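(* Let $1<p<\infty$ and $0<r\le p-1$, let $\omega\subseteq\mathbb R^N$, and let $\mathcal H$ and $K$ be as in the context. Then, in the sense of distributions, $$\int_\omega\nabla_z\mathcal H(x,\nabla u)\cdot\nabla\Big(\frac{u^{r+1}-v^{r+1}}{u^r}\Big)dx+\int_\omega\nabla_z\mathcal H(x,\nabla v)\cdot\nabla\Big(\frac{v^{r+1}-u^{r+1}}{v^r}\Big)dx$$ $$+\iint_{\omega\times\omega}K(x,y)[u(x)-u(y)]^{p-1}\Big(\frac{u(x)^{r+1}-v(x)^{r+1}}{u(x)^r}-\frac{u(y)^{r+1}-v(y)^{r+1}}{u(y)^r}\Big)dxdy$$ $$+\iint_{\omega\times\omega}K(x,y)[v(x)-v(y)]^{p-1}\Big(\frac{v(x)^{r+1}-u(x)^{r+1}}{v(x)^r}-\frac{v(y)^{r+1}-u(y)^{r+1}}{v(y)^r}\Big)dxdy\ \ge\ 0$$ for all $u,v\in W^{1,p}_0(\Omega)$ such that $u>0$ and $v>0$ a.e. in $\Omega$ and $u/v,\ v/u\in L^\infty(\Omega)$. Moreover, if equality holds, then: (i) $u/v\equiv\mathrm{const}>0$ a.e. in $\Omega$; (ii) if, in addition, $r+1\ne p$, then $u\equiv v$ a.e. in $\Omega$.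
   Context: $\Omega\subset\mathbb R^N$ is a bounded domain with smooth boundary, $N>p$, $s\in(0,1)$; $[a]^{p-1}:=|a|^{p-2}a$. Functions in $W^{1,p}_0(\Omega)$ are extended by zero to $\mathbb R^N$, and the quotients appearing in the inequality are understood to be $0$ where $u=v=0$. $K:\omega\times\omega\to\mathbb R^+$ is measurable, $K(x,y)=K(y,x)$ and $\frac{\kappa}{\Lambda|x-y|^{N+sp}}\le K(x,y)\le\frac{\kappa\Lambda}{|x-y|^{N+sp}}$ for a.e. $x,y\in\omega$, for fixed constants $\Lambda>0$, $\kappa\in(0,1]$. $\mathcal H=\mathcal H(x,z)\ge0$ is a Carathéodory function of $x$ (in the domain of integration) and $z\in\mathbb R^N$ such that $z\mapsto\mathcal H(x,z)$ is of class $C^1$ and convex, and $\mathcal H(x,tz)=|t|^p\mathcal H(x,z)$ for all $t\in\mathbb R$ and all $(x,z)$; $\nabla_z\mathcal H$ is its gradient in $z$.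
   Formalization: ω is assumed measurable and both local integrands integrable on ω, so that the integrals exist; (i) and (ii) a.e. in Ω are claimed only when Ω∖ω is a null set (they fail e.g. for a small ball ω with u=1, v=2 on ω); for general ω, (i) is claimed a.e. in Ω∩ω. *)

theory Defs
  imports "HOL-Analysis.Analysis"
begin

section \<open>Classical gradients, smooth functions, smooth boundaries\<close>

definition gradient :: "('a::euclidean_space \<Rightarrow> real) \<Rightarrow> 'a \<Rightarrow> 'a" where
  "gradient f x = (THE D. GDERIV f x :> D)"

primrec C_k :: "nat \<Rightarrow> ('a::euclidean_space \<Rightarrow> real) \<Rightarrow> bool" where
  "C_k 0 f \<longleftrightarrow> continuous_on UNIV f"
| "C_k (Suc k) f \<longleftrightarrow>
     (\<forall>x. f differentiable at x) \<and> (\<forall>h. C_k k (\<lambda>x. frechet_derivative f (at x) h))"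

definition smooth :: "('a::euclidean_space \<Rightarrow> real) \<Rightarrow> bool" where
  "smooth f \<longleftrightarrow> (\<forall>k. C_k k f)"

definition test_functions :: "'a::euclidean_space set \<Rightarrow> ('a \<Rightarrow> real) set" where
  "test_functions S =
     {\<phi>. smooth \<phi> \<and> compact (closure {x. \<phi> x \<noteq> 0}) \<and> closure {x. \<phi> x \<noteq> 0} \<subseteq> S}"

text \<open>Near every boundary point the set is the part above the graph of a smooth function. The
  direction \<open>e\<close> is the one of the last axis after rotating the coordinates; \<open>\<gamma>\<close> is only evaluated
  on the hyperplane orthogonal to \<open>e\<close>.\<close>

definition smooth_boundary :: "'a::euclidean_space set \<Rightarrow> bool" where
  "smooth_boundary \<Omega> \<longleftrightarrow>
     (\<forall>x0\<in>frontier \<Omega>. \<exists>\<delta>>0. \<exists>e \<gamma>. norm e = 1 \<and> smooth \<gamma> \<and>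
        \<Omega> \<inter> ball x0 \<delta> = {x \<in> ball x0 \<delta>. x \<bullet> e > \<gamma> (x - (x \<bullet> e) *\<^sub>R e)})"

section \<open>Sobolev spaces\<close>

definition Lp_on :: "real \<Rightarrow> 'a::euclidean_space set \<Rightarrow> ('a \<Rightarrow> 'b::euclidean_space) \<Rightarrow> bool" where
  "Lp_on p S f \<longleftrightarrow>
     f \<in> borel_measurable (lebesgue_on S) \<and> set_integrable lebesgue S (\<lambda>x. norm (f x) powr p)"

definition Linf_on :: "'a::euclidean_space set \<Rightarrow> ('a \<Rightarrow> real) \<Rightarrow> bool" where
  "Linf_on S f \<longleftrightarrow>
     f \<in> borel_measurable (lebesgue_on S) \<and> (\<exists>M. AE x in lebesgue_on S. \<bar>f x\<bar> \<le> M)"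

definition locally_integrable_on ::
    "('a::euclidean_space \<Rightarrow> 'b::euclidean_space) \<Rightarrow> 'a set \<Rightarrow> bool" (infixr "locally'_integrable'_on" 46)
  where "f locally_integrable_on S \<longleftrightarrow> (\<forall>C. compact C \<and> C \<subseteq> S \<longrightarrow> set_integrable lebesgue C f)"

definition has_weak_gradient_on ::
    "('a::euclidean_space \<Rightarrow> real) \<Rightarrow> ('a \<Rightarrow> 'a) \<Rightarrow> 'a set \<Rightarrow> bool" where
  "has_weak_gradient_on u g S \<longleftrightarrow>
     u locally_integrable_on S \<and> g locally_integrable_on S \<and>
     (\<forall>\<phi>\<in>test_functions S.
        (LINT x:S|lebesgue. u x *\<^sub>R gradient \<phi> x) = - (LINT x:S|lebesgue. \<phi> x *\<^sub>R g x))"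

text \<open>On an open set a weak gradient is unique up to null sets, so for a weakly differentiable
  function the choice is immaterial under integrals.\<close>

definition weak_grad_on :: "'a::euclidean_space set \<Rightarrow> ('a \<Rightarrow> real) \<Rightarrow> 'a \<Rightarrow> 'a" where
  "weak_grad_on S u = (SOME g. has_weak_gradient_on u g S)"

abbreviation weak_grad :: "('a::euclidean_space \<Rightarrow> real) \<Rightarrow> 'a \<Rightarrow> 'a" where
  "weak_grad \<equiv> weak_grad_on UNIV"

definition W1p :: "real \<Rightarrow> 'a::euclidean_space set \<Rightarrow> ('a \<Rightarrow> real) set" where
  "W1p p \<Omega> = {u. Lp_on p \<Omega> u \<and> (\<exists>g. has_weak_gradient_on u g \<Omega> \<and> Lp_on p \<Omega> g)}"

text \<open>The closure of the test functions in the norm of \<open>W1p p \<Omega>\<close>. The members are functions on the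
  whole space that vanish outside \<open>\<Omega>\<close>, i.e. they are already extended by zero.\<close>

definition W1p_0 :: "real \<Rightarrow> 'a::euclidean_space set \<Rightarrow> ('a \<Rightarrow> real) set" where
  "W1p_0 p \<Omega> =
     {u \<in> W1p p \<Omega>. (\<forall>x. x \<notin> \<Omega> \<longrightarrow> u x = 0) \<and>
        (\<exists>\<phi>. (\<forall>k. \<phi> k \<in> test_functions \<Omega>) \<and>
             (\<lambda>k::nat. (LINT x:\<Omega>|lebesgue. \<bar>u x - \<phi> k x\<bar> powr p) +
                  (LINT x:\<Omega>|lebesgue. norm (weak_grad_on \<Omega> u x - gradient (\<phi> k) x) powr p))
               \<longlonglongrightarrow> 0)}"

section \<open>The local and the nonlocal operator\<close>

text \<open>Measurability in \<open>x\<close> and continuity in \<open>z\<close> (part of the \<open>C\<^sup>1\<close> condition) make \<open>H\<close> a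
  Caratheodory function.\<close>

definition homogeneous_integrand ::
    "real \<Rightarrow> 'a::euclidean_space set \<Rightarrow> ('a \<Rightarrow> 'a \<Rightarrow> real) \<Rightarrow> bool" where
  "homogeneous_integrand p \<omega> H \<longleftrightarrow>
     (\<forall>z. (\<lambda>x. H x z) \<in> borel_measurable (lebesgue_on \<omega>)) \<and>
     (\<forall>x\<in>\<omega>. (\<forall>z. H x z \<ge> 0) \<and>
        (\<forall>z. H x differentiable at z) \<and> continuous_on UNIV (gradient (H x)) \<and>
        convex_on UNIV (H x) \<and>
        (\<forall>t z. H x (t *\<^sub>R z) = \<bar>t\<bar> powr p * H x z))"

definition fractional_kernel ::
    "real \<Rightarrow> real \<Rightarrow> real \<Rightarrow> real \<Rightarrow> 'a::euclidean_space set \<Rightarrow> ('a \<Rightarrow> 'a \<Rightarrow> real) \<Rightarrow> bool" where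
  "fractional_kernel p s \<kappa> \<Lambda> \<omega> K \<longleftrightarrow>
     (\<lambda>(x, y). K x y) \<in> borel_measurable (lebesgue_on (\<omega> \<times> \<omega>)) \<and>
     (\<forall>x\<in>\<omega>. \<forall>y\<in>\<omega>. K x y \<ge> 0) \<and>
     (AE (x, y) in lebesgue_on (\<omega> \<times> \<omega>).
        K x y = K y x \<and>
        \<kappa> / (\<Lambda> * norm (x - y) powr (real DIM('a) + s * p)) \<le> K x y \<and>
        K x y \<le> \<kappa> * \<Lambda> / norm (x - y) powr (real DIM('a) + s * p))"

text \<open>The power \<open>[a]\<^sup>q\<close> with \<open>[a]\<^bsup>p - 1\<^esup> = \<bar>a\<bar> powr (p - 2) * a\<close>.\<close>

definition signed_powr :: "real \<Rightarrow> real \<Rightarrow> real" where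
  "signed_powr a q = \<bar>a\<bar> powr (q - 1) * a"

text \<open>Since \<open>0 powr r = 0\<close> and division by zero yields zero, this is \<open>0\<close> where \<open>u = v = 0\<close>.\<close>

definition DS_quotient :: "real \<Rightarrow> ('a \<Rightarrow> real) \<Rightarrow> ('a \<Rightarrow> real) \<Rightarrow> 'a \<Rightarrow> real" where
  "DS_quotient r u v x = (u x powr (r + 1) - v x powr (r + 1)) / u x powr r"

definition local_integrand ::
    "('a::euclidean_space \<Rightarrow> 'a \<Rightarrow> real) \<Rightarrow> ('a \<Rightarrow> real) \<Rightarrow> ('a \<Rightarrow> real) \<Rightarrow> 'a \<Rightarrow> real" where
  "local_integrand H u \<phi> x = gradient (H x) (weak_grad u x) \<bullet> weak_grad \<phi> x"

definition nonlocal_integrand ::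
    "real \<Rightarrow> ('a::euclidean_space \<Rightarrow> 'a \<Rightarrow> real) \<Rightarrow> ('a \<Rightarrow> real) \<Rightarrow> ('a \<Rightarrow> real) \<Rightarrow> 'a \<times> 'a \<Rightarrow> real" where
  "nonlocal_integrand p K u \<phi> = (\<lambda>(x, y). K x y * signed_powr (u x - u y) (p - 1) * (\<phi> x - \<phi> y))"

text \<open>The left-hand side of the Diaz-Saa inequality. A double integral is taken with respect to
  Lebesgue measure on the product space.\<close>

definition DS_form ::
    "real \<Rightarrow> real \<Rightarrow> 'a::euclidean_space set \<Rightarrow> ('a \<Rightarrow> 'a \<Rightarrow> real) \<Rightarrow> ('a \<Rightarrow> 'a \<Rightarrow> real) \<Rightarrow>
     ('a \<Rightarrow> real) \<Rightarrow> ('a \<Rightarrow> real) \<Rightarrow> real" where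
  "DS_form p r \<omega> H K u v =
     (LINT x:\<omega>|lebesgue. local_integrand H u (DS_quotient r u v) x)
   + (LINT x:\<omega>|lebesgue. local_integrand H v (DS_quotient r v u) x)
   + (LINT z:\<omega> \<times> \<omega>|lebesgue. nonlocal_integrand p K u (DS_quotient r u v) z)
   + (LINT z:\<omega> \<times> \<omega>|lebesgue. nonlocal_integrand p K v (DS_quotient r v u) z)"

end

theory Submission
  imports Defs
begin

text \<open>
  Write \<open>q = r + 1 \<le> p\<close>. Both the local and the nonlocal part of the form are integrals of functions
  that are nonnegative almost everywhere, and the equality case is read off from the nonlocal part
  alone.

  Local part. By the chain rule the quotient \<open>u - v\<^sup>q / u\<^sup>r\<close> has the weak gradient
  \<open>(1 + r \<tau>\<^sup>q) \<nabla>u - q \<tau>\<^sup>r \<nabla>v\<close> with \<open>\<tau> = v / u\<close>. Euler's identity evaluates the products of a gradient of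
  the integrand with its own argument, and convexity together with homogeneity bounds the mixed
  products as in Young's inequality (\<open>local_DS_inequality\<close>). What remains is an inequality between
  real numbers, which Bernoulli's inequality reduces to
  \<open>(1 - \<sigma>\<^sup>q) (1 - \<sigma>\<^bsup>p-q\<^esup>) \<ge> 0\<close> (\<open>DS_scalar_inequality\<close>).

  Nonlocal part. The discrete Picone inequality (\<open>discrete_Picone\<close>) bounds the sum of the two
  integrands, up to the kernel, from below by \<open>(A\<^sup>q - C\<^sup>q) (A\<^bsup>p-q\<^esup> - C\<^bsup>p-q\<^esup>) \<ge> 0\<close>, where \<open>A\<close> and \<open>C\<close> are the
  absolute differences of \<open>u\<close> and of \<open>v\<close> at the two points. Strict convexity of the power shows that
  equality forces \<open>u / v\<close> to agree at the two points, and also \<open>A = C\<close> if \<open>q \<noteq> p\<close>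
  (\<open>nonlocal_DS_inequality\<close>). By Fubini \<open>u / v\<close> is a constant \<open>c\<close>. If \<open>q \<noteq> p\<close> and \<open>c \<noteq> 1\<close>, then \<open>A = c C = C\<close>
  makes \<open>v\<close> constant on \<open>\<Omega>\<close>, which is impossible for a positive function that vanishes on the boundary
  in the Sobolev sense (\<open>W1p_0_not_constant\<close>).

  The analytic content is that all these expressions make sense. The quotient is a Lipschitz function
  of \<open>u\<close> and \<open>v\<close> on the cone in which the ratios are bounded. Its weak gradient is obtained from a chain
  rule for \<open>C\<^sup>1\<close> functions of two Sobolev functions (\<open>W11_chain_rule\<close>) and a regularisation at the origin
  (\<open>DS_quotient_weak_gradient\<close>); the nonlocal integrands are dominated by the Gagliardo integrands of \<open>u\<close>
  and \<open>v\<close>, which are integrable because \<open>W\<^bsup>1,p\<^esup>\<^sub>0\<close> embeds into the fractional space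
  (\<open>gagliardo_integrable\<close>, \<open>nonlocal_integrable\<close>). Uniqueness of weak gradients
  (\<open>fundamental_lemma\<close>) ties the gradients chosen in the definitions to the computed ones.
\<close>


section \<open>Smooth bump functions\<close>

lemma C_k_imp_continuous: "C_k k f \<Longrightarrow> continuous_on UNIV f"
proof (cases k)
  case (Suc n)
  assume "C_k k f"
  then have "\<forall>x. f differentiable at x" using Suc by simp
  then show ?thesis
    by (intro differentiable_imp_continuous_on) (simp add: differentiable_on_def)
qed simp

lemma C_k_SucD: "C_k (Suc k) f \<Longrightarrow> C_k k f"
proof (induction k arbitrary: f)
  case 0
  then show ?case using C_k_imp_continuous[of "Suc 0" f] by simp
next
  case (Suc k)
  then show ?case by auto
qed

lemma C_k_SucI:
  assumes "\<And>x. (f has_derivative f' x) (at x)" "\<And>h. C_k k (\<lambda>x. f' x h)"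
  shows "C_k (Suc k) f"
proof -
  have "frechet_derivative f (at x) = f' x" for x
    using frechet_derivative_at[OF assms(1)] by simp
  then show ?thesis using assms by (auto simp: differentiable_def)
qed

lemma C_k_has_derivative:
  "C_k (Suc k) f \<Longrightarrow> (f has_derivative frechet_derivative f (at x)) (at x)"
  by (simp add: frechet_derivative_works)

lemma C_k_const: "C_k k (\<lambda>x. c)"
proof (induction k arbitrary: c)
  case (Suc k)
  show ?case by (rule C_k_SucI[where f' = "\<lambda>x h. 0"]) (auto intro: Suc)
qed simp

lemma C_k_add: "C_k k f \<Longrightarrow> C_k k g \<Longrightarrow> C_k k (\<lambda>x. f x + g x)"
proof (induction k arbitrary: f g)
  case 0 then show ?case by (simp add: continuous_on_add)
next
  case (Suc k)
  show ?case
    by (rule C_k_SucI[OF has_derivative_add[OF C_k_has_derivative C_k_has_derivative, OF Suc.prems]])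
      (use Suc in auto)
qed

lemma C_k_mult: "C_k k f \<Longrightarrow> C_k k g \<Longrightarrow> C_k k (\<lambda>x. f x * g x)"
proof (induction k arbitrary: f g)
  case 0 then show ?case by (simp add: continuous_on_mult)
next
  case (Suc k)
  have "C_k k f" "C_k k g" using Suc.prems C_k_SucD by blast+
  then show ?case
    by (intro C_k_SucI[OF has_derivative_mult[OF C_k_has_derivative C_k_has_derivative, OF Suc.prems]])
      (use Suc in \<open>auto intro!: Suc.IH C_k_add\<close>)
qed

lemma C_k_prod: "finite I \<Longrightarrow> (\<And>i. i \<in> I \<Longrightarrow> C_k k (f i)) \<Longrightarrow> C_k k (\<lambda>x. \<Prod>i\<in>I. f i x)"
  by (induction I rule: finite_induct) (auto intro: C_k_const C_k_mult)

lemma C_k_compose_affine: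
  fixes f :: "real \<Rightarrow> real"
  shows "C_k k f \<Longrightarrow> C_k k (\<lambda>x. f (x \<bullet> b + c))"
proof (induction k arbitrary: f)
  case 0
  then show ?case
    by (auto intro!: continuous_intros continuous_on_compose2[of UNIV f])
next
  case (Suc k)
  let ?D = "\<lambda>x h. frechet_derivative f (at (x \<bullet> b + c)) (h \<bullet> b)"
  show ?case
  proof (rule C_k_SucI[where f' = ?D])
    fix x
    have "((\<lambda>x. x \<bullet> b + c) has_derivative (\<lambda>h. h \<bullet> b)) (at x)"
      by (auto intro!: derivative_eq_intros)
    from has_derivative_compose[OF this C_k_has_derivative[OF Suc.prems]]
    show "((\<lambda>x. f (x \<bullet> b + c)) has_derivative ?D x) (at x)" by simp
  next
    fix h
    show "C_k k (\<lambda>x. ?D x h)"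
      using Suc.IH[of "\<lambda>t. frechet_derivative f (at t) (h \<bullet> b)"] Suc.prems by simp
  qed
qed

text \<open>The derivatives of \<open>exp (- 1 / t)\<close>, continued by zero to \<open>t \<le> 0\<close>, are combinations of
  the functions of this family, so smoothness of all members follows by one induction.\<close>

definition flat :: "nat \<Rightarrow> real \<Rightarrow> real" where
  "flat n t = (if t > 0 then exp (- 1 / t) / t ^ n else 0)"

text \<open>The exponential beats every power: keeping only the term of degree \<open>n + 1\<close> in the series of
  \<open>exp (1 / t)\<close> suffices. The linear bound yields differentiability at the origin.\<close>

lemma flat_bound: 
  assumes "t > 0"
  shows "flat n t \<le> fact (Suc n) * t"
proof -
  have "inverse (fact (Suc n)) * (1/t) ^ Suc n \<le> exp (1/t)"
  proof -
    have "(\<Sum>k\<in>{Suc n}. (1/t) ^ k /\<^sub>R fact k) \<le> (\<Sum>k. (1/t) ^ k /\<^sub>R fact k)"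
      by (rule sum_le_suminf[OF summable_exp_generic]) (use assms in auto)
    then show ?thesis by (simp add: exp_def)
  qed
  then have "1 / (fact (Suc n) * t ^ Suc n) \<le> exp (1/t)"
    by (simp add: field_simps power_divide)
  then have "1 / exp (1/t) \<le> fact (Suc n) * t ^ Suc n"
    using assms by (simp add: field_simps del: fact_Suc)
  then show ?thesis using assms
    by (simp add: flat_def exp_minus field_simps del: fact_Suc)
qed

lemma flat_has_derivative:
  "(flat n has_real_derivative - real n * flat (Suc n) t + flat (Suc (Suc n)) t) (at t)"
proof -
  consider "t > 0" | "t < 0" | "t = 0" by linarith
  then show ?thesis
  proof cases
    case 1
    have "((\<lambda>t. exp (- 1 / t) / t ^ n) has_real_derivative
        - real n * flat (Suc n) t + flat (Suc (Suc n)) t) (at t)"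
      using 1 by (auto intro!: derivative_eq_intros simp: flat_def field_simps power_Suc
          simp flip: power_Suc power_Suc2)
        (cases n; simp add: field_simps)
    then show ?thesis
      by (rule has_field_derivative_transform_within_open[where S = "{0<..}"])
        (use 1 in \<open>auto simp: flat_def\<close>)
  next
    case 2
    have "((\<lambda>t. 0) has_real_derivative - real n * flat (Suc n) t + flat (Suc (Suc n)) t) (at t)"
      using 2 by (simp add: flat_def)
    then show ?thesis
      by (rule has_field_derivative_transform_within_open[where S = "{..<0}"])
        (use 2 in \<open>auto simp: flat_def\<close>)
  next
    case 3
    have "((\<lambda>h. flat n h / h) \<longlongrightarrow> 0) (at 0)"
    proof (rule Lim_null_comparison)
      show "\<forall>\<^sub>F h in at 0. norm (flat n h / h) \<le> fact (Suc (Suc n)) * \<bar>h\<bar>"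
      proof (rule always_eventually, rule allI)
        fix h :: real
        show "norm (flat n h / h) \<le> fact (Suc (Suc n)) * \<bar>h\<bar>"
        proof (cases "h > 0")
          case True
          have "flat n h / h = flat (Suc n) h" by (simp add: flat_def)
          moreover have "0 \<le> flat (Suc n) h" using True by (simp add: flat_def)
          ultimately show ?thesis using flat_bound[OF True, of "Suc n"] True by (simp del: fact_Suc)
        qed (simp add: flat_def abs_real_def del: fact_Suc)
      qed
      show "((\<lambda>h. fact (Suc (Suc n)) * \<bar>h\<bar>) \<longlongrightarrow> (0::real)) (at 0)"
        by (rule tendsto_eq_intros refl)+ simp
    qed
    then show ?thesis using 3 by (simp add: DERIV_def flat_def)
  qed
qed

lemma C_k_flat: "C_k k (flat n)"
proof (induction k arbitrary: n)
  case 0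
  show ?case using flat_has_derivative[of n]
    by (auto intro!: continuous_at_imp_continuous_on DERIV_isCont)
next
  case (Suc k)
  show ?case
    by (rule C_k_SucI[OF flat_has_derivative[of n, unfolded has_field_derivative_def]])
      (intro C_k_mult C_k_add C_k_const Suc)
qed

text \<open>The scaling by \<open>n\<close> lets the bumps increase to the indicator of the open box, because
  \<open>exp (- 1 / (n t))\<close> tends to \<open>1\<close> for each \<open>t > 0\<close>; so test functions detect integrals over boxes.\<close>

definition box_bump :: "nat \<Rightarrow> 'a \<Rightarrow> 'a \<Rightarrow> 'a::euclidean_space \<Rightarrow> real" where
  "box_bump n a b x =
     (\<Prod>i\<in>Basis. flat 0 (real n * (x \<bullet> i - a \<bullet> i)) * flat 0 (real n * (b \<bullet> i - x \<bullet> i)))"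

lemma flat0_range: "0 \<le> flat 0 t" "flat 0 t \<le> 1"
  by (auto simp: flat_def)

lemma box_bump_range: "0 \<le> box_bump n a b x" "box_bump n a b x \<le> 1"
  unfolding box_bump_def
  by (auto intro!: prod_nonneg prod_le_1 mult_le_one mult_nonneg_nonneg flat0_range)

lemma box_bump_support: "box_bump n a b x \<noteq> 0 \<Longrightarrow> x \<in> box a b"
proof -
  assume "box_bump n a b x \<noteq> 0"
  then have *: "flat 0 (real n * (x \<bullet> i - a \<bullet> i)) \<noteq> 0 \<and> flat 0 (real n * (b \<bullet> i - x \<bullet> i)) \<noteq> 0"
    if "i \<in> Basis" for i
    using that by (auto simp: box_bump_def)
  have "a \<bullet> i < x \<bullet> i \<and> x \<bullet> i < b \<bullet> i" if "i \<in> Basis" for i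
    using *[OF that] by (auto simp: flat_def zero_less_mult_iff split: if_splits)
  then show ?thesis by (auto simp: mem_box)
qed

lemma smooth_box_bump: "smooth (box_bump n a b)"
  unfolding smooth_def
proof
  fix k
  have 1: "C_k k (\<lambda>x. flat 0 (real n * (x \<bullet> i - a \<bullet> i)))" for i
    using C_k_compose_affine[OF C_k_flat[of k 0], of "real n *\<^sub>R i" "- (real n * (a \<bullet> i))"]
    by (simp add: algebra_simps)
  have 2: "C_k k (\<lambda>x. flat 0 (real n * (b \<bullet> i - x \<bullet> i)))" for i
    using C_k_compose_affine[OF C_k_flat[of k 0], of "- real n *\<^sub>R i" "real n * (b \<bullet> i)"]
    by (simp add: algebra_simps)
  show "C_k k (box_bump n a b)"
    unfolding box_bump_def[abs_def] by (intro C_k_prod C_k_mult 1 2) simp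
qed

lemma box_bump_test_function:
  assumes "cbox a b \<subseteq> S"
  shows "box_bump n a b \<in> test_functions S"
proof -
  have "closure {x. box_bump n a b x \<noteq> 0} \<subseteq> cbox a b"
    using box_bump_support box_subset_cbox by (intro closure_minimal) (blast, simp add: closed_cbox)
  then show ?thesis
    using assms smooth_box_bump
    by (auto simp: test_functions_def intro: compact_closure[THEN iffD2] bounded_subset[OF bounded_cbox] closure_subset
        dest: subset_trans[OF closure_subset])
qed

lemma box_bump_tendsto: "(\<lambda>n. box_bump n a b x) \<longlonglongrightarrow> indicator (box a b) x"
proof (cases "x \<in> box a b")
  case False
  then show ?thesis using box_bump_support[of _ a b x] by (auto intro!: tendsto_eventually always_eventually)
next
  case True
  have lim: "(\<lambda>n. flat 0 (real n * t)) \<longlonglongrightarrow> 1" if "t > 0" for t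
  proof -
    have "(\<lambda>n. exp (- (1 / t) / real n)) \<longlonglongrightarrow> exp 0"
      by (intro tendsto_intros)
    moreover have "\<forall>\<^sub>F n in sequentially. exp (- (1 / t) / real n) = flat 0 (real n * t)"
      using eventually_gt_at_top[of 0] by eventually_elim (use that in \<open>auto simp: flat_def field_simps\<close>)
    ultimately show ?thesis by (simp add: tendsto_cong)
  qed
  have "(\<lambda>n. box_bump n a b x) \<longlonglongrightarrow> (\<Prod>i\<in>(Basis::'a set). 1 * 1)"
    unfolding box_bump_def using True
    by (intro tendsto_prod tendsto_mult lim) (auto simp: mem_box)
  then show ?thesis using True by simp
qed

section \<open>Weak gradients\<close>

lemma functional_eq_inner:
  fixes f :: "'a::euclidean_space \<Rightarrow> real"
  assumes "bounded_linear f"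
  shows "f h = h \<bullet> (\<Sum>b\<in>Basis. f b *\<^sub>R b)"
proof -
  interpret bounded_linear f by fact
  have "f h = f (\<Sum>b\<in>Basis. (h \<bullet> b) *\<^sub>R b)" by (simp add: euclidean_representation)
  also have "\<dots> = (\<Sum>b\<in>Basis. (h \<bullet> b) * f b)" unfolding sum scaleR by simp
  finally show ?thesis by (simp add: inner_sum_right mult.commute)
qed

lemma GDERIV_unique: "GDERIV f x :> D \<Longrightarrow> GDERIV f x :> E \<Longrightarrow> D = E"
proof -
  assume "GDERIV f x :> D" "GDERIV f x :> E"
  then have "(\<lambda>h. h \<bullet> D) = (\<lambda>h. h \<bullet> E)"
    unfolding gderiv_def by (rule has_derivative_unique)
  then have "\<forall>h. h \<bullet> D = h \<bullet> E" by (rule fun_cong[THEN allI])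
  then show "D = E" by (simp add: vector_eq_ldot)
qed

lemma gradient_eqI: "GDERIV f x :> D \<Longrightarrow> gradient f x = D"
  unfolding gradient_def by (blast intro: GDERIV_unique)

lemma differentiable_GDERIV:
  fixes f :: "'a::euclidean_space \<Rightarrow> real"
  assumes "f differentiable at x"
  shows "GDERIV f x :> (\<Sum>b\<in>Basis. frechet_derivative f (at x) b *\<^sub>R b)"
    and "GDERIV f x :> gradient f x"
proof -
  have d: "(f has_derivative frechet_derivative f (at x)) (at x)"
    using assms by (simp add: frechet_derivative_works)
  have "(\<lambda>h. h \<bullet> (\<Sum>b\<in>Basis. frechet_derivative f (at x) b *\<^sub>R b)) = frechet_derivative f (at x)"
    by (rule ext, rule functional_eq_inner[OF has_derivative_bounded_linear[OF d], symmetric])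
  then show "GDERIV f x :> (\<Sum>b\<in>Basis. frechet_derivative f (at x) b *\<^sub>R b)"
    using d by (simp add: gderiv_def)
  then show "GDERIV f x :> gradient f x" by (simp only: gradient_eqI)
qed

lemma GDERIV_isCont: "GDERIV f x :> D \<Longrightarrow> isCont f x"
  unfolding gderiv_def by (rule has_derivative_continuous)

definition C1_grad :: "('a::euclidean_space \<Rightarrow> real) \<Rightarrow> ('a \<Rightarrow> 'a) \<Rightarrow> bool" where
  "C1_grad f g \<longleftrightarrow> (\<forall>x. GDERIV f x :> g x) \<and> continuous_on UNIV g"

definition C1c_grad :: "('a::euclidean_space \<Rightarrow> real) \<Rightarrow> ('a \<Rightarrow> 'a) \<Rightarrow> bool" where
  "C1c_grad f g \<longleftrightarrow> C1_grad f g \<and> bounded {x. f x \<noteq> 0}"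

lemma C1_grad_continuous: "C1_grad f g \<Longrightarrow> continuous_on UNIV f"
  by (auto simp: C1_grad_def intro!: continuous_at_imp_continuous_on GDERIV_isCont)

lemma C1_grad_mult:
  "C1_grad f g \<Longrightarrow> C1_grad h k \<Longrightarrow> C1_grad (\<lambda>x. f x * h x) (\<lambda>x. f x *\<^sub>R k x + h x *\<^sub>R g x)"
  using C1_grad_continuous[of f g] C1_grad_continuous[of h k]
  by (auto simp: C1_grad_def intro!: GDERIV_mult continuous_intros)

lemma C1c_grad_mult:
  assumes "C1c_grad f g" "C1_grad h k"
  shows "C1c_grad (\<lambda>x. f x * h x) (\<lambda>x. f x *\<^sub>R k x + h x *\<^sub>R g x)"
  using assms C1_grad_mult[of f g h k]
  by (auto simp: C1c_grad_def intro: bounded_subset)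

lemma test_function_C1c:
  assumes "\<phi> \<in> test_functions S"
  shows "C1c_grad \<phi> (gradient \<phi>)"
proof -
  have C: "C_k 1 \<phi>" and cp: "compact (closure {x. \<phi> x \<noteq> 0})"
    using assms by (auto simp: test_functions_def smooth_def)
  then have d: "\<phi> differentiable at x" for x by simp
  have "gradient \<phi> = (\<lambda>x. \<Sum>b\<in>Basis. frechet_derivative \<phi> (at x) b *\<^sub>R b)"
    using gradient_eqI[OF differentiable_GDERIV(1)[OF d]] by auto
  moreover have "continuous_on UNIV (\<lambda>x. \<Sum>b\<in>Basis. frechet_derivative \<phi> (at x) b *\<^sub>R b)"
    using C by (auto intro!: continuous_intros)
  ultimately show ?thesis
    using differentiable_GDERIV(2)[OF d] bounded_subset[OF compact_imp_bounded[OF cp] closure_subset]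
    by (simp add: C1c_grad_def C1_grad_def)
qed

lemma gradient_zero_off_support:
  assumes "\<And>x. GDERIV f x :> g x" "x \<notin> closure {x. f x \<noteq> 0}"
  shows "g x = 0"
proof -
  have "((\<lambda>x. 0) has_derivative (\<lambda>h. h \<bullet> 0)) (at x)" by simp
  then have "(f has_derivative (\<lambda>h. h \<bullet> 0)) (at x)"
    by (rule has_derivative_transform_within_open[where s = "- closure {x. f x \<noteq> 0}"])
      (use assms(2) closure_subset[of "{x. f x \<noteq> 0}"] in auto)
  then have "GDERIV f x :> 0" unfolding gderiv_def .
  then show ?thesis by (rule GDERIV_unique[OF assms(1)])
qed

lemma C1c_grad_support:
  assumes "C1c_grad f g"
  obtains R where "R > 0" "\<And>x. x \<notin> cball 0 R \<Longrightarrow> f x = 0" "\<And>x. x \<notin> cball 0 R \<Longrightarrow> g x = 0"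
proof -
  have "bounded (closure {x. f x \<noteq> 0})" using assms by (auto simp: C1c_grad_def)
  then obtain R where R: "R > 0" "closure {x. f x \<noteq> 0} \<subseteq> cball 0 R"
    unfolding bounded_pos by (meson mem_cball_0 subsetI)
  have "x \<notin> closure {x. f x \<noteq> 0}" if "x \<notin> cball 0 R" for x
    using that R(2) by blast
  then have "f x = 0" "g x = 0" if "x \<notin> cball 0 R" for x
    using that gradient_zero_off_support[of f g x] assms closure_subset[of "{x. f x \<noteq> 0}"]
    by (auto simp: C1c_grad_def C1_grad_def)
  then show ?thesis using R(1) that by blast
qed

lemma continuous_compact_support_integrable:
  fixes f :: "'a::euclidean_space \<Rightarrow> 'b::euclidean_space"
  assumes "continuous_on UNIV f" "\<And>x. x \<notin> cball 0 R \<Longrightarrow> f x = 0"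
  shows "integrable lborel f" and "\<exists>B. \<forall>x. norm (f x) \<le> B"
proof -
  have "integrable lborel (\<lambda>x. indicator (cball 0 R) x *\<^sub>R f x)"
    by (intro borel_integrable_compact) (auto intro: continuous_on_subset[OF assms(1)])
  moreover have "(\<lambda>x. indicator (cball 0 R) x *\<^sub>R f x) = f"
    using assms(2) by (auto simp: indicator_def fun_eq_iff)
  ultimately show "integrable lborel f" by simp
  have "bounded (f ` cball 0 R)"
    by (intro compact_imp_bounded compact_continuous_image) (auto intro: continuous_on_subset[OF assms(1)])
  then obtain B where "\<And>x. x \<in> cball 0 R \<Longrightarrow> norm (f x) \<le> B"
    unfolding bounded_iff by blast
  then have "norm (f x) \<le> max B 0" for x using assms(2)[of x] by (cases "x \<in> cball 0 R") force+
  then show "\<exists>B. \<forall>x. norm (f x) \<le> B" by blast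
qed

lemma C1c_grad_integrable:
  assumes "C1c_grad f g"
  shows "integrable lborel f" "integrable lborel g" "\<exists>B. \<forall>x. \<bar>f x\<bar> \<le> B" "\<exists>B. \<forall>x. norm (g x) \<le> B"
proof -
  obtain R where "\<And>x. x \<notin> cball 0 R \<Longrightarrow> f x = 0" "\<And>x. x \<notin> cball 0 R \<Longrightarrow> g x = 0"
    using C1c_grad_support[OF assms] by metis
  moreover have "continuous_on UNIV f" "continuous_on UNIV g"
    using assms C1_grad_continuous[of f g] by (auto simp: C1c_grad_def C1_grad_def)
  ultimately show "integrable lborel f" "integrable lborel g"
      "\<exists>B. \<forall>x. \<bar>f x\<bar> \<le> B" "\<exists>B. \<forall>x. norm (g x) \<le> B"
    using continuous_compact_support_integrable[of f R] continuous_compact_support_integrable[of g R]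
    by simp_all
qed

lemma GDERIV_difference_quotient:
  assumes "GDERIV f x :> D"
  shows "((\<lambda>h. (f (x + h *\<^sub>R e) - f x) / h) \<longlongrightarrow> e \<bullet> D) (at 0)"
proof -
  have "((\<lambda>h. x + h *\<^sub>R e) has_derivative (\<lambda>h. h *\<^sub>R e)) (at 0)"
    by (auto intro!: derivative_eq_intros)
  moreover have "(f has_derivative (\<lambda>h. h \<bullet> D)) (at (x + 0 *\<^sub>R e))"
    using assms by (simp add: gderiv_def)
  ultimately have "((\<lambda>h. f (x + h *\<^sub>R e)) has_derivative (\<lambda>h. (h *\<^sub>R e) \<bullet> D)) (at 0)"
    by (rule has_derivative_compose)
  then have "((\<lambda>h. f (x + h *\<^sub>R e)) has_field_derivative (e \<bullet> D)) (at 0)"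
    unfolding has_field_derivative_def by (simp add: mult.commute[of _ "e \<bullet> D"])
  then show ?thesis by (simp add: DERIV_def)
qed

lemma C1_Lipschitz:
  assumes "\<And>x. GDERIV f x :> g x" "\<And>x. norm (g x) \<le> B"
  shows "\<bar>f x - f y\<bar> \<le> B * norm (x - y)"
proof -
  have "norm (f x - f y) \<le> B * norm (x - y)"
  proof (rule differentiable_bound[of UNIV])
    fix x show "(f has_derivative (\<lambda>h. h \<bullet> g x)) (at x within UNIV)"
      using assms(1) by (simp add: gderiv_def)
    have "norm (h \<bullet> g x) \<le> B * norm h" for h
      using Cauchy_Schwarz_ineq2[of h "g x"] mult_left_mono[OF assms(2)[of x] norm_ge_zero[of h]]
      by (simp add: mult.commute)
    then show "onorm (\<lambda>h. h \<bullet> g x) \<le> B"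
      by (intro onorm_bound) (use assms(2)[of x] norm_ge_zero[of "g x"] in linarith)+
  qed auto
  then show ?thesis by simp
qed

lemma lborel_integral_translate:
  fixes f :: "'a::euclidean_space \<Rightarrow> 'b::{banach, second_countable_topology}"
  assumes [measurable]: "f \<in> borel_measurable borel"
  shows "(\<integral>x. f (x + c) \<partial>lborel) = (\<integral>x. f x \<partial>lborel)"
    "integrable lborel f \<Longrightarrow> integrable lborel (\<lambda>x. f (x + c))"
proof -
  have "(\<integral>x. f x \<partial>lborel) = (\<integral>x. f x \<partial>(distr lborel borel ((+) c)))"
    by (simp add: lborel_distr_plus)
  also have "\<dots> = (\<integral>x. f (c + x) \<partial>lborel)" by (rule integral_distr) auto
  finally show "(\<integral>x. f (x + c) \<partial>lborel) = (\<integral>x. f x \<partial>lborel)" by (simp add: add.commute)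
  show "integrable lborel (\<lambda>x. f (x + c))" if "integrable lborel f"
  proof -
    have "integrable (distr lborel borel ((+) c)) f" using that by (simp add: lborel_distr_plus)
    then show ?thesis by (subst (asm) integrable_distr_eq) (auto simp: add.commute)
  qed
qed

text \<open>The integrals of the difference quotients vanish by translation invariance.\<close>

lemma integral_gradient_C1c:
  assumes "C1c_grad f g"
  shows "(\<integral>x. g x \<partial>lborel) = 0"
proof -
  have G: "\<And>x. GDERIV f x :> g x" and cf: "continuous_on UNIV f" and cg: "continuous_on UNIV g"
    using assms C1_grad_continuous[of f g] by (auto simp: C1c_grad_def C1_grad_def)
  note int = C1c_grad_integrable[OF assms]
  obtain B where B: "\<And>x. norm (g x) \<le> B" using int(4) by blast
  have "B \<ge> 0" using B[of 0] norm_ge_zero order_trans by blast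
  obtain R where R: "R > 0" "\<And>x. x \<notin> cball 0 R \<Longrightarrow> f x = 0" using C1c_grad_support[OF assms] by metis
  have [measurable]: "f \<in> borel_measurable borel" "g \<in> borel_measurable borel"
    using cf cg by (auto intro: borel_measurable_continuous_onI)
  have zero: "e \<bullet> (\<integral>x. g x \<partial>lborel) = 0" if e: "norm e = 1" for e
  proof -
    let ?h = "\<lambda>n. 1 / real (Suc n)"
    let ?q = "\<lambda>n x. (f (x + ?h n *\<^sub>R e) - f x) / ?h n"
    have h0: "filterlim ?h (at 0) sequentially"
      by (auto simp: filterlim_at simp del: of_nat_Suc intro!: LIMSEQ_Suc[of "\<lambda>n. 1 / real n"] lim_1_over_n)
    have "(\<lambda>n. \<integral>x. ?q n x \<partial>lborel) \<longlonglongrightarrow> (\<integral>x. e \<bullet> g x \<partial>lborel)"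
    proof (rule integral_dominated_convergence[where w = "\<lambda>x. indicator (cball 0 (R + 1)) x *\<^sub>R B"])
      show "AE x in lborel. (\<lambda>n. ?q n x) \<longlonglongrightarrow> e \<bullet> g x"
        using filterlim_compose[OF GDERIV_difference_quotient[OF G] h0] by simp
      show "AE x in lborel. norm (?q n x) \<le> indicator (cball 0 (R + 1)) x *\<^sub>R B" for n
      proof (rule AE_I2)
        fix x
        show "norm (?q n x) \<le> indicator (cball 0 (R + 1)) x *\<^sub>R B"
        proof (cases "x \<in> cball 0 (R + 1)")
          case True
          have "\<bar>f (x + ?h n *\<^sub>R e) - f x\<bar> \<le> B * norm (x + ?h n *\<^sub>R e - x)"
            using C1_Lipschitz[OF G B] .
          also have "\<dots> = B * ?h n" using e by simp
          finally have "\<bar>f (x + ?h n *\<^sub>R e) - f x\<bar> / ?h n \<le> B"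
            by (subst pos_divide_le_eq) auto
          then have "\<bar>?q n x\<bar> \<le> B" by (simp add: abs_mult)
          then show ?thesis using True by (simp del: abs_divide)
        next
          case False
          have "norm x \<le> norm (x + ?h n *\<^sub>R e) + norm (?h n *\<^sub>R e)"
            using norm_triangle_sub[of x "x + ?h n *\<^sub>R e"] by simp
          also have "norm (?h n *\<^sub>R e) \<le> 1" using e by simp
          finally have "x + ?h n *\<^sub>R e \<notin> cball 0 R" using False by auto
          then have "f (x + ?h n *\<^sub>R e) = 0" "f x = 0" using R(2) False by auto
          then show ?thesis using False by simp
        qed
      qed
      show "integrable lborel (\<lambda>x. indicator (cball 0 (R + 1)) x *\<^sub>R B)"
        by (intro borel_integrable_compact) auto
    qed measurable
    moreover have "(\<integral>x. ?q n x \<partial>lborel) = 0" for n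
      using int(1) lborel_integral_translate[of f "?h n *\<^sub>R e"] by simp
    ultimately have "(\<lambda>n. 0) \<longlonglongrightarrow> (\<integral>x. e \<bullet> g x \<partial>lborel)" by (simp only:)
    then have "(\<integral>x. e \<bullet> g x \<partial>lborel) = 0" using LIMSEQ_const_iff by metis
    then show ?thesis using int(2) by simp
  qed
  show ?thesis
    by (rule euclidean_eqI) (use zero in \<open>simp add: inner_commute\<close>)
qed

lemma integration_by_parts_C1:
  assumes "C1c_grad f g" "C1_grad h k"
  shows "integrable lborel (\<lambda>x. f x *\<^sub>R k x)" "integrable lborel (\<lambda>x. h x *\<^sub>R g x)"
    "(\<integral>x. h x *\<^sub>R g x \<partial>lborel) = - (\<integral>x. f x *\<^sub>R k x \<partial>lborel)"
proof -
  obtain R where R: "\<And>x. x \<notin> cball 0 R \<Longrightarrow> f x = 0" "\<And>x. x \<notin> cball 0 R \<Longrightarrow> g x = 0"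
    using C1c_grad_support[OF assms(1)] by metis
  have c: "continuous_on UNIV f" "continuous_on UNIV g" "continuous_on UNIV h" "continuous_on UNIV k"
    using assms C1_grad_continuous by (auto simp: C1c_grad_def C1_grad_def)
  show i: "integrable lborel (\<lambda>x. f x *\<^sub>R k x)" "integrable lborel (\<lambda>x. h x *\<^sub>R g x)"
    by (rule continuous_compact_support_integrable(1)[of _ R]; use R c in \<open>auto intro!: continuous_intros\<close>)+
  show "(\<integral>x. h x *\<^sub>R g x \<partial>lborel) = - (\<integral>x. f x *\<^sub>R k x \<partial>lborel)"
    using integral_gradient_C1c[OF C1c_grad_mult[OF assms]] i by (simp add: eq_neg_iff_add_eq_0 add.commute)
qed

text \<open>By Henstock's lemma, in a fine division the terms of a Riemann sum are close to the integrals over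
  the boxes even when the errors are added in norm. These integrals vanish, so the Riemann sums of the
  norm are arbitrarily small.\<close>

lemma zero_box_integrals_imp_AE_zero:
  fixes f :: "'a::euclidean_space \<Rightarrow> 'b::euclidean_space"
  assumes f: "f absolutely_integrable_on cbox a b"
    and zero: "\<And>c d. cbox c d \<subseteq> cbox a b \<Longrightarrow> integral (cbox c d) f = 0"
  shows "AE x in lebesgue. x \<in> cbox a b \<longrightarrow> f x = 0"
proof -
  have intf: "f integrable_on cbox a b"
    using f by (rule set_lebesgue_integral_eq_integral(1))
  have "((\<lambda>x. norm (f x)) has_integral 0) (cbox a b)"
    unfolding has_integral
  proof (intro allI impI)
    fix e :: real assume "e > 0"
    obtain \<gamma> where \<gamma>: "gauge \<gamma>" 
      "\<And>p. \<lbrakk>p tagged_partial_division_of (cbox a b); \<gamma> fine p\<rbrakk> \<Longrightarrow>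
             sum (\<lambda>(x,k). norm(measure lborel k *\<^sub>R f x - integral k f)) p < e"
      using Henstock_lemma[OF intf \<open>e > 0\<close>] by blast
    show "\<exists>\<gamma>. gauge \<gamma> \<and> (\<forall>\<D>. \<D> tagged_division_of cbox a b \<and> \<gamma> fine \<D> \<longrightarrow>
             norm ((\<Sum>(x, k)\<in>\<D>. measure lborel k *\<^sub>R norm (f x)) - 0) < e)"
    proof (intro exI conjI allI impI)
      fix \<D> assume D: "\<D> tagged_division_of cbox a b \<and> \<gamma> fine \<D>"
      have "(\<Sum>(x, k)\<in>\<D>. measure lborel k *\<^sub>R norm (f x)) = (\<Sum>(x,k)\<in>\<D>. norm(measure lborel k *\<^sub>R f x - integral k f))"
      proof (rule sum.cong[OF refl], safe)
        fix x k assume xk: "(x, k) \<in> \<D>"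
        obtain c d where "k = cbox c d" using D tagged_division_ofD(4) xk by metis
        moreover have "k \<subseteq> cbox a b" using D tagged_division_ofD(3) xk by metis
        ultimately have "integral k f = 0" using zero by simp
        then show "measure lborel k *\<^sub>R norm (f x) = norm (measure lborel k *\<^sub>R f x - integral k f)" by simp
      qed
      also have "\<dots> < e" using \<gamma>(2) D tagged_division_of_def by blast
      finally have "(\<Sum>(x, k)\<in>\<D>. measure lborel k *\<^sub>R norm (f x)) < e" .
      moreover have "0 \<le> (\<Sum>(x, k)\<in>\<D>. measure lborel k *\<^sub>R norm (f x))"
        by (intro sum_nonneg) auto
      ultimately show "norm ((\<Sum>(x, k)\<in>\<D>. measure lborel k *\<^sub>R norm (f x)) - 0) < e" by simp
    qed (rule \<gamma>(1))
  qed
  then have "integral (cbox a b) (\<lambda>x. norm (f x)) = 0" by (rule integral_unique)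
  moreover have af: "(\<lambda>x. norm (f x)) absolutely_integrable_on cbox a b"
    using f by (rule absolutely_integrable_norm[unfolded o_def])
  ultimately have "(LINT x:cbox a b|lebesgue. norm (f x)) = 0"
    using set_lebesgue_integral_eq_integral(2)[OF af] by simp
  then have "AE x in lebesgue. indicator (cbox a b) x *\<^sub>R norm (f x) = 0"
    using integral_nonneg_eq_0_iff_AE[of lebesgue "\<lambda>x. indicator (cbox a b) x *\<^sub>R norm (f x)"] af
    by (simp add: set_lebesgue_integral_def set_integrable_def)
  then show ?thesis by eventually_elim (auto simp: indicator_def split: if_splits)
qed


lemma continuous_lebesgue_measurable:
  fixes f :: "'a::euclidean_space \<Rightarrow> 'b::euclidean_space"
  assumes "continuous_on UNIV f"
  shows "f \<in> borel_measurable lebesgue"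
proof -
  have "f \<in> borel_measurable lborel"
    using borel_measurable_continuous_onI[OF assms] by simp
  then show ?thesis by (rule measurable_completion)
qed

lemma integrable_bounded_scaleR:
  fixes G :: "'a \<Rightarrow> 'b::{banach, second_countable_topology}"
  assumes "a \<in> borel_measurable M" "\<And>x. \<bar>a x\<bar> \<le> B" "integrable M G"
  shows "integrable M (\<lambda>x. a x *\<^sub>R G x)"
proof (rule Bochner_Integration.integrable_bound)
  show "integrable M (\<lambda>x. B *\<^sub>R norm (G x))" using assms(3) by auto
  show "(\<lambda>x. a x *\<^sub>R G x) \<in> borel_measurable M"
    by (rule borel_measurable_scaleR[OF assms(1) borel_measurable_integrable[OF assms(3)]])
  have "B \<ge> 0" using assms(2) abs_ge_zero order_trans by blast
  then show "AE x in M. norm (a x *\<^sub>R G x) \<le> norm (B *\<^sub>R norm (G x))"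
    using assms(2) by (auto intro!: mult_right_mono)
qed

lemma continuous_times_integrable:
  fixes f :: "'a::euclidean_space \<Rightarrow> real" and G :: "'a \<Rightarrow> 'b::euclidean_space"
  assumes "continuous_on UNIV f" "\<And>x. \<bar>f x\<bar> \<le> B" "integrable lebesgue G"
  shows "integrable lebesgue (\<lambda>x. f x *\<^sub>R G x)"
  by (rule integrable_bounded_scaleR[OF continuous_lebesgue_measurable[OF assms(1)] assms(2,3)])

lemma test_function_times_integrable:
  fixes G :: "'a::euclidean_space \<Rightarrow> 'b::euclidean_space"
  assumes "\<phi> \<in> test_functions S" "G locally_integrable_on S"
  shows "set_integrable lebesgue S (\<lambda>x. \<phi> x *\<^sub>R G x)"
    "set_integrable lebesgue S (\<lambda>x. (gradient \<phi> x \<bullet> b) *\<^sub>R G x)"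
proof -
  let ?C = "closure {x. \<phi> x \<noteq> 0}"
  have C: "compact ?C" "?C \<subseteq> S" using assms(1) by (auto simp: test_functions_def)
  have c: "C1c_grad \<phi> (gradient \<phi>)" by (rule test_function_C1c[OF assms(1)])
  then have cont: "continuous_on UNIV \<phi>" "continuous_on UNIV (gradient \<phi>)" "\<And>x. GDERIV \<phi> x :> gradient \<phi> x"
    using C1_grad_continuous by (auto simp: C1c_grad_def C1_grad_def)
  have i: "integrable lebesgue (\<lambda>x. indicator ?C x *\<^sub>R G x)"
    using assms(2) C by (simp add: locally_integrable_on_def set_integrable_def)
  obtain B where "\<And>x. \<bar>\<phi> x\<bar> \<le> B" using C1c_grad_integrable(3)[OF c] by blast
  then have "integrable lebesgue (\<lambda>x. \<phi> x *\<^sub>R (indicator ?C x *\<^sub>R G x))"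
    by (rule continuous_times_integrable[OF cont(1) _ i])
  moreover have "\<phi> x *\<^sub>R (indicator ?C x *\<^sub>R G x) = indicator S x *\<^sub>R (\<phi> x *\<^sub>R G x)" for x
    using C(2) closure_subset[of "{x. \<phi> x \<noteq> 0}"] by (auto simp: indicator_def)
  ultimately show "set_integrable lebesgue S (\<lambda>x. \<phi> x *\<^sub>R G x)"
    unfolding set_integrable_def by (simp only:)
  obtain B where B: "\<And>x. norm (gradient \<phi> x) \<le> B" using C1c_grad_integrable(4)[OF c] by blast
  have "\<bar>gradient \<phi> x \<bullet> b\<bar> \<le> B * norm b" for x
    using Cauchy_Schwarz_ineq2[of "gradient \<phi> x" b] mult_right_mono[OF B[of x] norm_ge_zero[of b]]
    by simp
  moreover have "continuous_on UNIV (\<lambda>x. gradient \<phi> x \<bullet> b)"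
    using cont by (intro continuous_intros)
  ultimately have "integrable lebesgue (\<lambda>x. (gradient \<phi> x \<bullet> b) *\<^sub>R (indicator ?C x *\<^sub>R G x))"
    using continuous_times_integrable[OF _ _ i] by blast
  moreover have "(gradient \<phi> x \<bullet> b) *\<^sub>R (indicator ?C x *\<^sub>R G x) = indicator S x *\<^sub>R ((gradient \<phi> x \<bullet> b) *\<^sub>R G x)" for x
    using C(2) gradient_zero_off_support[OF cont(3), of x]
    by (cases "x \<in> ?C") (auto simp: indicator_def)
  ultimately show "set_integrable lebesgue S (\<lambda>x. (gradient \<phi> x \<bullet> b) *\<^sub>R G x)"
    unfolding set_integrable_def by (simp only:)
qed

lemma open_AE_on_cboxes:
  fixes S :: "'a::euclidean_space set"
  assumes "open S" "\<And>a b. cbox a b \<subseteq> S \<Longrightarrow> AE x in M. x \<in> cbox a b \<longrightarrow> P x"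
  shows "AE x in M. x \<in> S \<longrightarrow> P x"
proof -
  obtain D where D: "countable D" "D \<subseteq> Pow S" "\<And>X. X \<in> D \<Longrightarrow> \<exists>a b. X = cbox a b" "\<Union>D = S"
    using open_countable_Union_open_cbox[OF assms(1)] by metis
  have "AE x in M. \<forall>X\<in>D. x \<in> X \<longrightarrow> P x"
    using D assms(2) by (subst AE_ball_countable[OF D(1)]) (metis PowD subsetD)
  then show ?thesis by eventually_elim (use D(4) in blast)
qed

lemma locally_integrable_diff:
  fixes f g :: "'a::euclidean_space \<Rightarrow> 'b::euclidean_space"
  shows "f locally_integrable_on S \<Longrightarrow> g locally_integrable_on S \<Longrightarrow> (\<lambda>x. f x - g x) locally_integrable_on S"
  by (auto simp: locally_integrable_on_def intro: set_integral_diff(1))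

text \<open>The fundamental lemma of the calculus of variations: testing against bumps that exhaust a box
  shows that all box integrals vanish.\<close>

lemma fundamental_lemma:
  fixes f :: "'a::euclidean_space \<Rightarrow> 'b::euclidean_space"
  assumes "open S" and f: "f locally_integrable_on S"
    and zero: "\<And>\<phi>. \<phi> \<in> test_functions S \<Longrightarrow> (LINT x:S|lebesgue. \<phi> x *\<^sub>R f x) = 0"
  shows "AE x in lebesgue. x \<in> S \<longrightarrow> f x = 0"
proof (rule open_AE_on_cboxes[OF assms(1)])
  fix a b :: 'a assume ab: "cbox a b \<subseteq> S"
  show "AE x in lebesgue. x \<in> cbox a b \<longrightarrow> f x = 0"
  proof (rule zero_box_integrals_imp_AE_zero)
    show "f absolutely_integrable_on cbox a b"
      using f ab by (simp add: locally_integrable_on_def)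
    fix c d assume "cbox c d \<subseteq> cbox a b"
    then have cd: "cbox c d \<subseteq> S" using ab by blast
    have fi: "f absolutely_integrable_on cbox c d"
      using f cd by (simp add: locally_integrable_on_def)
    have eq: "indicator S x *\<^sub>R (box_bump n c d x *\<^sub>R f x) = box_bump n c d x *\<^sub>R (indicator (cbox c d) x *\<^sub>R f x)" for n x
      using box_bump_support[of n c d x] cd box_subset_cbox[of c d] by (auto simp: indicator_def)
    have int0: "integrable lebesgue (\<lambda>x. indicator (cbox c d) x *\<^sub>R f x)"
      using fi by (simp add: set_integrable_def)
    have m: "box_bump n c d \<in> borel_measurable lebesgue" for n
      using C_k_imp_continuous[of 0 "box_bump n c d"] smooth_box_bump[of n c d, unfolded smooth_def]
      by (blast intro: continuous_lebesgue_measurable)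
    have "(\<lambda>n. \<integral>x. indicator S x *\<^sub>R (box_bump n c d x *\<^sub>R f x) \<partial>lebesgue)
        \<longlonglongrightarrow> (\<integral>x. indicator (box c d) x *\<^sub>R (indicator (cbox c d) x *\<^sub>R f x) \<partial>lebesgue)"
      unfolding eq
    proof (rule integral_dominated_convergence[where w = "\<lambda>x. norm (indicator (cbox c d) x *\<^sub>R f x)"])
      show "integrable lebesgue (\<lambda>x. norm (indicator (cbox c d) x *\<^sub>R f x))"
        using int0 by (rule integrable_norm)
      show "AE x in lebesgue. (\<lambda>n. box_bump n c d x *\<^sub>R (indicator (cbox c d) x *\<^sub>R f x))
          \<longlonglongrightarrow> indicator (box c d) x *\<^sub>R (indicator (cbox c d) x *\<^sub>R f x)"
        by (intro AE_I2 tendsto_scaleR box_bump_tendsto tendsto_const)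
      show "AE x in lebesgue. norm (box_bump n c d x *\<^sub>R (indicator (cbox c d) x *\<^sub>R f x))
          \<le> norm (indicator (cbox c d) x *\<^sub>R f x)" for n
        using box_bump_range[of n c d] 
        by (auto intro!: AE_I2 mult_left_le_one_le mult_right_mono simp: indicator_def)
      show "(\<lambda>x. box_bump n c d x *\<^sub>R (indicator (cbox c d) x *\<^sub>R f x)) \<in> borel_measurable lebesgue" for n
        by (rule borel_measurable_scaleR[OF m borel_measurable_integrable[OF int0]])
      show "(\<lambda>x. indicator (box c d) x *\<^sub>R (indicator (cbox c d) x *\<^sub>R f x)) \<in> borel_measurable lebesgue"
        by (rule borel_measurable_scaleR[OF borel_measurable_indicator[OF fmeasurableD[OF lmeasurable_box]]
              borel_measurable_integrable[OF int0]])
    qed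
    moreover have "(\<integral>x. indicator S x *\<^sub>R (box_bump n c d x *\<^sub>R f x) \<partial>lebesgue) = 0" for n
      using zero[OF box_bump_test_function[OF cd]] by (simp add: set_lebesgue_integral_def)
    ultimately have "(\<lambda>n. 0) \<longlonglongrightarrow> (\<integral>x. indicator (box c d) x *\<^sub>R (indicator (cbox c d) x *\<^sub>R f x) \<partial>lebesgue)"
      by (simp only:)
    then have "(\<integral>x. indicator (box c d) x *\<^sub>R (indicator (cbox c d) x *\<^sub>R f x) \<partial>lebesgue) = 0"
      using LIMSEQ_const_iff by metis
    moreover have "(\<integral>x. indicator (box c d) x *\<^sub>R (indicator (cbox c d) x *\<^sub>R f x) \<partial>lebesgue)
        = (LINT x:box c d|lebesgue. f x)"
      unfolding set_lebesgue_integral_def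
      by (intro Bochner_Integration.integral_cong) (use box_subset_cbox[of c d] in \<open>auto simp: indicator_def\<close>)
    moreover have "(LINT x:box c d|lebesgue. f x) = integral (box c d) f"
      by (intro set_lebesgue_integral_eq_integral(2) set_integrable_subset[OF fi]) (auto simp: box_subset_cbox)
    ultimately show "integral (cbox c d) f = 0"
      by (simp add: integral_open_interval)
  qed
qed

lemma weak_gradient_unique:
  assumes "open S" "has_weak_gradient_on u g S" "has_weak_gradient_on u g' S"
  shows "AE x in lebesgue. x \<in> S \<longrightarrow> g x = g' x"
proof -
  have l: "g locally_integrable_on S" "g' locally_integrable_on S"
    using assms by (auto simp: has_weak_gradient_on_def)
  have "AE x in lebesgue. x \<in> S \<longrightarrow> g x - g' x = 0"
  proof (rule fundamental_lemma[OF assms(1) locally_integrable_diff[OF l]])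
    fix \<phi> assume t: "\<phi> \<in> test_functions S"
    then have "(LINT x:S|lebesgue. \<phi> x *\<^sub>R g x) = (LINT x:S|lebesgue. \<phi> x *\<^sub>R g' x)"
      using assms(2,3) by (simp add: has_weak_gradient_on_def)
    then show "(LINT x:S|lebesgue. \<phi> x *\<^sub>R (g x - g' x)) = 0"
      using set_integral_diff(2)[OF test_function_times_integrable(1)[OF t l(1)]
          test_function_times_integrable(1)[OF t l(2)]]
      by (simp add: scaleR_diff_right)
  qed
  then show ?thesis by simp
qed

text \<open>Uniqueness makes the chosen gradient computable: under an integral it may be replaced by any weak
  gradient found by other means.\<close>

lemma weak_grad_on_AE_eq:
  assumes "open S" "has_weak_gradient_on u g S"
  shows "AE x in lebesgue. x \<in> S \<longrightarrow> weak_grad_on S u x = g x"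
proof -
  have "has_weak_gradient_on u (weak_grad_on S u) S"
    unfolding weak_grad_on_def by (rule someI[where P = "\<lambda>g. has_weak_gradient_on u g S", OF assms(2)])
  then show ?thesis by (rule weak_gradient_unique[OF assms(1) _ assms(2)])
qed

section \<open>The chain rule\<close>

text \<open>Members of the closure of the compactly supported \<open>C\<^sup>1\<close> functions in \<open>W\<^bsup>1,1\<^esup>\<close> of the whole
  space, together with their gradient.\<close>

definition W11_grad :: "('a::euclidean_space \<Rightarrow> real) \<Rightarrow> ('a \<Rightarrow> 'a) \<Rightarrow> bool" where
  "W11_grad u g \<longleftrightarrow> integrable lebesgue u \<and> integrable lebesgue g \<and>
     (\<exists>\<phi> \<gamma>. (\<forall>k::nat. C1c_grad (\<phi> k) (\<gamma> k)) \<and>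
       (\<lambda>k. \<integral>x. norm (\<phi> k x - u x) \<partial>lebesgue) \<longlonglongrightarrow> 0 \<and>
       (\<lambda>k. \<integral>x. norm (\<gamma> k x - g x) \<partial>lebesgue) \<longlonglongrightarrow> 0)"

lemma integral_tendsto_dominated_diff:
  fixes F :: "nat \<Rightarrow> 'a \<Rightarrow> 'b::{banach, second_countable_topology}"
  assumes "\<And>n. integrable M (F n)" "integrable M f" "\<And>n. integrable M (w n)"
    and "\<And>n x. norm (F n x - f x) \<le> w n x"
    and "(\<lambda>n. \<integral>x. w n x \<partial>M) \<longlonglongrightarrow> 0"
  shows "(\<lambda>n. \<integral>x. F n x \<partial>M) \<longlonglongrightarrow> (\<integral>x. f x \<partial>M)"
proof (subst Lim_null, rule Lim_null_comparison[OF always_eventually assms(5)], rule allI)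
  fix n
  have "norm ((\<integral>x. F n x \<partial>M) - (\<integral>x. f x \<partial>M)) = norm (\<integral>x. F n x - f x \<partial>M)"
    using assms(1,2) by simp
  also have "\<dots> \<le> (\<integral>x. norm (F n x - f x) \<partial>M)" by (rule integral_norm_bound)
  also have "\<dots> \<le> (\<integral>x. w n x \<partial>M)"
    using assms(1,2,3,4) by (intro integral_mono) auto
  finally show "norm ((\<integral>x. F n x \<partial>M) - (\<integral>x. f x \<partial>M)) \<le> (\<integral>x. w n x \<partial>M)" .
qed

text \<open>The coefficients converge only almost everywhere. Splitting the error into \<open>a\<^sub>n (G\<^sub>n - G\<^sub>0)\<close> and
  \<open>(a\<^sub>n - a\<^sub>0) G\<^sub>0\<close> leaves one term to convergence in \<open>L\<^sup>1\<close> and the other to dominated convergence.\<close>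

lemma integral_bounded_times_L1_tendsto:
  fixes G :: "nat \<Rightarrow> 'a \<Rightarrow> 'b::{banach, second_countable_topology}"
  assumes a: "\<And>n. a n \<in> borel_measurable M" "a0 \<in> borel_measurable M"
    and B: "\<And>n x. \<bar>a n x\<bar> \<le> B" "\<And>x. \<bar>a0 x\<bar> \<le> B"
    and lim: "AE x in M. (\<lambda>n. a n x) \<longlonglongrightarrow> a0 x"
    and G: "\<And>n. integrable M (G n)" "integrable M G0"
    and L1: "(\<lambda>n. \<integral>x. norm (G n x - G0 x) \<partial>M) \<longlonglongrightarrow> 0"
  shows "(\<lambda>n. \<integral>x. a n x *\<^sub>R G n x \<partial>M) \<longlonglongrightarrow> (\<integral>x. a0 x *\<^sub>R G0 x \<partial>M)"
proof (rule integral_tendsto_dominated_diff)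
  let ?w = "\<lambda>n x. B * norm (G n x - G0 x) + norm ((a n x - a0 x) *\<^sub>R G0 x)"
  have B0: "B \<ge> 0" using B(2) abs_ge_zero order_trans by blast
  have bd: "\<bar>a n x - a0 x\<bar> \<le> 2 * B" for n x using B(1)[of n x] B(2)[of x] by linarith
  have i2: "integrable M (\<lambda>x. (a n x - a0 x) *\<^sub>R G0 x)" for n
    by (rule integrable_bounded_scaleR[OF _ bd G(2)]) (use a in measurable)
  show "integrable M (\<lambda>x. a n x *\<^sub>R G n x)" for n
    by (rule integrable_bounded_scaleR[OF a(1) B(1) G(1)])
  show "integrable M (\<lambda>x. a0 x *\<^sub>R G0 x)"
    by (rule integrable_bounded_scaleR[OF a(2) B(2) G(2)])
  show "integrable M (?w n)" for n
    by (rule Bochner_Integration.integrable_add[OF _ integrable_norm[OF i2]]) (use G in auto)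
  show "norm (a n x *\<^sub>R G n x - a0 x *\<^sub>R G0 x) \<le> ?w n x" for n x
  proof -
    have "a n x *\<^sub>R G n x - a0 x *\<^sub>R G0 x = a n x *\<^sub>R (G n x - G0 x) + (a n x - a0 x) *\<^sub>R G0 x"
      by (simp add: algebra_simps)
    then have "norm (a n x *\<^sub>R G n x - a0 x *\<^sub>R G0 x)
        \<le> norm (a n x *\<^sub>R (G n x - G0 x)) + norm ((a n x - a0 x) *\<^sub>R G0 x)"
      by (metis norm_triangle_ineq)
    also have "norm (a n x *\<^sub>R (G n x - G0 x)) \<le> B * norm (G n x - G0 x)"
      using B(1) by (auto intro!: mult_right_mono)
    finally show ?thesis by simp
  qed
  have "(\<lambda>n. \<integral>x. norm ((a n x - a0 x) *\<^sub>R G0 x) \<partial>M) \<longlonglongrightarrow> (\<integral>x. 0 \<partial>M)"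
  proof (rule integral_dominated_convergence[where w = "\<lambda>x. 2 * B * norm (G0 x)"])
    show "AE x in M. (\<lambda>n. norm ((a n x - a0 x) *\<^sub>R G0 x)) \<longlonglongrightarrow> 0"
      using lim
    proof eventually_elim
      case (elim x)
      then have "(\<lambda>n. (a n x - a0 x) *\<^sub>R G0 x) \<longlonglongrightarrow> (a0 x - a0 x) *\<^sub>R G0 x"
        by (intro tendsto_intros)
      then show ?case by (intro tendsto_norm_zero) simp
    qed
    show "AE x in M. norm (norm ((a n x - a0 x) *\<^sub>R G0 x)) \<le> 2 * B * norm (G0 x)" for n
      using bd[of n] by (auto intro!: AE_I2 mult_right_mono)
    show "(\<lambda>x. norm ((a n x - a0 x) *\<^sub>R G0 x)) \<in> borel_measurable M" for n
      by (rule borel_measurable_integrable[OF integrable_norm[OF i2]])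
  qed (use G in auto)
  then have "(\<lambda>n. B * (\<integral>x. norm (G n x - G0 x) \<partial>M) + (\<integral>x. norm ((a n x - a0 x) *\<^sub>R G0 x) \<partial>M)) \<longlonglongrightarrow> B * 0 + 0"
    using L1 by (intro tendsto_intros) auto
  moreover have "(\<integral>x. ?w n x \<partial>M) = B * (\<integral>x. norm (G n x - G0 x) \<partial>M) + (\<integral>x. norm ((a n x - a0 x) *\<^sub>R G0 x) \<partial>M)" for n
    by (subst Bochner_Integration.integral_add[OF _ integrable_norm[OF i2]]) (use G in auto)
  ultimately show "(\<lambda>n. \<integral>x. ?w n x \<partial>M) \<longlonglongrightarrow> 0" by simp
qed

lemma C1c_grad_integrable_lebesgue:
  assumes "C1c_grad f g"
  shows "integrable lebesgue f" "integrable lebesgue g"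
  using C1c_grad_integrable[OF assms] by (auto simp: integrable_completion)

lemma C1_grad_chain_pair:
  fixes \<Phi> :: "real \<times> real \<Rightarrow> real"
  assumes "C1_grad \<Phi> D" "C1_grad f g" "C1_grad h k"
  shows "C1_grad (\<lambda>x. \<Phi> (f x, h x)) (\<lambda>x. fst (D (f x, h x)) *\<^sub>R g x + snd (D (f x, h x)) *\<^sub>R k x)"
  unfolding C1_grad_def
proof
  have c: "continuous_on UNIV f" "continuous_on UNIV h" "continuous_on UNIV g" "continuous_on UNIV k"
    "continuous_on UNIV D"
    using assms C1_grad_continuous by (auto simp: C1_grad_def)
  have cd: "continuous_on UNIV (\<lambda>x. D (f x, h x))"
    by (rule continuous_on_compose2[OF c(5)]) (use c in \<open>auto intro!: continuous_intros\<close>)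
  then show "continuous_on UNIV (\<lambda>x. fst (D (f x, h x)) *\<^sub>R g x + snd (D (f x, h x)) *\<^sub>R k x)"
    using c by (intro continuous_intros)
  show "\<forall>x. GDERIV (\<lambda>x. \<Phi> (f x, h x)) x :> fst (D (f x, h x)) *\<^sub>R g x + snd (D (f x, h x)) *\<^sub>R k x"
  proof
    fix x
    have "((\<lambda>x. (f x, h x)) has_derivative (\<lambda>e. (e \<bullet> g x, e \<bullet> k x))) (at x)"
      using assms by (intro has_derivative_Pair) (auto simp: C1_grad_def gderiv_def)
    moreover have "(\<Phi> has_derivative (\<lambda>e. e \<bullet> D (f x, h x))) (at (f x, h x))"
      using assms(1) by (auto simp: C1_grad_def gderiv_def)
    ultimately have "((\<lambda>x. \<Phi> (f x, h x)) has_derivative (\<lambda>e. (e \<bullet> g x, e \<bullet> k x) \<bullet> D (f x, h x))) (at x)"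
      by (rule has_derivative_compose)
    moreover have "(e \<bullet> g x, e \<bullet> k x) \<bullet> D (f x, h x) = e \<bullet> (fst (D (f x, h x)) *\<^sub>R g x + snd (D (f x, h x)) *\<^sub>R k x)" for e
      by (cases "D (f x, h x)") (simp add: inner_Pair algebra_simps)
    ultimately show "GDERIV (\<lambda>x. \<Phi> (f x, h x)) x :> fst (D (f x, h x)) *\<^sub>R g x + snd (D (f x, h x)) *\<^sub>R k x"
      by (simp add: gderiv_def)
  qed
qed

lemma W11_gradE:
  fixes u v :: "'a::euclidean_space \<Rightarrow> real"
  assumes "W11_grad u g" "W11_grad v h"
  obtains \<phi> \<gamma> \<psi> \<eta> where
    "\<And>k. C1c_grad (\<phi> k) (\<gamma> k)" "\<And>k. C1c_grad (\<psi> k) (\<eta> k)"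
    "(\<lambda>k. \<integral>x. norm (\<phi> k x - u x) \<partial>lebesgue) \<longlonglongrightarrow> 0"
    "(\<lambda>k. \<integral>x. norm (\<gamma> k x - g x) \<partial>lebesgue) \<longlonglongrightarrow> 0"
    "(\<lambda>k. \<integral>x. norm (\<psi> k x - v x) \<partial>lebesgue) \<longlonglongrightarrow> 0"
    "(\<lambda>k. \<integral>x. norm (\<eta> k x - h x) \<partial>lebesgue) \<longlonglongrightarrow> 0"
    "AE x in lebesgue. (\<lambda>k. \<phi> k x) \<longlonglongrightarrow> u x" "AE x in lebesgue. (\<lambda>k. \<psi> k x) \<longlonglongrightarrow> v x"
proof -
  have iu: "integrable lebesgue u" "integrable lebesgue v" using assms by (auto simp: W11_grad_def)
  obtain \<phi> \<gamma> where 1: "\<And>k. C1c_grad (\<phi> k) (\<gamma> k)"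
    "(\<lambda>k. \<integral>x. norm (\<phi> k x - u x) \<partial>lebesgue) \<longlonglongrightarrow> 0"
    "(\<lambda>k. \<integral>x. norm (\<gamma> k x - g x) \<partial>lebesgue) \<longlonglongrightarrow> 0"
    using assms(1) by (auto simp: W11_grad_def)
  obtain \<psi> \<eta> where 2: "\<And>k. C1c_grad (\<psi> k) (\<eta> k)"
    "(\<lambda>k. \<integral>x. norm (\<psi> k x - v x) \<partial>lebesgue) \<longlonglongrightarrow> 0"
    "(\<lambda>k. \<integral>x. norm (\<eta> k x - h x) \<partial>lebesgue) \<longlonglongrightarrow> 0"
    using assms(2) by (auto simp: W11_grad_def)
  note i = C1c_grad_integrable_lebesgue[OF 1(1)] C1c_grad_integrable_lebesgue[OF 2(1)]
  let ?s = "\<lambda>k x. norm (\<phi> k x - u x) + norm (\<psi> k x - v x)"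
  have "(\<lambda>k. \<integral>x. norm (?s k x) \<partial>lebesgue) \<longlonglongrightarrow> 0"
    using tendsto_add[OF 1(2) 2(2)] i iu by simp
  then obtain \<rho> where \<rho>: "strict_mono \<rho>" "AE x in lebesgue. (\<lambda>n. ?s (\<rho> n) x) \<longlonglongrightarrow> 0"
    using tendsto_L1_AE_subseq[of lebesgue ?s] i iu by auto
  have "(\<lambda>n. \<phi> (\<rho> n) x) \<longlonglongrightarrow> u x \<and> (\<lambda>n. \<psi> (\<rho> n) x) \<longlonglongrightarrow> v x" if "(\<lambda>n. ?s (\<rho> n) x) \<longlonglongrightarrow> 0" for x
    by (intro conjI; subst Lim_null, rule Lim_null_comparison[OF always_eventually that]) auto
  then have "AE x in lebesgue. (\<lambda>k. \<phi> (\<rho> k) x) \<longlonglongrightarrow> u x" "AE x in lebesgue. (\<lambda>k. \<psi> (\<rho> k) x) \<longlonglongrightarrow> v x"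
    using \<rho>(2) by auto
  then show ?thesis
    using that[of "\<phi> \<circ> \<rho>" "\<gamma> \<circ> \<rho>" "\<psi> \<circ> \<rho>" "\<eta> \<circ> \<rho>"] 1(1) 2(1)
      LIMSEQ_subseq_LIMSEQ[OF 1(2) \<rho>(1)] LIMSEQ_subseq_LIMSEQ[OF 1(3) \<rho>(1)]
      LIMSEQ_subseq_LIMSEQ[OF 2(2) \<rho>(1)] LIMSEQ_subseq_LIMSEQ[OF 2(3) \<rho>(1)]
    by (simp add: o_def)
qed

lemma integrable_imp_locally_integrable:
  fixes f :: "'a::euclidean_space \<Rightarrow> 'b::euclidean_space"
  assumes "integrable lebesgue f"
  shows "f locally_integrable_on S"
  unfolding locally_integrable_on_def set_integrable_def
  by (intro allI impI integrable_mult_indicator[OF _ assms]) (auto simp: compact_imp_closed)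

lemma locally_integrable_const:
  fixes c :: "'b::euclidean_space"
  shows "(\<lambda>x::'a::euclidean_space. c) locally_integrable_on S"
  unfolding locally_integrable_on_def set_integrable_def
proof (intro allI impI, elim conjE)
  fix C :: "'a set" assume "compact C"
  then have "integrable lborel (\<lambda>x. indicat_real C x *\<^sub>R c)"
    by (intro borel_integrable_compact) auto
  then show "integrable lebesgue (\<lambda>x. indicat_real C x *\<^sub>R c)"
    by (subst integrable_completion) auto
qed

lemma locally_integrable_add:
  fixes f g :: "'a::euclidean_space \<Rightarrow> 'b::euclidean_space"
  shows "f locally_integrable_on S \<Longrightarrow> g locally_integrable_on S \<Longrightarrow> (\<lambda>x. f x + g x) locally_integrable_on S"
  by (auto simp: locally_integrable_on_def intro: set_integral_add(1))

text \<open>Along approximations that converge in \<open>L\<^sup>1\<close> and almost everywhere, integration by parts is classical.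
  The functions converge because \<open>\<Phi>\<close> is Lipschitz; the gradients are products of bounded coefficients
  that converge almost everywhere with gradients that converge in \<open>L\<^sup>1\<close>.\<close>

theorem W11_chain_rule:
  fixes u v :: "'a::euclidean_space \<Rightarrow> real" and \<Phi> :: "real \<times> real \<Rightarrow> real"
  assumes u: "W11_grad u g" and v: "W11_grad v h"
    and \<Phi>: "C1_grad \<Phi> D" and B: "\<And>z. norm (D z) \<le> B"
  shows "has_weak_gradient_on (\<lambda>x. \<Phi> (u x, v x))
      (\<lambda>x. fst (D (u x, v x)) *\<^sub>R g x + snd (D (u x, v x)) *\<^sub>R h x) UNIV"
    (is "has_weak_gradient_on ?F ?G UNIV")
proof -
  obtain \<phi> \<gamma> \<psi> \<eta> where C: "\<And>k. C1c_grad (\<phi> k) (\<gamma> k)" "\<And>k. C1c_grad (\<psi> k) (\<eta> k)"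
    and L: "(\<lambda>k. \<integral>x. norm (\<phi> k x - u x) \<partial>lebesgue) \<longlonglongrightarrow> 0"
    "(\<lambda>k. \<integral>x. norm (\<gamma> k x - g x) \<partial>lebesgue) \<longlonglongrightarrow> 0"
    "(\<lambda>k. \<integral>x. norm (\<psi> k x - v x) \<partial>lebesgue) \<longlonglongrightarrow> 0"
    "(\<lambda>k. \<integral>x. norm (\<eta> k x - h x) \<partial>lebesgue) \<longlonglongrightarrow> 0"
    and ae: "AE x in lebesgue. (\<lambda>k. \<phi> k x) \<longlonglongrightarrow> u x" "AE x in lebesgue. (\<lambda>k. \<psi> k x) \<longlonglongrightarrow> v x"
    by (rule W11_gradE[OF u v]) (rule that)
  have i: "integrable lebesgue u" "integrable lebesgue v" "integrable lebesgue g" "integrable lebesgue h"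
    using u v by (auto simp: W11_grad_def)
  note iC = C1c_grad_integrable_lebesgue[OF C(1)] C1c_grad_integrable_lebesgue[OF C(2)]
  have [measurable]: "u \<in> borel_measurable lebesgue" "v \<in> borel_measurable lebesgue"
    "\<phi> k \<in> borel_measurable lebesgue" "\<psi> k \<in> borel_measurable lebesgue" for k
    using i iC by auto
  have cD: "continuous_on UNIV D" and cP: "continuous_on UNIV \<Phi>"
    using \<Phi> C1_grad_continuous[OF \<Phi>] by (auto simp: C1_grad_def)
  have [measurable]: "\<Phi> \<in> borel_measurable (borel \<Otimes>\<^sub>M borel)" "D \<in> (borel \<Otimes>\<^sub>M borel) \<rightarrow>\<^sub>M (borel \<Otimes>\<^sub>M borel)"
    using borel_measurable_continuous_onI[OF cD] borel_measurable_continuous_onI[OF cP]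
    by (simp_all add: borel_prod)
  have lip: "\<bar>\<Phi> (a, b) - \<Phi> (a', b')\<bar> \<le> B * (\<bar>a - a'\<bar> + \<bar>b - b'\<bar>)" for a b a' b'
  proof -
    have "B \<ge> 0" using B[of 0] norm_ge_zero order_trans by blast
    have "\<bar>\<Phi> (a, b) - \<Phi> (a', b')\<bar> \<le> B * norm ((a, b) - (a', b'))"
      by (rule C1_Lipschitz[of \<Phi> D, OF _ B]) (use \<Phi> in \<open>unfold C1_grad_def, blast\<close>)
    also have "norm ((a, b) - (a', b')) \<le> \<bar>a - a'\<bar> + \<bar>b - b'\<bar>"
      using norm_Pair_le[of "a - a'" "b - b'"] by simp
    finally show ?thesis using \<open>B \<ge> 0\<close> by (simp add: mult_left_mono)
  qed
  have Db: "\<bar>fst (D z)\<bar> \<le> B" "\<bar>snd (D z)\<bar> \<le> B" for z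
    using B[of z] norm_fst_le[of "fst (D z)" "snd (D z)"] norm_snd_le[of "snd (D z)" "fst (D z)"] by auto
  have F0: "integrable lebesgue (\<lambda>x. \<Phi> (u x, v x) - \<Phi> (0, 0))"
  proof (rule Bochner_Integration.integrable_bound)
    show "integrable lebesgue (\<lambda>x. B * (\<bar>u x\<bar> + \<bar>v x\<bar>))" using i by auto
    show "AE x in lebesgue. norm (\<Phi> (u x, v x) - \<Phi> (0, 0)) \<le> norm (B * (\<bar>u x\<bar> + \<bar>v x\<bar>))"
      using lip[of _ _ 0 0] by (auto intro: order_trans[OF _ abs_ge_self])
  qed measurable
  have Fl: "?F locally_integrable_on UNIV"
    using locally_integrable_add[OF integrable_imp_locally_integrable[OF F0]
        locally_integrable_const[of "\<Phi> (0, 0)"]] by simp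
  have iG: "integrable lebesgue (\<lambda>x. fst (D (u x, v x)) *\<^sub>R g x)" "integrable lebesgue (\<lambda>x. snd (D (u x, v x)) *\<^sub>R h x)"
    by (rule integrable_bounded_scaleR[OF _ Db(1) i(3)], measurable)
      (rule integrable_bounded_scaleR[OF _ Db(2) i(4)], measurable)
  have "(LINT x:UNIV|lebesgue. ?F x *\<^sub>R gradient \<tau> x) = - (LINT x:UNIV|lebesgue. \<tau> x *\<^sub>R ?G x)"
    if t: "\<tau> \<in> test_functions UNIV" for \<tau>
  proof -
    let ?F' = "\<lambda>k x. \<Phi> (\<phi> k x, \<psi> k x)"
    let ?d1 = "\<lambda>k x. fst (D (\<phi> k x, \<psi> k x))" and ?d2 = "\<lambda>k x. snd (D (\<phi> k x, \<psi> k x))"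
    have ct: "C1c_grad \<tau> (gradient \<tau>)" by (rule test_function_C1c[OF t])
    obtain T where T: "\<And>x. \<bar>\<tau> x\<bar> \<le> T" using C1c_grad_integrable(3)[OF ct] by blast
    obtain T' where T': "\<And>x. norm (gradient \<tau> x) \<le> T'" using C1c_grad_integrable(4)[OF ct] by blast
    have T0: "T' \<ge> 0" "T \<ge> 0" "B \<ge> 0"
      using T'[of 0] T[of 0] B[of 0] norm_ge_zero order_trans abs_ge_zero by blast+
    have [measurable]: "\<tau> \<in> borel_measurable lebesgue" "gradient \<tau> \<in> borel_measurable lebesgue"
      using C1c_grad_integrable_lebesgue[OF ct] by auto
    have cF: "C1_grad (?F' k) (\<lambda>x. ?d1 k x *\<^sub>R \<gamma> k x + ?d2 k x *\<^sub>R \<eta> k x)" for k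
      by (rule C1_grad_chain_pair[OF \<Phi>]) (use C in \<open>auto simp: C1c_grad_def\<close>)
    note ibp = integration_by_parts_C1[OF ct cF]
    have L1: "integrable lebesgue (\<lambda>x. ?F' k x *\<^sub>R gradient \<tau> x)" for k
      using ibp(2)[of k] by (subst integrable_completion) auto
    have tds: "T * B \<ge> \<bar>\<tau> x * fst (D z)\<bar>" "T * B \<ge> \<bar>\<tau> x * snd (D z)\<bar>" for x z
      using mult_mono[OF T[of x] Db(1)[of z]] mult_mono[OF T[of x] Db(2)[of z]] T0 by (simp_all add: abs_mult)
    have I1: "integrable lebesgue (\<lambda>x. (\<tau> x * ?d1 k x) *\<^sub>R \<gamma> k x)"
       "integrable lebesgue (\<lambda>x. (\<tau> x * ?d2 k x) *\<^sub>R \<eta> k x)" for k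
      by (rule integrable_bounded_scaleR[OF _ tds(1) iC(2)], measurable)
        (rule integrable_bounded_scaleR[OF _ tds(2) iC(4)], measurable)
    have I2: "integrable lebesgue (\<lambda>x. (\<tau> x * fst (D (u x, v x))) *\<^sub>R g x)"
       "integrable lebesgue (\<lambda>x. (\<tau> x * snd (D (u x, v x))) *\<^sub>R h x)"
      by (rule integrable_bounded_scaleR[OF _ tds(1) i(3)], measurable)
        (rule integrable_bounded_scaleR[OF _ tds(2) i(4)], measurable)
    have eq: "(\<integral>x. ?F' k x *\<^sub>R gradient \<tau> x \<partial>lebesgue) =
        - ((\<integral>x. (\<tau> x * ?d1 k x) *\<^sub>R \<gamma> k x \<partial>lebesgue) + (\<integral>x. (\<tau> x * ?d2 k x) *\<^sub>R \<eta> k x \<partial>lebesgue))" for k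
    proof -
      have "(\<integral>x. ?F' k x *\<^sub>R gradient \<tau> x \<partial>lebesgue) = (\<integral>x. ?F' k x *\<^sub>R gradient \<tau> x \<partial>lborel)"
        using ibp(2)[of k] by (intro integral_completion) auto
      also have "\<dots> = - (\<integral>x. \<tau> x *\<^sub>R (?d1 k x *\<^sub>R \<gamma> k x + ?d2 k x *\<^sub>R \<eta> k x) \<partial>lborel)"
        by (rule ibp(3))
      also have "(\<integral>x. \<tau> x *\<^sub>R (?d1 k x *\<^sub>R \<gamma> k x + ?d2 k x *\<^sub>R \<eta> k x) \<partial>lborel)
          = (\<integral>x. \<tau> x *\<^sub>R (?d1 k x *\<^sub>R \<gamma> k x + ?d2 k x *\<^sub>R \<eta> k x) \<partial>lebesgue)"
        using ibp(1)[of k] by (intro integral_completion[symmetric]) auto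
      also have "\<dots> = (\<integral>x. (\<tau> x * ?d1 k x) *\<^sub>R \<gamma> k x + (\<tau> x * ?d2 k x) *\<^sub>R \<eta> k x \<partial>lebesgue)"
        by (simp add: scaleR_add_right)
      finally show ?thesis using I1[of k] by simp
    qed
    have "(\<lambda>k. \<integral>x. ?F' k x *\<^sub>R gradient \<tau> x \<partial>lebesgue) \<longlonglongrightarrow> (\<integral>x. ?F x *\<^sub>R gradient \<tau> x \<partial>lebesgue)"
    proof (rule integral_tendsto_dominated_diff[OF L1,
          where w = "\<lambda>k x. B * (norm (\<phi> k x - u x) + norm (\<psi> k x - v x)) * T'"])
      have a: "integrable lebesgue (\<lambda>x. (\<Phi> (u x, v x) - \<Phi> (0, 0)) *\<^sub>R gradient \<tau> x)"
      proof (rule Bochner_Integration.integrable_bound)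
        show "integrable lebesgue (\<lambda>x. T' * (\<Phi> (u x, v x) - \<Phi> (0, 0)))" using F0 by simp
        show "AE x in lebesgue. norm ((\<Phi> (u x, v x) - \<Phi> (0, 0)) *\<^sub>R gradient \<tau> x)
            \<le> norm (T' * (\<Phi> (u x, v x) - \<Phi> (0, 0)))"
          using T' T0 by (auto simp: abs_mult mult.commute intro!: mult_left_mono mult_right_mono)
      qed measurable
      have b: "integrable lebesgue (\<lambda>x. \<Phi> (0, 0) *\<^sub>R gradient \<tau> x)"
        using C1c_grad_integrable_lebesgue(2)[OF ct] by simp
      show "integrable lebesgue (\<lambda>x. ?F x *\<^sub>R gradient \<tau> x)"
        using Bochner_Integration.integrable_add[OF a b] by (simp add: algebra_simps)
      show "integrable lebesgue (\<lambda>x. B * (norm (\<phi> k x - u x) + norm (\<psi> k x - v x)) * T')" for k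
        using i iC by simp
      show "norm (?F' k x *\<^sub>R gradient \<tau> x - ?F x *\<^sub>R gradient \<tau> x)
          \<le> B * (norm (\<phi> k x - u x) + norm (\<psi> k x - v x)) * T'" for k x
      proof -
        have "norm (?F' k x *\<^sub>R gradient \<tau> x - ?F x *\<^sub>R gradient \<tau> x)
            = \<bar>?F' k x - ?F x\<bar> * norm (gradient \<tau> x)"
          by (metis norm_scaleR scaleR_diff_left)
        also have "\<dots> \<le> B * (norm (\<phi> k x - u x) + norm (\<psi> k x - v x)) * T'"
          using lip T' T0 by (intro mult_mono) auto
        finally show ?thesis .
      qed
      have "(\<lambda>k. B * ((\<integral>x. norm (\<phi> k x - u x) \<partial>lebesgue) + (\<integral>x. norm (\<psi> k x - v x) \<partial>lebesgue)) * T')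
          \<longlonglongrightarrow> B * (0 + 0) * T'"
        by (intro tendsto_intros L)
      then show "(\<lambda>k. \<integral>x. B * (norm (\<phi> k x - u x) + norm (\<psi> k x - v x)) * T' \<partial>lebesgue) \<longlonglongrightarrow> 0"
        using i iC by simp
    qed
    moreover have "(\<lambda>k. - ((\<integral>x. (\<tau> x * ?d1 k x) *\<^sub>R \<gamma> k x \<partial>lebesgue) + (\<integral>x. (\<tau> x * ?d2 k x) *\<^sub>R \<eta> k x \<partial>lebesgue)))
       \<longlonglongrightarrow> - ((\<integral>x. (\<tau> x * fst (D (u x, v x))) *\<^sub>R g x \<partial>lebesgue) + (\<integral>x. (\<tau> x * snd (D (u x, v x))) *\<^sub>R h x \<partial>lebesgue))"
    proof (intro tendsto_minus tendsto_add integral_bounded_times_L1_tendsto[where B = "T * B"])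
      have "(\<lambda>k. D (\<phi> k x, \<psi> k x)) \<longlonglongrightarrow> D (u x, v x)"
        if "(\<lambda>k. \<phi> k x) \<longlonglongrightarrow> u x" "(\<lambda>k. \<psi> k x) \<longlonglongrightarrow> v x" for x
        using cD that by (intro isCont_tendsto_compose[of _ D] tendsto_Pair)
          (auto simp: continuous_on_eq_continuous_at)
      then show "AE x in lebesgue. (\<lambda>k. \<tau> x * ?d1 k x) \<longlonglongrightarrow> \<tau> x * fst (D (u x, v x))"
        "AE x in lebesgue. (\<lambda>k. \<tau> x * ?d2 k x) \<longlonglongrightarrow> \<tau> x * snd (D (u x, v x))"
        using ae by (auto elim!: eventually_elim2 intro!: tendsto_intros)
    qed (use tds iC i L in \<open>auto\<close>)
    ultimately have "(\<integral>x. ?F x *\<^sub>R gradient \<tau> x \<partial>lebesgue) =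
       - ((\<integral>x. (\<tau> x * fst (D (u x, v x))) *\<^sub>R g x \<partial>lebesgue) + (\<integral>x. (\<tau> x * snd (D (u x, v x))) *\<^sub>R h x \<partial>lebesgue))"
      unfolding eq by (rule LIMSEQ_unique)
    also have "\<dots> = - (\<integral>x. (\<tau> x * fst (D (u x, v x))) *\<^sub>R g x + (\<tau> x * snd (D (u x, v x))) *\<^sub>R h x \<partial>lebesgue)"
      using I2 by simp
    also have "\<dots> = - (\<integral>x. \<tau> x *\<^sub>R ?G x \<partial>lebesgue)"
      by (simp add: scaleR_add_right)
    finally show ?thesis by (simp add: set_lebesgue_integral_def)
  qed
  moreover have "?G locally_integrable_on UNIV"
    using integrable_imp_locally_integrable[OF Bochner_Integration.integrable_add[OF iG]] .
  ultimately show ?thesis using Fl by (simp add: has_weak_gradient_on_def)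
qed

text \<open>This removes the regularisation from the chain rule. Locally integrable bounds are needed because
  the regularised functions do not vanish at infinity.\<close>

lemma weak_gradient_dominated_limit:
  fixes F :: "nat \<Rightarrow> 'a::euclidean_space \<Rightarrow> real"
  assumes wg: "\<And>n. has_weak_gradient_on (F n) (G n) UNIV"
    and limF: "AE x in lebesgue. (\<lambda>n. F n x) \<longlonglongrightarrow> F0 x"
    and limG: "AE x in lebesgue. (\<lambda>n. G n x) \<longlonglongrightarrow> G0 x"
    and F: "\<And>n. F n \<in> borel_measurable lebesgue" "F0 \<in> borel_measurable lebesgue"
    and G: "\<And>n. G n \<in> borel_measurable lebesgue" "G0 \<in> borel_measurable lebesgue"
    and W: "W locally_integrable_on UNIV" "\<And>n. AE x in lebesgue. \<bar>F n x\<bar> \<le> W x"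
    and V: "V locally_integrable_on UNIV" "\<And>n. AE x in lebesgue. norm (G n x) \<le> V x"
  shows "has_weak_gradient_on F0 G0 UNIV"
proof -
  have bF: "AE x in lebesgue. \<bar>F0 x\<bar> \<le> W x"
  proof -
    have "AE x in lebesgue. \<forall>n. \<bar>F n x\<bar> \<le> W x" using W(2) by (simp add: AE_all_countable)
    then show ?thesis using limF
      by eventually_elim (auto intro: LIMSEQ_le_const2 tendsto_rabs)
  qed
  have bG: "AE x in lebesgue. norm (G0 x) \<le> V x"
  proof -
    have "AE x in lebesgue. \<forall>n. norm (G n x) \<le> V x" using V(2) by (simp add: AE_all_countable)
    then show ?thesis using limG
      by eventually_elim (auto intro: LIMSEQ_le_const2 tendsto_norm)
  qed
  have dom: "f locally_integrable_on UNIV"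
    if "w locally_integrable_on UNIV" "f \<in> borel_measurable lebesgue" "AE x in lebesgue. norm (f x) \<le> w x"
    for f :: "'a \<Rightarrow> 'c::euclidean_space" and w :: "'a \<Rightarrow> real"
    unfolding locally_integrable_on_def set_integrable_def
  proof (intro allI impI, elim conjE)
    fix C :: "'a set" assume C: "compact C"
    show "integrable lebesgue (\<lambda>x. indicat_real C x *\<^sub>R f x)"
    proof (rule Bochner_Integration.integrable_bound)
      show "integrable lebesgue (\<lambda>x. indicat_real C x *\<^sub>R w x)"
        using that(1) C by (simp add: locally_integrable_on_def set_integrable_def)
      have "C \<in> sets lebesgue" using C by (simp add: compact_imp_closed)
      then show "(\<lambda>x. indicat_real C x *\<^sub>R f x) \<in> borel_measurable lebesgue"
        using that(2) by (intro borel_measurable_scaleR) auto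
      show "AE x in lebesgue. norm (indicat_real C x *\<^sub>R f x) \<le> norm (indicat_real C x *\<^sub>R w x)"
        using that(3) by eventually_elim (auto simp: indicator_def)
    qed
  qed
  have lF: "F0 locally_integrable_on UNIV" by (rule dom[OF W(1) F(2)]) (use bF in simp)
  have lG: "G0 locally_integrable_on UNIV" by (rule dom[OF V(1) G(2) bG])
  have "(LINT x:UNIV|lebesgue. F0 x *\<^sub>R gradient \<phi> x) = - (LINT x:UNIV|lebesgue. \<phi> x *\<^sub>R G0 x)"
    if t: "\<phi> \<in> test_functions UNIV" for \<phi>
  proof -
    have ct: "C1c_grad \<phi> (gradient \<phi>)" by (rule test_function_C1c[OF t])
    have mt: "\<phi> \<in> borel_measurable lebesgue" "gradient \<phi> \<in> borel_measurable lebesgue"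
      using C1c_grad_integrable_lebesgue[OF ct] by auto
    have eq: "(\<integral>x. F n x *\<^sub>R gradient \<phi> x \<partial>lebesgue) = - (\<integral>x. \<phi> x *\<^sub>R G n x \<partial>lebesgue)" for n
      using wg[of n] t by (simp add: has_weak_gradient_on_def set_lebesgue_integral_def)
    have "(\<lambda>n. \<integral>x. \<phi> x *\<^sub>R G n x \<partial>lebesgue) \<longlonglongrightarrow> (\<integral>x. \<phi> x *\<^sub>R G0 x \<partial>lebesgue)"
    proof (rule integral_dominated_convergence[where w = "\<lambda>x. norm (\<phi> x *\<^sub>R V x)"])
      show "integrable lebesgue (\<lambda>x. norm (\<phi> x *\<^sub>R V x))"
        using test_function_times_integrable(1)[OF t V(1)] by (simp add: set_integrable_def)
      show "AE x in lebesgue. (\<lambda>n. \<phi> x *\<^sub>R G n x) \<longlonglongrightarrow> \<phi> x *\<^sub>R G0 x"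
        using limG by eventually_elim (intro tendsto_intros)
      show "AE x in lebesgue. norm (\<phi> x *\<^sub>R G n x) \<le> norm (\<phi> x *\<^sub>R V x)" for n
        using V(2)[of n] by eventually_elim (auto simp: abs_mult intro!: mult_left_mono)
    qed (use mt G in \<open>auto intro!: borel_measurable_scaleR\<close>)
    moreover have "(\<lambda>n. \<integral>x. F n x *\<^sub>R gradient \<phi> x \<partial>lebesgue) \<longlonglongrightarrow> (\<integral>x. F0 x *\<^sub>R gradient \<phi> x \<partial>lebesgue)"
    proof (rule integral_dominated_convergence[where w = "\<lambda>x. \<Sum>b\<in>Basis. norm ((gradient \<phi> x \<bullet> b) *\<^sub>R W x)"])
      show "integrable lebesgue (\<lambda>x. \<Sum>b\<in>Basis. norm ((gradient \<phi> x \<bullet> b) *\<^sub>R W x))"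
        using test_function_times_integrable(2)[OF t W(1)]
        by (intro Bochner_Integration.integrable_sum integrable_norm) (simp add: set_integrable_def)
      show "AE x in lebesgue. (\<lambda>n. F n x *\<^sub>R gradient \<phi> x) \<longlonglongrightarrow> F0 x *\<^sub>R gradient \<phi> x"
        using limF by eventually_elim (intro tendsto_intros)
      show "AE x in lebesgue. norm (F n x *\<^sub>R gradient \<phi> x) \<le> (\<Sum>b\<in>Basis. norm ((gradient \<phi> x \<bullet> b) *\<^sub>R W x))" for n
        using W(2)[of n]
      proof eventually_elim
        case (elim x)
        have "norm (F n x *\<^sub>R gradient \<phi> x) \<le> \<bar>W x\<bar> * norm (gradient \<phi> x)"
          using elim by (auto intro!: mult_right_mono)
        also have "\<dots> \<le> \<bar>W x\<bar> * (\<Sum>b\<in>Basis. \<bar>gradient \<phi> x \<bullet> b\<bar>)"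
          by (intro mult_left_mono norm_le_l1) auto
        also have "\<dots> = (\<Sum>b\<in>Basis. norm ((gradient \<phi> x \<bullet> b) *\<^sub>R W x))"
          by (simp add: sum_distrib_left abs_mult mult.commute)
        finally show ?case .
      qed
    qed (use mt F in \<open>auto intro!: borel_measurable_scaleR\<close>)
    ultimately have "(\<integral>x. F0 x *\<^sub>R gradient \<phi> x \<partial>lebesgue) = - (\<integral>x. \<phi> x *\<^sub>R G0 x \<partial>lebesgue)"
      unfolding eq using LIMSEQ_unique tendsto_minus by blast
    then show ?thesis by (simp add: set_lebesgue_integral_def)
  qed
  then show ?thesis using lF lG by (simp add: has_weak_gradient_on_def)
qed

lemma W11_weak_gradient:
  assumes "W11_grad u g"
  shows "has_weak_gradient_on u g UNIV"
proof -
  have "C1_grad (fst :: real \<times> real \<Rightarrow> real) (\<lambda>z. (1, 0))"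
  proof -
    have "(\<lambda>h::real \<times> real. h \<bullet> (1, 0)) = fst" by (auto simp: fun_eq_iff)
    then show ?thesis
      by (auto simp: C1_grad_def gderiv_def intro!: bounded_linear_imp_has_derivative bounded_linear_fst)
  qed
  \<comment> \<open>The projection as outer function turns the chain rule into the claim.\<close>
  from W11_chain_rule[OF assms assms this, of 1]
  show ?thesis by (simp add: norm_Pair)
qed

section \<open>The weak gradient of the quotient\<close>

lemma GDERIV_regularised_quotient:
  fixes A B :: "'a::real_inner \<Rightarrow> real"
  assumes A: "GDERIV A z :> A'" and B: "GDERIV B z :> B'" and pos: "A z > 0" "B z > 0" "\<epsilon> > 0"
  defines "t \<equiv> B z / (A z + \<epsilon> * B z)" and "s \<equiv> A z / (A z + \<epsilon> * B z)"
  shows "GDERIV (\<lambda>z. A z * (1 - (B z / (A z + \<epsilon> * B z)) powr (r + 1))) z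
    :> (1 - t powr (r + 1) + (r + 1) * t powr (r + 1) * s) *\<^sub>R A' - ((r + 1) * t powr r * s\<^sup>2) *\<^sub>R B'"
proof -
  have N: "A z + \<epsilon> * B z > 0" using pos by (simp add: add_pos_pos)
  have t: "t > 0" using N pos by (simp add: t_def)
  have dA: "(A has_derivative (\<lambda>h. h \<bullet> A')) (at z)" and dB: "(B has_derivative (\<lambda>h. h \<bullet> B')) (at z)"
    using A B by (simp_all add: gderiv_def)
  have dt: "((\<lambda>z. B z / (A z + \<epsilon> * B z)) has_derivative
      (\<lambda>h. s / (A z + \<epsilon> * B z) * (h \<bullet> B') - t / (A z + \<epsilon> * B z) * (h \<bullet> A'))) (at z)"
  proof -
    have "((\<lambda>z. A z + \<epsilon> * B z) has_derivative (\<lambda>h. h \<bullet> A' + \<epsilon> * (h \<bullet> B'))) (at z)"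
      by (auto intro!: derivative_eq_intros dA dB)
    from has_derivative_divide'[OF dB this] N
    have "((\<lambda>z. B z / (A z + \<epsilon> * B z)) has_derivative (\<lambda>h. ((h \<bullet> B') * (A z + \<epsilon> * B z)
        - B z * (h \<bullet> A' + \<epsilon> * (h \<bullet> B'))) / ((A z + \<epsilon> * B z) * (A z + \<epsilon> * B z)))) (at z)"
      by simp
    moreover have "((h \<bullet> B') * (A z + \<epsilon> * B z) - B z * (h \<bullet> A' + \<epsilon> * (h \<bullet> B'))) / ((A z + \<epsilon> * B z) * (A z + \<epsilon> * B z))
        = s / (A z + \<epsilon> * B z) * (h \<bullet> B') - t / (A z + \<epsilon> * B z) * (h \<bullet> A')" for h
    proof -
      have "(h \<bullet> B') * (A z + \<epsilon> * B z) - B z * (h \<bullet> A' + \<epsilon> * (h \<bullet> B')) = A z * (h \<bullet> B') - B z * (h \<bullet> A')"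
        by (simp add: algebra_simps)
      then show ?thesis by (simp add: s_def t_def diff_divide_distrib)
    qed
    ultimately show ?thesis by (simp only:)
  qed
  have dp: "((\<lambda>x. x powr (r + 1)) has_real_derivative (r + 1) * t powr r) (at t)"
    using t by (auto intro!: derivative_eq_intros)
  have dw: "((\<lambda>z. (B z / (A z + \<epsilon> * B z)) powr (r + 1)) has_derivative
      (\<lambda>h. (r + 1) * t powr r * (s / (A z + \<epsilon> * B z) * (h \<bullet> B') - t / (A z + \<epsilon> * B z) * (h \<bullet> A')))) (at z)"
    using has_derivative_compose[OF dt, of "\<lambda>x. x powr (r + 1)" "\<lambda>h. (r + 1) * t powr r * h"] dp
    by (simp add: has_field_derivative_def t_def)
  have "((\<lambda>z. A z * (1 - (B z / (A z + \<epsilon> * B z)) powr (r + 1))) has_derivative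
      (\<lambda>h. A z * (0 - (r + 1) * t powr r * (s / (A z + \<epsilon> * B z) * (h \<bullet> B') - t / (A z + \<epsilon> * B z) * (h \<bullet> A')))
        + (h \<bullet> A') * (1 - t powr (r + 1)))) (at z)"
    using has_derivative_mult[OF dA has_derivative_diff[OF has_derivative_const dw]]
    unfolding t_def[symmetric] .
  moreover have "A z * (0 - (r + 1) * t powr r * (s / (A z + \<epsilon> * B z) * (h \<bullet> B') - t / (A z + \<epsilon> * B z) * (h \<bullet> A')))
        + (h \<bullet> A') * (1 - t powr (r + 1))
      = h \<bullet> ((1 - t powr (r + 1) + (r + 1) * t powr (r + 1) * s) *\<^sub>R A' - ((r + 1) * t powr r * s\<^sup>2) *\<^sub>R B')" for h
  proof -
    have 1: "A z / (A z + \<epsilon> * B z) = s" by (simp add: s_def)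
    have "A z * ((r + 1) * t powr r * (s / (A z + \<epsilon> * B z) * (h \<bullet> B') - t / (A z + \<epsilon> * B z) * (h \<bullet> A')))
       = A z / (A z + \<epsilon> * B z) * ((r + 1) * t powr r * (s * (h \<bullet> B') - t * (h \<bullet> A')))"
      by (simp add: diff_divide_distrib add_divide_distrib algebra_simps)
    also have "\<dots> = (r + 1) * t powr r * s\<^sup>2 * (h \<bullet> B') - (r + 1) * t powr (r + 1) * s * (h \<bullet> A')"
      unfolding 1 using t by (simp add: powr_add power2_eq_square algebra_simps)
    finally show ?thesis by (simp add: inner_diff_right algebra_simps)
  qed
  ultimately show ?thesis by (simp add: gderiv_def)
qed

text \<open>The quotient \<open>a - b\<^bsup>r+1\<^esup> / a\<^sup>r\<close> is homogeneous of degree one, hence not differentiable at the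
  origin. Replacing \<open>a\<close> and \<open>b\<close> by \<open>sqrt (a\<^sup>2 + \<epsilon>\<^sup>2)\<close> and \<open>sqrt (b\<^sup>2 + \<epsilon>\<^sup>2)\<close> removes the singularity, and
  the term \<open>\<epsilon> b\<close> in the denominator bounds the ratio by \<open>1 / \<epsilon>\<close>, so that for each \<open>\<epsilon>\<close> the gradient is
  bounded on the whole plane. The ratios \<open>reg_t\<close> and \<open>reg_s\<close> tend to \<open>b / a\<close> and \<open>1\<close>.\<close>

definition reg_sqrt :: "real \<Rightarrow> real \<Rightarrow> real" where
  "reg_sqrt \<epsilon> a = sqrt (a\<^sup>2 + \<epsilon>\<^sup>2)"

definition reg_t :: "real \<Rightarrow> real \<times> real \<Rightarrow> real" where
  "reg_t \<epsilon> z = reg_sqrt \<epsilon> (snd z) / (reg_sqrt \<epsilon> (fst z) + \<epsilon> * reg_sqrt \<epsilon> (snd z))"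

definition reg_s :: "real \<Rightarrow> real \<times> real \<Rightarrow> real" where
  "reg_s \<epsilon> z = reg_sqrt \<epsilon> (fst z) / (reg_sqrt \<epsilon> (fst z) + \<epsilon> * reg_sqrt \<epsilon> (snd z))"

definition reg_quot :: "real \<Rightarrow> real \<Rightarrow> real \<times> real \<Rightarrow> real" where
  "reg_quot r \<epsilon> z = reg_sqrt \<epsilon> (fst z) * (1 - reg_t \<epsilon> z powr (r + 1))"

definition reg_quot_grad :: "real \<Rightarrow> real \<Rightarrow> real \<times> real \<Rightarrow> real \<times> real" where
  "reg_quot_grad r \<epsilon> z =
    ((1 - reg_t \<epsilon> z powr (r + 1) + (r + 1) * reg_t \<epsilon> z powr (r + 1) * reg_s \<epsilon> z) * (fst z / reg_sqrt \<epsilon> (fst z)),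
     - ((r + 1) * reg_t \<epsilon> z powr r * (reg_s \<epsilon> z)\<^sup>2) * (snd z / reg_sqrt \<epsilon> (snd z)))"

lemma reg_sqrt_pos: "\<epsilon> > 0 \<Longrightarrow> 0 < reg_sqrt \<epsilon> a"
  by (simp add: reg_sqrt_def add_nonneg_pos)

lemma reg_sqrt_ge: "\<bar>a\<bar> \<le> reg_sqrt \<epsilon> a"
  unfolding reg_sqrt_def by (rule real_le_rsqrt) simp

lemma reg_sqrt_le: "\<epsilon> \<ge> 0 \<Longrightarrow> reg_sqrt \<epsilon> a \<le> \<bar>a\<bar> + \<epsilon>"
  unfolding reg_sqrt_def by (rule real_le_lsqrt) (auto simp: power2_sum)

lemma reg_sqrt_GDERIV:
  assumes "\<epsilon> > 0"
  shows "GDERIV (\<lambda>z::real \<times> real. reg_sqrt \<epsilon> (fst z)) z :> (fst z / reg_sqrt \<epsilon> (fst z), 0)"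
    "GDERIV (\<lambda>z::real \<times> real. reg_sqrt \<epsilon> (snd z)) z :> (0, snd z / reg_sqrt \<epsilon> (snd z))"
proof -
  have d: "((\<lambda>a. reg_sqrt \<epsilon> a) has_real_derivative a / reg_sqrt \<epsilon> a) (at a)" for a
  proof -
    have "0 < a\<^sup>2 + \<epsilon>\<^sup>2" using assms by (simp add: add_nonneg_pos)
    then show ?thesis
      unfolding reg_sqrt_def by (auto intro!: derivative_eq_intros simp: field_simps)
  qed
  have f: "GDERIV fst z :> (1::real, 0::real)" "GDERIV snd z :> (0::real, 1::real)"
    unfolding gderiv_def
    by (auto intro!: derivative_eq_intros simp: fun_eq_iff)
  show "GDERIV (\<lambda>z::real \<times> real. reg_sqrt \<epsilon> (fst z)) z :> (fst z / reg_sqrt \<epsilon> (fst z), 0)"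
    "GDERIV (\<lambda>z::real \<times> real. reg_sqrt \<epsilon> (snd z)) z :> (0, snd z / reg_sqrt \<epsilon> (snd z))"
    using GDERIV_DERIV_compose[OF f(1) d] GDERIV_DERIV_compose[OF f(2) d] by simp_all
qed

lemma continuous_reg_sqrt: "continuous_on S (reg_sqrt \<epsilon>)"
  unfolding reg_sqrt_def by (intro continuous_intros)

lemma reg_quot_C1:
  assumes "\<epsilon> > 0" "r > 0"
  shows "C1_grad (reg_quot r \<epsilon>) (reg_quot_grad r \<epsilon>)"
  unfolding C1_grad_def
proof
  show "\<forall>z. GDERIV (reg_quot r \<epsilon>) z :> reg_quot_grad r \<epsilon> z"
  proof
    fix z
    show "GDERIV (reg_quot r \<epsilon>) z :> reg_quot_grad r \<epsilon> z"
      using GDERIV_regularised_quotient[where z = z and r = r, OF reg_sqrt_GDERIV[OF assms(1)]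
          reg_sqrt_pos[OF assms(1)] reg_sqrt_pos[OF assms(1)] assms(1)]
      unfolding reg_quot_def[abs_def] reg_quot_grad_def reg_t_def reg_s_def
      by (simp add: algebra_simps)
  qed
  have N: "reg_sqrt \<epsilon> a + \<epsilon> * reg_sqrt \<epsilon> b \<noteq> 0" "reg_sqrt \<epsilon> a \<noteq> 0" for a b
    using reg_sqrt_pos[OF assms(1)] assms(1) by (auto simp: add_pos_pos less_imp_neq[symmetric])
  have cs: "continuous_on UNIV (\<lambda>z::real \<times> real. reg_sqrt \<epsilon> (fst z))" "continuous_on UNIV (\<lambda>z::real \<times> real. reg_sqrt \<epsilon> (snd z))"
    by (auto intro!: continuous_on_compose2[OF continuous_reg_sqrt[of UNIV]] continuous_intros)
  have ct: "continuous_on UNIV (reg_t \<epsilon>)" "continuous_on UNIV (reg_s \<epsilon>)"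
    unfolding reg_t_def reg_s_def using N by (auto intro!: continuous_intros cs)
  have tp: "reg_t \<epsilon> z \<noteq> 0" for z
    using N by (simp add: reg_t_def)
  show "continuous_on UNIV (reg_quot_grad r \<epsilon>)"
    unfolding reg_quot_grad_def[abs_def] using N tp by (intro continuous_intros cs ct) auto
qed

text \<open>The bound \<open>1 / \<epsilon>\<close> makes the chain rule applicable; the bound \<open>M\<close> is uniform in \<open>\<epsilon>\<close> and holds on the cone
  where the pair of functions takes its values. It needs \<open>M \<ge> 1\<close> because both arguments are raised by
  the same \<open>\<epsilon>\<close>.\<close>

lemma reg_ts_bounds:
  assumes "\<epsilon> > 0"
  shows "0 < reg_t \<epsilon> z" "0 < reg_s \<epsilon> z" "reg_s \<epsilon> z \<le> 1" "reg_t \<epsilon> z \<le> 1 / \<epsilon>"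
    "M \<ge> 1 \<Longrightarrow> 0 \<le> snd z \<Longrightarrow> snd z \<le> M * fst z \<Longrightarrow> reg_t \<epsilon> z \<le> M"
proof -
  let ?A = "reg_sqrt \<epsilon> (fst z)" and ?B = "reg_sqrt \<epsilon> (snd z)"
  have p: "?A > 0" "?B > 0" "?A + \<epsilon> * ?B > 0" using reg_sqrt_pos[OF assms] assms by (auto simp: add_pos_pos)
  show "0 < reg_t \<epsilon> z" "0 < reg_s \<epsilon> z" using p by (auto simp: reg_t_def reg_s_def)
  show "reg_s \<epsilon> z \<le> 1" "reg_t \<epsilon> z \<le> 1 / \<epsilon>" using p assms by (auto simp: reg_t_def reg_s_def field_simps)
  assume M: "M \<ge> 1" "0 \<le> snd z" "snd z \<le> M * fst z"
  have "(snd z)\<^sup>2 \<le> (M * fst z)\<^sup>2" using M by (intro power_mono) auto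
  moreover have "1 * \<epsilon>\<^sup>2 \<le> M\<^sup>2 * \<epsilon>\<^sup>2" using M by (intro mult_right_mono) auto
  ultimately have "(snd z)\<^sup>2 + \<epsilon>\<^sup>2 \<le> M\<^sup>2 * ((fst z)\<^sup>2 + \<epsilon>\<^sup>2)" by (simp add: power_mult_distrib distrib_left)
  then have "?B \<le> M * ?A" using M real_sqrt_le_mono[of "(snd z)\<^sup>2 + \<epsilon>\<^sup>2" "M\<^sup>2 * ((fst z)\<^sup>2 + \<epsilon>\<^sup>2)"]
    by (simp add: reg_sqrt_def real_sqrt_mult)
  moreover have "M * ?A \<le> M * (?A + \<epsilon> * ?B)"
    using M p assms by (intro mult_left_mono) auto
  ultimately have "?B \<le> M * (?A + \<epsilon> * ?B)" by linarith
  then show "reg_t \<epsilon> z \<le> M" unfolding reg_t_def pos_divide_le_eq[OF p(3)] .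
qed

lemma reg_quot_grad_bound:
  assumes "\<epsilon> > 0" "r > 0" "reg_t \<epsilon> z \<le> T"
  shows "\<bar>fst (reg_quot_grad r \<epsilon> z)\<bar> \<le> 1 + (r + 2) * T powr (r + 1)"
    "\<bar>snd (reg_quot_grad r \<epsilon> z)\<bar> \<le> (r + 1) * T powr r"
    "\<bar>reg_quot r \<epsilon> z\<bar> \<le> (\<bar>fst z\<bar> + \<epsilon>) * (1 + T powr (r + 1))"
proof -
  note b = reg_ts_bounds[OF assms(1), where z = z]
  have tq: "0 \<le> reg_t \<epsilon> z powr (r + 1)" "reg_t \<epsilon> z powr (r + 1) \<le> T powr (r + 1)" "reg_t \<epsilon> z powr r \<le> T powr r"
    using b assms by (auto intro!: powr_mono2)
  have quo: "\<bar>a / reg_sqrt \<epsilon> a\<bar> \<le> 1" for a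
    using reg_sqrt_pos[OF assms(1), of a] reg_sqrt_ge[of a \<epsilon>] unfolding abs_divide by simp
  have "(r + 1) * reg_t \<epsilon> z powr (r + 1) * reg_s \<epsilon> z \<le> (r + 1) * T powr (r + 1) * 1"
    using tq b assms by (intro mult_mono) auto
  moreover have "0 \<le> (r + 1) * reg_t \<epsilon> z powr (r + 1) * reg_s \<epsilon> z" using b assms by simp
  moreover have "\<bar>1 - reg_t \<epsilon> z powr (r + 1) + (r + 1) * reg_t \<epsilon> z powr (r + 1) * reg_s \<epsilon> z\<bar>
      \<le> 1 + (r + 2) * T powr (r + 1)"
  proof -
    have "(r + 2) * T powr (r + 1) = (r + 1) * T powr (r + 1) * 1 + T powr (r + 1)"
      by (simp add: algebra_simps)
    with calculation tq show ?thesis by (intro abs_leI) linarith+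
  qed
  ultimately have "\<bar>fst (reg_quot_grad r \<epsilon> z)\<bar> \<le> (1 + (r + 2) * T powr (r + 1)) * 1"
    unfolding reg_quot_grad_def fst_conv abs_mult[of _ "fst z / _"] using quo
    by (intro mult_mono) auto
  then show "\<bar>fst (reg_quot_grad r \<epsilon> z)\<bar> \<le> 1 + (r + 2) * T powr (r + 1)" by simp
  have "\<bar>(r + 1) * reg_t \<epsilon> z powr r * (reg_s \<epsilon> z)\<^sup>2\<bar> \<le> (r + 1) * T powr r * 1"
  proof -
    have "(reg_s \<epsilon> z)\<^sup>2 \<le> 1" using b by (intro power_le_one) auto
    then have "(r + 1) * reg_t \<epsilon> z powr r * (reg_s \<epsilon> z)\<^sup>2 \<le> (r + 1) * T powr r * 1"
      using tq assms by (intro mult_mono) auto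
    then show ?thesis using assms by (simp add: abs_mult)
  qed
  then have "\<bar>snd (reg_quot_grad r \<epsilon> z)\<bar> \<le> ((r + 1) * T powr r * 1) * 1"
    unfolding reg_quot_grad_def snd_conv abs_mult[of _ "snd z / _"] abs_minus_cancel using quo
    by (intro mult_mono) auto
  then show "\<bar>snd (reg_quot_grad r \<epsilon> z)\<bar> \<le> (r + 1) * T powr r" by simp
  have "\<bar>1 - reg_t \<epsilon> z powr (r + 1)\<bar> \<le> 1 + T powr (r + 1)"
    unfolding abs_le_iff using tq(1,2) by linarith
  moreover have "\<bar>reg_sqrt \<epsilon> (fst z)\<bar> \<le> \<bar>fst z\<bar> + \<epsilon>"
    using reg_sqrt_le[of \<epsilon> "fst z"] reg_sqrt_pos[OF assms(1), of "fst z"] assms by simp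
  ultimately show "\<bar>reg_quot r \<epsilon> z\<bar> \<le> (\<bar>fst z\<bar> + \<epsilon>) * (1 + T powr (r + 1))"
    unfolding reg_quot_def abs_mult by (intro mult_mono) (use assms in auto)
qed

lemma reg_limits:
  assumes e: "(e \<longlongrightarrow> 0) F" and r: "r > 0"
  shows "a > 0 \<Longrightarrow> b > 0 \<Longrightarrow> ((\<lambda>n. reg_quot r (e n) (a, b)) \<longlongrightarrow> a * (1 - (b / a) powr (r + 1))) F"
    "a > 0 \<Longrightarrow> b > 0 \<Longrightarrow> ((\<lambda>n. reg_quot_grad r (e n) (a, b)) \<longlongrightarrow>
       (1 + r * (b / a) powr (r + 1), - ((r + 1) * (b / a) powr r))) F"
proof -
  assume ab: "a > 0" "b > 0"
  have s: "((\<lambda>n. reg_sqrt (e n) c) \<longlongrightarrow> c) F" if "c > 0" for c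
  proof -
    have "((\<lambda>n. sqrt (c\<^sup>2 + (e n)\<^sup>2)) \<longlongrightarrow> sqrt (c\<^sup>2 + 0\<^sup>2)) F" by (intro tendsto_intros e)
    then show ?thesis using that by (simp add: reg_sqrt_def)
  qed
  have N: "((\<lambda>n. reg_sqrt (e n) a + e n * reg_sqrt (e n) b) \<longlongrightarrow> a + 0 * b) F"
    by (intro tendsto_intros e s ab)
  have t: "((\<lambda>n. reg_t (e n) (a, b)) \<longlongrightarrow> b / a) F"
    using tendsto_divide[OF s[OF ab(2)] N] ab by (simp add: reg_t_def)
  have ss: "((\<lambda>n. reg_s (e n) (a, b)) \<longlongrightarrow> 1) F"
    using tendsto_divide[OF s[OF ab(1)] N] ab by (simp add: reg_s_def)
  have ba: "b / a \<noteq> 0" using ab by simp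
  show "((\<lambda>n. reg_quot r (e n) (a, b)) \<longlongrightarrow> a * (1 - (b / a) powr (r + 1))) F"
    unfolding reg_quot_def fst_conv by (intro tendsto_intros s ab t disjI1 ba)
  have q: "((\<lambda>n. c / reg_sqrt (e n) c) \<longlongrightarrow> 1) F" if "c > 0" for c
    using tendsto_divide[OF tendsto_const s[OF that], of c] that by simp
  have "((\<lambda>n. reg_quot_grad r (e n) (a, b)) \<longlongrightarrow>
     ((1 - (b / a) powr (r + 1) + (r + 1) * (b / a) powr (r + 1) * 1) * 1,
       - ((r + 1) * (b / a) powr r * 1\<^sup>2) * 1)) F"
    unfolding reg_quot_grad_def fst_conv snd_conv by (intro tendsto_intros q ab t ss disjI1 ba)
  then show "((\<lambda>n. reg_quot_grad r (e n) (a, b)) \<longlongrightarrow>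
       (1 + r * (b / a) powr (r + 1), - ((r + 1) * (b / a) powr r))) F"
    by (simp add: algebra_simps)
qed

text \<open>The chain rule applies to the regularised quotients, whose gradients converge pointwise on the open
  cone and stay bounded there by a constant independent of \<open>\<epsilon>\<close>. Off the cone both functions and both
  gradients vanish, so nothing has to converge at the singular point.\<close>

lemma DS_quotient_weak_gradient:
  fixes u v :: "'a::euclidean_space \<Rightarrow> real"
  assumes u: "W11_grad u g" and v: "W11_grad v h" and r: "r > 0" and M: "M \<ge> 1"
    and ae: "AE x in lebesgue. (u x > 0 \<and> v x > 0 \<and> v x \<le> M * u x) \<or> (u x = 0 \<and> v x = 0 \<and> g x = 0 \<and> h x = 0)"
  shows "has_weak_gradient_on (DS_quotient r u v)
    (\<lambda>x. (1 + r * (v x / u x) powr (r + 1)) *\<^sub>R g x - ((r + 1) * (v x / u x) powr r) *\<^sub>R h x) UNIV"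
proof (rule weak_gradient_dominated_limit)
  define e where "e n = 1 / real (Suc n)" for n
  have e: "e \<longlonglongrightarrow> 0" "\<And>n. e n > 0" "\<And>n. e n \<le> 1"
    unfolding e_def by (auto intro!: LIMSEQ_Suc[of "\<lambda>n. 1 / real n"] lim_1_over_n simp del: of_nat_Suc)
  let ?z = "\<lambda>x. (u x, v x)"
  let ?F = "\<lambda>n x. reg_quot r (e n) (?z x)"
  let ?G = "\<lambda>n x. fst (reg_quot_grad r (e n) (?z x)) *\<^sub>R g x + snd (reg_quot_grad r (e n) (?z x)) *\<^sub>R h x"
  have i: "integrable lebesgue u" "integrable lebesgue v" "integrable lebesgue g" "integrable lebesgue h"
    using u v by (auto simp: W11_grad_def)
  then have [measurable]: "u \<in> borel_measurable lebesgue" "v \<in> borel_measurable lebesgue"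
    "g \<in> borel_measurable lebesgue" "h \<in> borel_measurable lebesgue" by auto
  show wg: "has_weak_gradient_on (?F n) (?G n) UNIV" for n
  proof (rule W11_chain_rule[OF u v reg_quot_C1[OF e(2) r]])
    fix z
    have "norm (reg_quot_grad r (e n) z) \<le> \<bar>fst (reg_quot_grad r (e n) z)\<bar> + \<bar>snd (reg_quot_grad r (e n) z)\<bar>"
      using norm_Pair_le[of "fst (reg_quot_grad r (e n) z)" "snd (reg_quot_grad r (e n) z)"] by simp
    also have "\<dots> \<le> (1 + (r + 2) * (1 / e n) powr (r + 1)) + (r + 1) * (1 / e n) powr r"
      by (intro add_mono reg_quot_grad_bound e r reg_ts_bounds)
    finally show "norm (reg_quot_grad r (e n) z) \<le> (1 + (r + 2) * (1 / e n) powr (r + 1)) + (r + 1) * (1 / e n) powr r" .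
  qed
  show "AE x in lebesgue. (\<lambda>n. ?F n x) \<longlonglongrightarrow> DS_quotient r u v x"
    using ae
  proof eventually_elim
    case (elim x)
    then show ?case
    proof
      assume p: "u x > 0 \<and> v x > 0 \<and> v x \<le> M * u x"
      then have "u x * (1 - (v x / u x) powr (r + 1)) = DS_quotient r u v x"
        by (simp add: DS_quotient_def powr_divide powr_add field_simps)
      then show ?thesis using reg_limits(1)[OF e(1) r, of "u x" "v x"] p by simp
    next
      assume z: "u x = 0 \<and> v x = 0 \<and> g x = 0 \<and> h x = 0"
      have "(\<lambda>n. reg_quot r (e n) (0, 0)) \<longlonglongrightarrow> 0"
      proof (rule Lim_null_comparison[OF always_eventually], rule allI)
        fix n
        show "norm (reg_quot r (e n) (0, 0)) \<le> e n * (1 + 1 powr (r + 1))"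
          using reg_quot_grad_bound(3)[OF e(2)[of n] r, of "(0, 0)" 1] reg_ts_bounds(5)[OF e(2)[of n], of 1 "(0, 0)"] by simp
        show "(\<lambda>n. e n * (1 + 1 powr (r + 1))) \<longlonglongrightarrow> 0"
          using e(1) tendsto_mult_left_zero by blast
      qed
      then show ?thesis using z by (simp add: DS_quotient_def)
    qed
  qed
  show "AE x in lebesgue. (\<lambda>n. ?G n x) \<longlonglongrightarrow>
     (1 + r * (v x / u x) powr (r + 1)) *\<^sub>R g x - ((r + 1) * (v x / u x) powr r) *\<^sub>R h x"
    using ae
  proof eventually_elim
    case (elim x)
    then show ?case
    proof
      assume p: "u x > 0 \<and> v x > 0 \<and> v x \<le> M * u x"
      have l: "(\<lambda>n. reg_quot_grad r (e n) (?z x)) \<longlonglongrightarrow>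
         (1 + r * (v x / u x) powr (r + 1), - ((r + 1) * (v x / u x) powr r))"
        using reg_limits(2)[OF e(1) r, of "u x" "v x"] p by simp
      have "(\<lambda>n. ?G n x) \<longlonglongrightarrow> (1 + r * (v x / u x) powr (r + 1)) *\<^sub>R g x + (- ((r + 1) * (v x / u x) powr r)) *\<^sub>R h x"
        using tendsto_fst[OF l] tendsto_snd[OF l] by (intro tendsto_intros) simp_all
      then show ?thesis by simp
    next
      assume z: "u x = 0 \<and> v x = 0 \<and> g x = 0 \<and> h x = 0"
      then show ?thesis by simp
    qed
  qed
  have C: "C1_grad (reg_quot r (e n)) (reg_quot_grad r (e n))" for n by (rule reg_quot_C1[OF e(2) r])
  have [measurable]: "reg_quot r (e n) \<in> borel_measurable (borel \<Otimes>\<^sub>M borel)"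
    "reg_quot_grad r (e n) \<in> (borel \<Otimes>\<^sub>M borel) \<rightarrow>\<^sub>M (borel \<Otimes>\<^sub>M borel)" for n
    using borel_measurable_continuous_onI[OF C1_grad_continuous[OF C]]
      borel_measurable_continuous_onI[OF C[unfolded C1_grad_def, THEN conjunct2]]
    by (simp_all add: borel_prod)
  show "?F n \<in> borel_measurable lebesgue" "?G n \<in> borel_measurable lebesgue" for n by measurable
  show "DS_quotient r u v \<in> borel_measurable lebesgue"
    unfolding DS_quotient_def[abs_def] by measurable
  show "(\<lambda>x. (1 + r * (v x / u x) powr (r + 1)) *\<^sub>R g x - ((r + 1) * (v x / u x) powr r) *\<^sub>R h x) \<in> borel_measurable lebesgue"
    by measurable
  let ?W = "\<lambda>x. (1 + M powr (r + 1)) * \<bar>u x\<bar> + (1 + M powr (r + 1))"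
  let ?V = "\<lambda>x. (1 + (r + 2) * M powr (r + 1)) * norm (g x) + ((r + 1) * M powr r) * norm (h x)"
  show "?W locally_integrable_on UNIV"
    using i by (intro locally_integrable_add locally_integrable_const integrable_imp_locally_integrable) auto
  show "?V locally_integrable_on UNIV"
    using i by (intro integrable_imp_locally_integrable) auto
  have tM: "AE x in lebesgue. reg_t (e n) (?z x) \<le> M" for n
    using ae
  proof eventually_elim
    case (elim x)
    then show ?case using reg_ts_bounds(5)[OF e(2)[of n], of M "?z x"] M by auto
  qed
  show "AE x in lebesgue. \<bar>?F n x\<bar> \<le> ?W x" for n
    using tM[of n]
  proof eventually_elim
    case (elim x)
    have "\<bar>?F n x\<bar> \<le> (\<bar>u x\<bar> + e n) * (1 + M powr (r + 1))"
      using reg_quot_grad_bound(3)[OF e(2) r elim] by simp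
    also have "\<dots> \<le> (\<bar>u x\<bar> + 1) * (1 + M powr (r + 1))"
      using e by (intro mult_right_mono) auto
    finally show ?case by (simp add: algebra_simps)
  qed
  show "AE x in lebesgue. norm (?G n x) \<le> ?V x" for n
    using tM[of n]
  proof eventually_elim
    case (elim x)
    have "norm (?G n x) \<le> \<bar>fst (reg_quot_grad r (e n) (?z x))\<bar> * norm (g x) + \<bar>snd (reg_quot_grad r (e n) (?z x))\<bar> * norm (h x)"
      using norm_triangle_ineq[of "fst (reg_quot_grad r (e n) (?z x)) *\<^sub>R g x" "snd (reg_quot_grad r (e n) (?z x)) *\<^sub>R h x"] by simp
    also have "\<dots> \<le> ?V x"
      by (intro add_mono mult_right_mono reg_quot_grad_bound[OF e(2) r elim]) auto
    finally show ?case .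
  qed
qed

section \<open>Pointwise inequalities\<close>

text \<open>Bernoulli's inequality for real exponents. The equality case of the Picone inequality rests on its
  strict form.\<close>

lemma powr_above_tangent_one:
  fixes x q :: real
  assumes "q > 1" "x \<ge> 0"
  shows "q * x \<le> (q - 1) + x powr q" and "x \<noteq> 1 \<Longrightarrow> q * x < (q - 1) + x powr q"
proof -
  have strict: "q * x < (q - 1) + x powr q" if ne: "x \<noteq> 1"
  proof -
    have d: "((\<lambda>x. x powr q) has_real_derivative q * y powr (q - 1)) (at y)" if "y > 0" for y
      using that by (auto intro!: derivative_eq_intros)
    consider "x = 0" | "0 < x" "x < 1" | "x > 1" using ne assms(2) by linarith
    then show ?thesis
    proof cases
      case 1
      then show ?thesis using assms by simp
    next
      case 2
      then obtain z where z: "x < z" "z < 1" "1 powr q - x powr q = (1 - x) * (q * z powr (q - 1))"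
        using MVT2[of x 1 "\<lambda>x. x powr q" "\<lambda>y. q * y powr (q - 1)"] d by force
      have "z powr (q - 1) < 1 powr (q - 1)"
        using z 2 assms by (intro powr_less_mono2) auto
      then have "(1 - x) * (q * z powr (q - 1)) < (1 - x) * (q * 1)"
        using 2 assms by (intro mult_strict_left_mono) auto
      then show ?thesis using z(3) by (simp add: algebra_simps)
    next
      case 3
      then obtain z where z: "1 < z" "z < x" "x powr q - 1 powr q = (x - 1) * (q * z powr (q - 1))"
        using MVT2[of 1 x "\<lambda>x. x powr q" "\<lambda>y. q * y powr (q - 1)"] d by force
      have "1 powr (q - 1) < z powr (q - 1)"
        using z 3 assms by (intro powr_less_mono2) auto
      then have "(x - 1) * (q * 1) < (x - 1) * (q * z powr (q - 1))"
        using 3 assms by (intro mult_strict_left_mono) auto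
      then show ?thesis using z(3) by (simp add: algebra_simps)
    qed
  qed
  then show "x \<noteq> 1 \<Longrightarrow> q * x < (q - 1) + x powr q" .
  show "q * x \<le> (q - 1) + x powr q" using strict by (cases "x = 1") auto
qed

lemma powr_above_tangent:
  fixes t m q :: real
  assumes "q > 1" "t \<ge> 0" "m > 0"
  shows "m powr q + q * m powr (q - 1) * (t - m) \<le> t powr q"
    and "t \<noteq> m \<Longrightarrow> m powr q + q * m powr (q - 1) * (t - m) < t powr q"
proof -
  have m: "m powr q = m powr (q - 1) * m" using assms(3) by (simp add: powr_diff)
  have e: "m powr q * (q - 1 + (t / m) powr q - q * (t / m))
      = t powr q - (m powr q + q * m powr (q - 1) * (t - m))"
    using assms by (simp add: powr_divide field_simps m)
  have mp: "m powr q > 0" using assms(3) by simp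
  have "0 \<le> m powr q * (q - 1 + (t / m) powr q - q * (t / m))"
    using powr_above_tangent_one(1)[of q "t / m"] assms mp by (intro mult_nonneg_nonneg) auto
  then show "m powr q + q * m powr (q - 1) * (t - m) \<le> t powr q" unfolding e by simp
  assume "t \<noteq> m"
  then have "0 < m powr q * (q - 1 + (t / m) powr q - q * (t / m))"
    using powr_above_tangent_one(2)[of q "t / m"] assms mp by (intro mult_pos_pos) auto
  then show "m powr q + q * m powr (q - 1) * (t - m) < t powr q" unfolding e by simp
qed

text \<open>The difference of the two sides is \<open>(x\<^sup>q - y\<^sup>q) (x\<^bsup>p-q\<^esup> - y\<^bsup>p-q\<^esup>)\<close>, whose factors have the same sign.\<close>

lemma powr_commuting_differences_nonneg:
  fixes x y :: real
  assumes "x > 0" "y > 0" "0 < q" "q \<le> p"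
  shows "x powr q * y powr (p - q) + y powr q * x powr (p - q) \<le> x powr p + y powr p"
    and "q \<noteq> p \<Longrightarrow> x \<noteq> y \<Longrightarrow> x powr q * y powr (p - q) + y powr q * x powr (p - q) < x powr p + y powr p"
proof -
  have e: "x powr p + y powr p - (x powr q * y powr (p - q) + y powr q * x powr (p - q))
      = (x powr q - y powr q) * (x powr (p - q) - y powr (p - q))"
    using assms by (simp add: algebra_simps flip: powr_add)
  have "0 \<le> (x powr q - y powr q) * (x powr (p - q) - y powr (p - q))"
    using assms powr_mono2[of q x y] powr_mono2[of q y x] powr_mono2[of "p - q" x y] powr_mono2[of "p - q" y x]
    by (cases "x \<le> y") (auto intro: mult_nonneg_nonneg mult_nonpos_nonpos)
  then show "x powr q * y powr (p - q) + y powr q * x powr (p - q) \<le> x powr p + y powr p"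
    unfolding e[symmetric] by simp
  assume ne: "q \<noteq> p" "x \<noteq> y"
  have "0 < (x powr q - y powr q) * (x powr (p - q) - y powr (p - q))"
  proof (cases "x < y")
    case True
    then show ?thesis
      using assms ne powr_less_mono2[of q x y] powr_less_mono2[of "p - q" x y]
      by (intro mult_neg_neg) auto
  next
    case False
    then show ?thesis
      using assms ne powr_less_mono2[of q y x] powr_less_mono2[of "p - q" y x]
      by (intro mult_pos_pos) auto
  qed
  then show "x powr q * y powr (p - q) + y powr q * x powr (p - q) < x powr p + y powr p"
    unfolding e[symmetric] by simp
qed

subsection \<open>The local inequality\<close>

text \<open>Bernoulli's inequality at \<open>\<sigma> / \<tau>\<close> and at \<open>\<tau> / \<sigma>\<close> bounds the two terms on the left and cancels \<open>\<tau>\<close>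
  completely.\<close>

lemma DS_scalar_inequality:
  fixes \<tau> \<sigma> :: real
  assumes "0 < \<tau>" "0 < \<sigma>" "0 < r" "r + 1 \<le> p"
  shows "(r + 1) * (\<tau> powr r * \<sigma> + \<tau> powr (- r) * \<sigma> powr (p - 1))
    \<le> 1 + r * \<tau> powr (r + 1) + \<sigma> powr p * (1 + r * \<tau> powr (- (r + 1)))"
proof -
  have "\<tau> powr (r + 1) * ((r + 1) * (\<sigma> / \<tau>)) \<le> \<tau> powr (r + 1) * (r + (\<sigma> / \<tau>) powr (r + 1))"
    using powr_above_tangent_one(1)[of "r + 1" "\<sigma> / \<tau>"] assms by (intro mult_left_mono) auto
  moreover have "\<tau> powr (r + 1) * ((r + 1) * (\<sigma> / \<tau>)) = (r + 1) * (\<tau> powr r * \<sigma>)"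
    using assms by (simp add: powr_add field_simps)
  moreover have "\<tau> powr (r + 1) * (r + (\<sigma> / \<tau>) powr (r + 1)) = r * \<tau> powr (r + 1) + \<sigma> powr (r + 1)"
    using assms by (simp add: powr_divide field_simps)
  ultimately have 1: "(r + 1) * (\<tau> powr r * \<sigma>) \<le> r * \<tau> powr (r + 1) + \<sigma> powr (r + 1)" by simp
  have "\<sigma> powr p * \<tau> powr (- (r + 1)) * ((r + 1) * (\<tau> / \<sigma>))
      \<le> \<sigma> powr p * \<tau> powr (- (r + 1)) * (r + (\<tau> / \<sigma>) powr (r + 1))"
    using powr_above_tangent_one(1)[of "r + 1" "\<tau> / \<sigma>"] assms by (intro mult_left_mono) auto
  moreover have "\<sigma> powr p * \<tau> powr (- (r + 1)) * ((r + 1) * (\<tau> / \<sigma>)) = (r + 1) * (\<tau> powr (- r) * \<sigma> powr (p - 1))"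
    using assms by (simp add: powr_minus powr_add powr_diff field_simps)
  moreover have "\<sigma> powr p * \<tau> powr (- (r + 1)) * (r + (\<tau> / \<sigma>) powr (r + 1))
      = r * (\<sigma> powr p * \<tau> powr (- (r + 1))) + \<sigma> powr (p - (r + 1))"
  proof -
    have "\<tau> powr (- (r + 1)) * \<tau> powr (r + 1) = 1"
      using assms by (simp flip: powr_add)
    moreover have "\<sigma> powr p * (\<tau> powr (- (r + 1)) * (\<tau> / \<sigma>) powr (r + 1))
        = (\<tau> powr (- (r + 1)) * \<tau> powr (r + 1)) * \<sigma> powr (p - (r + 1))"
      using assms by (simp add: powr_diff[of \<sigma> p] powr_divide)
    ultimately show ?thesis by (simp add: algebra_simps)
  qed
  ultimately have 2: "(r + 1) * (\<tau> powr (- r) * \<sigma> powr (p - 1))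
      \<le> r * (\<sigma> powr p * \<tau> powr (- (r + 1))) + \<sigma> powr (p - (r + 1))" by simp
  have 3: "\<sigma> powr (r + 1) + \<sigma> powr (p - (r + 1)) \<le> 1 + \<sigma> powr p"
    using powr_commuting_differences_nonneg(1)[of \<sigma> 1 "r + 1" p] assms by simp
  show ?thesis using 1 2 3 by (simp add: algebra_simps)
qed

text \<open>The best \<open>t\<close> in the two hypotheses is a power of \<open>A / B\<close>, which degenerates when \<open>A\<close> or \<open>B\<close> vanishes. Hence
  both are raised by a small amount first.\<close>

lemma DS_Young_inequality:
  fixes A B X Y \<tau> :: real
  assumes "0 < \<tau>" "0 < r" "r + 1 \<le> p" "A \<ge> 0" "B \<ge> 0"
    and X: "\<And>t. t > 0 \<Longrightarrow> t * X \<le> t powr p * B + (p - 1) * A"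
    and Y: "\<And>t. t > 0 \<Longrightarrow> t * Y \<le> t powr p * A + (p - 1) * B"
  shows "(r + 1) * (\<tau> powr r * X + \<tau> powr (- r) * Y)
    \<le> p * A * (1 + r * \<tau> powr (r + 1)) + p * B * (1 + r * \<tau> powr (- (r + 1)))"
proof (rule field_le_epsilon)
  fix e :: real assume "e > 0"
  let ?C = "p * (1 + r * \<tau> powr (r + 1)) + p * (1 + r * \<tau> powr (- (r + 1)))"
  have C: "?C > 0" using assms by (intro add_pos_pos mult_pos_pos) (auto intro!: add_pos_nonneg)
  define \<epsilon> where "\<epsilon> = e / ?C"
  have \<epsilon>: "\<epsilon> > 0" "\<epsilon> * ?C = e" using \<open>e > 0\<close> C by (auto simp: \<epsilon>_def)
  define A' B' where "A' = A + \<epsilon>" and "B' = B + \<epsilon>"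
  have pos: "A' > 0" "B' > 0" using assms \<epsilon> by (auto simp: A'_def B'_def)
  define \<sigma> where "\<sigma> = (B' / A') powr (1 / p)"
  have \<sigma>: "\<sigma> > 0" "B' = \<sigma> powr p * A'"
    using pos assms by (auto simp: \<sigma>_def powr_powr)
  have p1: "p > 1" using assms by simp
  have X': "X \<le> p * (\<sigma> * A')"
  proof -
    have "(1 / \<sigma>) * X \<le> (1 / \<sigma>) powr p * B + (p - 1) * A" using X[of "1 / \<sigma>"] \<sigma> by simp
    also have "\<dots> \<le> (1 / \<sigma>) powr p * B' + (p - 1) * A'"
      using \<epsilon> p1 by (auto simp: A'_def B'_def intro!: add_mono mult_left_mono)
    also have "\<dots> = p * A'" using \<sigma> by (simp add: powr_divide algebra_simps)
    finally show ?thesis using \<sigma> by (simp add: field_simps)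
  qed
  have Y': "Y \<le> p * (\<sigma> powr (p - 1) * A')"
  proof -
    have "\<sigma> * Y \<le> \<sigma> powr p * A + (p - 1) * B" using Y \<sigma> by simp
    also have "\<dots> \<le> \<sigma> powr p * A' + (p - 1) * B'"
      using \<epsilon> p1 by (auto simp: A'_def B'_def intro!: add_mono mult_left_mono)
    also have "\<dots> = p * (\<sigma> powr p * A')" using \<sigma> by (simp add: algebra_simps)
    finally show ?thesis using \<sigma> by (simp add: powr_diff field_simps)
  qed
  have "(r + 1) * (\<tau> powr r * X + \<tau> powr (- r) * Y)
      \<le> (r + 1) * (\<tau> powr r * (p * (\<sigma> * A')) + \<tau> powr (- r) * (p * (\<sigma> powr (p - 1) * A')))"
    using X' Y' assms by (intro mult_left_mono add_mono) auto
  also have "\<dots> = p * A' * ((r + 1) * (\<tau> powr r * \<sigma> + \<tau> powr (- r) * \<sigma> powr (p - 1)))"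
    by (simp add: algebra_simps)
  also have "\<dots> \<le> p * A' * (1 + r * \<tau> powr (r + 1) + \<sigma> powr p * (1 + r * \<tau> powr (- (r + 1))))"
    using DS_scalar_inequality[of \<tau> \<sigma> r p] assms \<sigma> pos p1 by (intro mult_left_mono) auto
  also have "\<dots> = p * A' * (1 + r * \<tau> powr (r + 1)) + p * B' * (1 + r * \<tau> powr (- (r + 1)))"
    by (simp add: \<sigma>(2) algebra_simps)
  also have "\<dots> = p * A * (1 + r * \<tau> powr (r + 1)) + p * B * (1 + r * \<tau> powr (- (r + 1))) + \<epsilon> * ?C"
    by (simp add: A'_def B'_def algebra_simps)
  finally show "(r + 1) * (\<tau> powr r * X + \<tau> powr (- r) * Y)
    \<le> p * A * (1 + r * \<tau> powr (r + 1)) + p * B * (1 + r * \<tau> powr (- (r + 1))) + e"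
    by (simp only: \<epsilon>(2))
qed

lemma convex_above_tangent_gradient:
  fixes F :: "'a::euclidean_space \<Rightarrow> real"
  assumes "convex_on UNIV F" "GDERIV F a :> D"
  shows "F a + D \<bullet> (b - a) \<le> F b"
proof -
  have lim: "((\<lambda>h. (F (a + h *\<^sub>R (b - a)) - F a) / h) \<longlongrightarrow> (b - a) \<bullet> D) (at_right 0)"
    using GDERIV_difference_quotient[OF assms(2), of "b - a"] tendsto_within_subset by blast
  moreover have "\<forall>\<^sub>F h in at_right 0. (F (a + h *\<^sub>R (b - a)) - F a) / h \<le> F b - F a"
    using eventually_at_right_less[of 0] eventually_at_right_real[of 0 1, OF zero_less_one]
  proof eventually_elim
    case (elim h)
    then have h: "0 < h" "h < 1" by auto
    have "a + h *\<^sub>R (b - a) = (1 - h) *\<^sub>R a + h *\<^sub>R b" by (simp add: algebra_simps)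
    then have "F (a + h *\<^sub>R (b - a)) \<le> (1 - h) * F a + h * F b"
      using convex_onD[OF assms(1), of h a b] h by simp
    then show ?case using h by (simp add: field_simps)
  qed
  ultimately have "(b - a) \<bullet> D \<le> F b - F a"
    by (intro tendsto_upperbound[OF lim]) auto
  then show ?thesis by (simp add: inner_commute)
qed

lemma Euler_homogeneous:
  fixes F :: "'a::euclidean_space \<Rightarrow> real"
  assumes "\<And>t z. F (t *\<^sub>R z) = \<bar>t\<bar> powr p * F z" "GDERIV F a :> D"
  shows "D \<bullet> a = p * F a"
proof -
  have 1: "((\<lambda>h. (F (a + h *\<^sub>R a) - F a) / h) \<longlongrightarrow> a \<bullet> D) (at 0)"
    by (rule GDERIV_difference_quotient[OF assms(2)])
  have "F (a + h *\<^sub>R a) = \<bar>1 + h\<bar> powr p * F a" for h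
    using assms(1)[of "1 + h" a] by (simp add: algebra_simps)
  then have eq: "(F (a + h *\<^sub>R a) - F a) / h = F a * ((\<bar>1 + h\<bar> powr p - \<bar>1\<bar> powr p) / h)" for h
    by (simp add: field_simps)
  have "((\<lambda>x. x powr p) has_real_derivative p) (at 1)"
    by (auto intro!: derivative_eq_intros)
  then have "((\<lambda>x. \<bar>x\<bar> powr p) has_real_derivative p) (at 1)"
    by (rule has_field_derivative_transform_within_open[where S = "{0<..}"]) auto
  then have "((\<lambda>h. (\<bar>1 + h\<bar> powr p - \<bar>1\<bar> powr p) / h) \<longlongrightarrow> p) (at 0)"
    by (simp add: DERIV_def)
  then have "((\<lambda>h. (F (a + h *\<^sub>R a) - F a) / h) \<longlongrightarrow> F a * p) (at 0)"
    unfolding eq by (intro tendsto_mult_left)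
  then have "a \<bullet> D = F a * p" using tendsto_unique[OF _ 1] by simp
  then show ?thesis by (simp add: inner_commute mult.commute)
qed

text \<open>Here \<open>a\<close> and \<open>b\<close> play the roles of \<open>\<nabla>u\<close> and \<open>\<nabla>v\<close>, and \<open>\<tau>\<close> that of \<open>v / u\<close>. The tangent plane at \<open>z\<close> evaluated at
  \<open>t y\<close> gives, with Euler's identity, the bounds on the mixed products that Young's inequality needs.\<close>

lemma local_DS_inequality:
  fixes F :: "'a::euclidean_space \<Rightarrow> real"
  assumes "\<And>z. F z \<ge> 0" "\<And>z. GDERIV F z :> D z" "convex_on UNIV F"
    and hom: "\<And>t z. F (t *\<^sub>R z) = \<bar>t\<bar> powr p * F z"
    and "0 < \<tau>" "0 < r" "r + 1 \<le> p"
  shows "0 \<le> D a \<bullet> ((1 + r * \<tau> powr (r + 1)) *\<^sub>R a - ((r + 1) * \<tau> powr r) *\<^sub>R b)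
    + D b \<bullet> ((1 + r * \<tau> powr (- (r + 1))) *\<^sub>R b - ((r + 1) * \<tau> powr (- r)) *\<^sub>R a)"
proof -
  have E: "D z \<bullet> z = p * F z" for z by (rule Euler_homogeneous[OF hom assms(2)])
  have T: "t * (D z \<bullet> y) \<le> t powr p * F y + (p - 1) * F z" if "t > 0" for t z y
    using convex_above_tangent_gradient[OF assms(3,2), of z "t *\<^sub>R y"] that E[of z] hom[of t y]
    by (simp add: inner_diff_right algebra_simps)
  have "(r + 1) * (\<tau> powr r * (D a \<bullet> b) + \<tau> powr (- r) * (D b \<bullet> a))
    \<le> p * F a * (1 + r * \<tau> powr (r + 1)) + p * F b * (1 + r * \<tau> powr (- (r + 1)))"
    by (rule DS_Young_inequality) (use assms T in auto)
  then show ?thesis by (simp add: inner_diff_right E algebra_simps)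
qed

subsection \<open>The nonlocal inequality\<close>

text \<open>The perspective \<open>x (y / x)\<^sup>q\<close> of a convex power is convex and homogeneous of degree one, hence
  subadditive. The proof compares both summands with the tangent at the combined slope.\<close>

lemma powr_perspective_subadditive:
  fixes A B S D :: real
  assumes "q > 1" "A > 0" "B > 0" "S \<ge> 0" "D > 0" "C > 0" "C \<le> S + D"
  shows "(A + B) * (C / (A + B)) powr q \<le> A * (S / A) powr q + B * (D / B) powr q"
    and "D / B \<noteq> C / (A + B) \<Longrightarrow> (A + B) * (C / (A + B)) powr q < A * (S / A) powr q + B * (D / B) powr q"
proof -
  define y where "y = C / (A + B)"
  have y: "y > 0" using assms by (simp add: y_def)
  have 1: "A * (y powr q + q * y powr (q - 1) * (S / A - y)) \<le> A * (S / A) powr q"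
    using powr_above_tangent(1)[of q "S / A" y] assms y by (intro mult_left_mono) auto
  have 2: "B * (y powr q + q * y powr (q - 1) * (D / B - y)) \<le> B * (D / B) powr q"
    using powr_above_tangent(1)[of q "D / B" y] assms y by (intro mult_left_mono) auto
  have 3: "(A + B) * y powr q \<le> A * (y powr q + q * y powr (q - 1) * (S / A - y))
      + B * (y powr q + q * y powr (q - 1) * (D / B - y))"
  proof -
    have "A * (y powr q + q * y powr (q - 1) * (S / A - y))
      + B * (y powr q + q * y powr (q - 1) * (D / B - y))
      = (A + B) * y powr q + q * y powr (q - 1) * (A * (S / A) + B * (D / B) - (A + B) * y)"
      by (simp add: algebra_simps)
    also have "A * (S / A) + B * (D / B) - (A + B) * y = S + D - C"
      using assms by (simp add: y_def)
    finally show ?thesis using assms by simp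
  qed
  show "(A + B) * (C / (A + B)) powr q \<le> A * (S / A) powr q + B * (D / B) powr q"
    using 1 2 3 by (simp add: y_def)
  assume "D / B \<noteq> C / (A + B)"
  then have "B * (y powr q + q * y powr (q - 1) * (D / B - y)) < B * (D / B) powr q"
    using powr_above_tangent(2)[of q "D / B" y] assms y by (intro mult_strict_left_mono) (auto simp: y_def)
  then show "(A + B) * (C / (A + B)) powr q < A * (S / A) powr q + B * (D / B) powr q"
    using 1 3 by (simp add: y_def)
qed

text \<open>Subadditivity of the perspective for \<open>a = (a - b) + b\<close> and \<open>c \<le> \<bar>c - d\<bar> + d\<close>. If equality holds, then
  the slopes \<open>d / b\<close> and \<open>c / a\<close> agree.\<close>

lemma discrete_Picone_ordered:
  fixes a b c d :: real
  assumes "0 < b" "b < a" "0 < c" "0 < d" "0 < r"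
  shows "signed_powr (a - b) (p - 1) * (c powr (r + 1) / a powr r - d powr (r + 1) / b powr r)
      \<le> \<bar>c - d\<bar> powr (r + 1) * \<bar>a - b\<bar> powr (p - (r + 1))"
    and "a / c \<noteq> b / d \<Longrightarrow>
      signed_powr (a - b) (p - 1) * (c powr (r + 1) / a powr r - d powr (r + 1) / b powr r)
      < \<bar>c - d\<bar> powr (r + 1) * \<bar>a - b\<bar> powr (p - (r + 1))"
proof -
  have persp: "x * (y / x) powr (r + 1) = y powr (r + 1) / x powr r" if "x > 0" "y \<ge> 0" for x y :: real
    using that by (simp add: powr_divide powr_add field_simps)
  have ab: "0 < a - b" "a - b + b = a" "0 < a" using assms by auto
  have sp: "signed_powr (a - b) (p - 1) = (a - b) powr (p - 1)"
    using ab by (simp add: signed_powr_def powr_diff power2_eq_square)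
  have e: "(a - b) powr (p - 1) * (\<bar>c - d\<bar> powr (r + 1) / (a - b) powr r)
      = \<bar>c - d\<bar> powr (r + 1) * \<bar>a - b\<bar> powr (p - (r + 1))"
    using ab by (simp add: powr_diff powr_add field_simps)
  have pe: "a * (c / a) powr (r + 1) = c powr (r + 1) / a powr r"
    "(a - b) * (\<bar>c - d\<bar> / (a - b)) powr (r + 1) = \<bar>c - d\<bar> powr (r + 1) / (a - b) powr r"
    "b * (d / b) powr (r + 1) = d powr (r + 1) / b powr r"
    using persp ab assms by auto
  note P = powr_perspective_subadditive[of "r + 1" "a - b" b "\<bar>c - d\<bar>" d c, unfolded ab(2) pe]
  have P1: "c powr (r + 1) / a powr r - d powr (r + 1) / b powr r \<le> \<bar>c - d\<bar> powr (r + 1) / (a - b) powr r"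
    using P(1) assms ab by linarith
  then have "(a - b) powr (p - 1) * (c powr (r + 1) / a powr r - d powr (r + 1) / b powr r)
      \<le> (a - b) powr (p - 1) * (\<bar>c - d\<bar> powr (r + 1) / (a - b) powr r)"
    by (intro mult_left_mono) auto
  then show "signed_powr (a - b) (p - 1) * (c powr (r + 1) / a powr r - d powr (r + 1) / b powr r)
      \<le> \<bar>c - d\<bar> powr (r + 1) * \<bar>a - b\<bar> powr (p - (r + 1))"
    unfolding sp e .
  assume "a / c \<noteq> b / d"
  then have "d / b \<noteq> c / a" using assms ab by (auto simp: field_simps)
  then have "c powr (r + 1) / a powr r - d powr (r + 1) / b powr r < \<bar>c - d\<bar> powr (r + 1) / (a - b) powr r"
    using P(2) assms ab by linarith
  then have "(a - b) powr (p - 1) * (c powr (r + 1) / a powr r - d powr (r + 1) / b powr r)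
      < (a - b) powr (p - 1) * (\<bar>c - d\<bar> powr (r + 1) / (a - b) powr r)"
    using ab by (intro mult_strict_left_mono) auto
  then show "signed_powr (a - b) (p - 1) * (c powr (r + 1) / a powr r - d powr (r + 1) / b powr r)
      < \<bar>c - d\<bar> powr (r + 1) * \<bar>a - b\<bar> powr (p - (r + 1))"
    unfolding sp e .
qed

lemma signed_powr_swap: "signed_powr (b - a) q = - signed_powr (a - b) q"
  unfolding signed_powr_def by (simp add: abs_minus_commute flip: mult_minus_right)

lemma discrete_Picone:
  fixes a b c d :: real
  assumes "0 < a" "0 < b" "a \<noteq> b" "0 < c" "0 < d" "0 < r"
  shows "signed_powr (a - b) (p - 1) * (c powr (r + 1) / a powr r - d powr (r + 1) / b powr r)
      \<le> \<bar>c - d\<bar> powr (r + 1) * \<bar>a - b\<bar> powr (p - (r + 1))" (is ?le)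
    and "a / c \<noteq> b / d \<Longrightarrow>
      signed_powr (a - b) (p - 1) * (c powr (r + 1) / a powr r - d powr (r + 1) / b powr r)
      < \<bar>c - d\<bar> powr (r + 1) * \<bar>a - b\<bar> powr (p - (r + 1))" (is "_ \<Longrightarrow> ?less")
proof -
  have "?le \<and> (a / c \<noteq> b / d \<longrightarrow> ?less)"
  proof (cases "b < a")
    case True
    then show ?thesis using discrete_Picone_ordered[of b a c d r p] assms by blast
  next
    case False
    then have "a < b" using assms by auto
    then show ?thesis using discrete_Picone_ordered[of a b d c r p] assms
      by (simp add: signed_powr_swap[of b a] abs_minus_commute algebra_simps)
  qed
  then show ?le "a / c \<noteq> b / d \<Longrightarrow> ?less" by auto
qed

definition DS_ratio :: "real \<Rightarrow> real \<Rightarrow> real \<Rightarrow> real" where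
  "DS_ratio r a c = (a powr (r + 1) - c powr (r + 1)) / a powr r"

lemma DS_quotient_eq: "DS_quotient r u v x = DS_ratio r (u x) (v x)"
  by (simp add: DS_quotient_def DS_ratio_def)

lemma DS_ratio_pos: "a > 0 \<Longrightarrow> DS_ratio r a c = a - c powr (r + 1) / a powr r"
  by (simp add: DS_ratio_def diff_divide_distrib powr_add)

text \<open>The sum of the two nonlocal integrands without the kernel, for \<open>a = u x\<close>, \<open>b = u y\<close>, \<open>c = v x\<close>, \<open>d = v y\<close>.\<close>

definition nonlocal_DS :: "real \<Rightarrow> real \<Rightarrow> real \<Rightarrow> real \<Rightarrow> real \<Rightarrow> real \<Rightarrow> real" where
  "nonlocal_DS p r a b c d =
     signed_powr (a - b) (p - 1) * (DS_ratio r a c - DS_ratio r b d)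
   + signed_powr (c - d) (p - 1) * (DS_ratio r c a - DS_ratio r d b)"

lemma nonlocal_DS_sym: 
  "nonlocal_DS p r b a d c = nonlocal_DS p r a b c d" "nonlocal_DS p r c d a b = nonlocal_DS p r a b c d"
  by (simp_all add: nonlocal_DS_def signed_powr_swap[of b a] signed_powr_swap[of d c] algebra_simps)

lemma signed_powr_mult_self: "signed_powr t (p - 1) * t = \<bar>t\<bar> powr p"
proof (cases "t = 0")
  case False
  then have "\<bar>t\<bar> powr (p - 2) * (\<bar>t\<bar> * \<bar>t\<bar>) = \<bar>t\<bar> powr p"
    by (simp add: powr_diff power2_eq_square)
  then show ?thesis by (simp add: signed_powr_def abs_mult_self_eq mult.assoc)
qed (simp add: signed_powr_def)

text \<open>If one of the functions has equal values at the two points, the Picone inequality degenerates; but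
  then the remaining product has two factors of the same sign.\<close>

lemma nonlocal_DS_one_const:
  assumes "0 < a" "0 < c" "0 < d" "c \<noteq> d" "0 < r"
  shows "0 < nonlocal_DS p r a a c d"
proof -
  have less: "0 < nonlocal_DS p r a a c d" if "0 < d" "d < c" for c d
  proof -
    have "1 / c powr r < 1 / d powr r"
      using that assms by (intro divide_strict_left_mono powr_less_mono2) auto
    then have "a powr (r + 1) * (1 / c powr r) < a powr (r + 1) * (1 / d powr r)"
      using assms by (intro mult_strict_left_mono) auto
    then have "0 < DS_ratio r c a - DS_ratio r d a"
      using that by (simp add: DS_ratio_pos)
    moreover have "0 < signed_powr (c - d) (p - 1)" using that by (simp add: signed_powr_def)
    ultimately show ?thesis by (simp add: nonlocal_DS_def signed_powr_def[of 0])
  qed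
  show ?thesis using less[of d c] less[of c d] nonlocal_DS_sym(1)[of p r a a d c] assms
    by (cases "d < c") auto
qed

lemma nonlocal_DS_inequality:
  assumes "0 < a" "0 < b" "0 < c" "0 < d" "0 < r" "r + 1 \<le> p"
  shows "0 \<le> nonlocal_DS p r a b c d"
    and "nonlocal_DS p r a b c d = 0 \<Longrightarrow> a / c = b / d"
    and "nonlocal_DS p r a b c d = 0 \<Longrightarrow> r + 1 \<noteq> p \<Longrightarrow> \<bar>a - b\<bar> = \<bar>c - d\<bar>"
proof -
  consider "a = b" "c = d" | "a = b" "c \<noteq> d" | "a \<noteq> b" "c = d" | "a \<noteq> b" "c \<noteq> d" by blast
  then have "0 \<le> nonlocal_DS p r a b c d \<and> (nonlocal_DS p r a b c d = 0 \<longrightarrow>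
      a / c = b / d \<and> (r + 1 \<noteq> p \<longrightarrow> \<bar>a - b\<bar> = \<bar>c - d\<bar>))"
  proof cases
    case 1
    then show ?thesis by (simp add: nonlocal_DS_def)
  next
    case 2
    then show ?thesis using nonlocal_DS_one_const[of a c d r p] assms by simp
  next
    case 3
    then show ?thesis using nonlocal_DS_one_const[of c a b r p] nonlocal_DS_sym(2)[of p r c d a b] assms by simp
  next
    case 4
    let ?A = "\<bar>a - b\<bar>" and ?C = "\<bar>c - d\<bar>"
    let ?x = "signed_powr (a - b) (p - 1) * (c powr (r + 1) / a powr r - d powr (r + 1) / b powr r)"
    let ?y = "signed_powr (c - d) (p - 1) * (a powr (r + 1) / c powr r - b powr (r + 1) / d powr r)"
    have e: "nonlocal_DS p r a b c d = ?A powr p - ?x + (?C powr p - ?y)"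
      using assms by (simp add: nonlocal_DS_def DS_ratio_pos algebra_simps flip: signed_powr_mult_self)
    let ?X = "?C powr (r + 1) * ?A powr (p - (r + 1))" and ?Y = "?A powr (r + 1) * ?C powr (p - (r + 1))"
    have x: "?x \<le> ?X" "a / c \<noteq> b / d \<Longrightarrow> ?x < ?X"
      using discrete_Picone[of a b c d r p] assms 4 by blast+
    have y: "?y \<le> ?Y" using discrete_Picone(1)[of c d a b r p] assms 4 by blast
    have pos: "?A > 0" "?C > 0" "0 < r + 1" using assms 4 by auto
    have m: "?Y + ?X \<le> ?A powr p + ?C powr p" "r + 1 \<noteq> p \<Longrightarrow> ?A \<noteq> ?C \<Longrightarrow> ?Y + ?X < ?A powr p + ?C powr p"
      using powr_commuting_differences_nonneg[OF pos assms(6)] by blast+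
    show ?thesis unfolding e
    proof (intro conjI impI)
      show "0 \<le> ?A powr p - ?x + (?C powr p - ?y)" using x(1) y m(1) by linarith
      assume z: "?A powr p - ?x + (?C powr p - ?y) = 0"
      show "a / c = b / d"
      proof (rule ccontr)
        assume "a / c \<noteq> b / d"
        then show False using x(2) y m(1) z by linarith
      qed
      assume "r + 1 \<noteq> p"
      show "?A = ?C"
      proof (rule ccontr)
        assume "?A \<noteq> ?C"
        then show False using x(1) y m(2)[OF \<open>r + 1 \<noteq> p\<close>] z by linarith
      qed
    qed
  qed
  then show "0 \<le> nonlocal_DS p r a b c d"
    and "nonlocal_DS p r a b c d = 0 \<Longrightarrow> a / c = b / d"
    and "nonlocal_DS p r a b c d = 0 \<Longrightarrow> r + 1 \<noteq> p \<Longrightarrow> \<bar>a - b\<bar> = \<bar>c - d\<bar>" by auto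
qed

text \<open>One of the two points lies where both functions vanish. By the conventions for division and powers,
  the quotient vanishes there too.\<close>

lemma nonlocal_DS_outside:
  assumes "0 < a" "0 < c" "0 < r" "r + 1 \<le> p"
  shows "0 \<le> nonlocal_DS p r a 0 c 0"
proof -
  have s: "signed_powr x (p - 1) = x powr (p - 1)" if "x > 0" for x
    using that by (simp add: signed_powr_def powr_diff power2_eq_square)
  have "x powr (p - 1) * (y powr (r + 1) / x powr r) = y powr (r + 1) * x powr (p - (r + 1))" if "x > 0" for x y
    using that by (simp add: powr_diff powr_add field_simps)
  moreover have "x powr (p - 1) * x = x powr p" if "x > 0" for x :: real using that by (simp add: powr_diff)
  ultimately have "nonlocal_DS p r a 0 c 0 = a powr p + c powr p - (a powr (r + 1) * c powr (p - (r + 1)) + c powr (r + 1) * a powr (p - (r + 1)))"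
    using assms by (simp add: nonlocal_DS_def s DS_ratio_pos DS_ratio_def[of r 0 0] right_diff_distrib)
  then show ?thesis using powr_commuting_differences_nonneg(1)[of a c "r + 1" p] assms by simp
qed

section \<open>Finiteness of the Gagliardo seminorm\<close>

subsection \<open>Lebesgue null sets and measurability in a product\<close>

text \<open>Lebesgue measure on the product is the completion of the product of the Borel measures, so null sets
  are transported through Borel null sets that contain them.\<close>

lemma AE_lebesgue_prod:
  assumes "AE x in (lebesgue::'a::euclidean_space measure). P x"
  shows "AE z in (lebesgue::('a \<times> 'a) measure). P (fst z) \<and> P (snd z)"
proof -
  have "AE x in (lborel::'a measure). P x" using assms by (simp add: AE_completion_iff)
  then obtain N where N: "{x. \<not> P x} \<subseteq> N" "N \<in> null_sets (lborel::'a measure)"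
    by (auto elim!: AE_E simp: null_sets_def)
  then have [measurable]: "N \<in> sets borel" by auto
  have n: "AE x in lborel. x \<notin> N" using N(2) by (rule AE_not_in)
  have 1: "AE z in (lborel :: 'a measure) \<Otimes>\<^sub>M (lborel :: 'a measure). fst z \<notin> N"
  proof (rule lborel_pair.AE_pair_measure)
    show "{z \<in> space (lborel \<Otimes>\<^sub>M lborel). fst z \<notin> N} \<in> sets ((lborel :: 'a measure) \<Otimes>\<^sub>M (lborel :: 'a measure))"
      by measurable
    show "AE x in lborel. AE y in lborel. fst (x, y) \<notin> N" using n by eventually_elim simp
  qed
  have 2: "AE z in (lborel :: 'a measure) \<Otimes>\<^sub>M (lborel :: 'a measure). snd z \<notin> N"
  proof (rule lborel_pair.AE_pair_measure)
    show "{z \<in> space (lborel \<Otimes>\<^sub>M lborel). snd z \<notin> N} \<in> sets ((lborel :: 'a measure) \<Otimes>\<^sub>M (lborel :: 'a measure))"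
      by measurable
    show "AE x in lborel. AE y in lborel. snd (x, y) \<notin> N" using n by simp
  qed
  have "AE z in (lborel :: ('a \<times> 'a) measure). P (fst z) \<and> P (snd z)"
    using 1 2 unfolding lborel_prod by eventually_elim (use N(1) in blast)
  then show ?thesis by (rule AE_completion)
qed

lemma lebesgue_measurable_prod:
  fixes f :: "'a::euclidean_space \<Rightarrow> real"
  assumes "f \<in> borel_measurable lebesgue"
  shows "(\<lambda>z. f (fst z)) \<in> borel_measurable (lebesgue :: ('a \<times> 'a) measure)"
    "(\<lambda>z. f (snd z)) \<in> borel_measurable (lebesgue :: ('a \<times> 'a) measure)"
proof -
  have "\<exists>f'\<in>borel_measurable borel. AE x in lebesgue. f x = f' x"
    using completion_ex_borel_measurable_real[OF assms] by (auto intro: AE_completion)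
  then obtain f' where f': "f' \<in> borel_measurable borel" "AE x in lebesgue. f x = f' x" by blast
  have m: "(\<lambda>z::'a \<times> 'a. f' (fst z)) \<in> borel_measurable lborel" "(\<lambda>z::'a \<times> 'a. f' (snd z)) \<in> borel_measurable lborel"
  proof -
    have "(fst :: 'a \<times> 'a \<Rightarrow> 'a) \<in> borel_measurable borel" "(snd :: 'a \<times> 'a \<Rightarrow> 'a) \<in> borel_measurable borel"
      by (intro borel_measurable_continuous_onI continuous_intros)+
    from measurable_compose[OF this(1) f'(1)] measurable_compose[OF this(2) f'(1)]
    show "(\<lambda>z::'a \<times> 'a. f' (fst z)) \<in> borel_measurable lborel" "(\<lambda>z::'a \<times> 'a. f' (snd z)) \<in> borel_measurable lborel"
      by (simp_all only: measurable_lborel2)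
  qed
  have ae: "AE z in (lebesgue :: ('a \<times> 'a) measure). f (fst z) = f' (fst z) \<and> f (snd z) = f' (snd z)"
    by (rule AE_lebesgue_prod[OF f'(2)])
  show "(\<lambda>z. f (fst z)) \<in> borel_measurable (lebesgue :: ('a \<times> 'a) measure)"
    by (rule borel_measurable_AE[OF measurable_completion[OF m(1)]]) (use ae in eventually_elim, simp)
  show "(\<lambda>z. f (snd z)) \<in> borel_measurable (lebesgue :: ('a \<times> 'a) measure)"
    by (rule borel_measurable_AE[OF measurable_completion[OF m(2)]]) (use ae in eventually_elim, simp)
qed

subsection \<open>Integrability of radial powers\<close>

lemma ennreal_term_le_suminf: "f k \<le> (\<Sum>k. f k :: ennreal)"
  using sum_le_suminf[of f "{k}"] by simp

text \<open>A ball of radius \<open>\<rho>\<^sub>k\<close> has measure proportional to \<open>\<rho>\<^sub>k\<close> to the power of the dimension, so the scale \<open>k\<close>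
  contributes a multiple of the \<open>k\<close>-th term of a geometric series. The balls may shrink or grow, which
  covers singularities at the origin and decay at infinity alike.\<close>

lemma nn_integral_dyadic_finite:
  fixes f :: "'a::euclidean_space \<Rightarrow> ennreal" and \<rho> :: "nat \<Rightarrow> real"
  assumes "\<alpha> > 0" "c \<ge> 0" "\<And>k. \<rho> k > 0"
    and f: "\<And>h. f h \<noteq> 0 \<Longrightarrow> \<exists>k. norm h < \<rho> k \<and> f h \<le> ennreal (c * ((1/2) powr \<alpha>) ^ k / \<rho> k ^ DIM('a))"
  shows "(\<integral>\<^sup>+h. f h \<partial>lborel) < \<infinity>"
proof -
  let ?q = "(1/2::real) powr \<alpha>"
  let ?V = "unit_ball_vol (real DIM('a))"
  let ?g = "\<lambda>k h. ennreal (c * ?q ^ k / \<rho> k ^ DIM('a)) * indicator (ball (0::'a) (\<rho> k)) h"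
  have q: "0 < ?q" "?q < 1" using assms(1) powr_less_mono2[of \<alpha> "1/2" 1] by auto
  have "f h \<le> (\<Sum>k. ?g k h)" for h
  proof (cases "f h = 0")
    case False
    then obtain k where k: "norm h < \<rho> k" "f h \<le> ennreal (c * ?q ^ k / \<rho> k ^ DIM('a))" using f by blast
    then have "f h \<le> ?g k h" by simp
    also have "\<dots> \<le> (\<Sum>k. ?g k h)" by (rule ennreal_term_le_suminf)
    finally show ?thesis .
  qed simp
  then have "(\<integral>\<^sup>+h. f h \<partial>lborel) \<le> (\<integral>\<^sup>+h. (\<Sum>k. ?g k h) \<partial>lborel)" by (intro nn_integral_mono)
  also have "\<dots> = (\<Sum>k. \<integral>\<^sup>+h. ?g k h \<partial>lborel)" 
    by (rule nn_integral_suminf) (intro borel_measurable_times_ennreal borel_measurable_const borel_measurable_indicator, simp)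
  also have "\<dots> = (\<Sum>k. ennreal (c * ?V * ?q ^ k))"
  proof (rule suminf_cong)
    fix k
    have "(\<integral>\<^sup>+h. ?g k h \<partial>lborel) = ennreal (c * ?q ^ k / \<rho> k ^ DIM('a)) * emeasure lborel (ball (0::'a) (\<rho> k))"
      by (rule nn_integral_cmult_indicator) simp
    also have "\<dots> = ennreal (c * ?q ^ k / \<rho> k ^ DIM('a)) * ennreal (?V * \<rho> k ^ DIM('a))"
      using assms(3)[of k] by (simp add: emeasure_ball)
    also have "\<dots> = ennreal (c * ?q ^ k / \<rho> k ^ DIM('a) * (?V * \<rho> k ^ DIM('a)))"
      by (intro ennreal_mult[symmetric] divide_nonneg_nonneg mult_nonneg_nonneg zero_le_power assms(2)
          less_imp_le[OF assms(3)] less_imp_le[OF q(1)] unit_ball_vol_nonneg) auto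
    also have "c * ?q ^ k / \<rho> k ^ DIM('a) * (?V * \<rho> k ^ DIM('a)) = c * ?V * ?q ^ k"
      using assms(3)[of k] by simp
    finally show "(\<integral>\<^sup>+h. ?g k h \<partial>lborel) = ennreal (c * ?V * ?q ^ k)" .
  qed
  also have "\<dots> = ennreal (\<Sum>k. c * ?V * ?q ^ k)"
    using q assms(2) by (intro suminf_ennreal2) (auto intro!: summable_mult summable_geometric)
  also have "\<dots> < \<infinity>" by simp
  finally show ?thesis .
qed

lemma dyadic_scale:
  fixes t :: real
  assumes "0 < t" "t \<le> 1"
  obtains k where "(1/2) ^ Suc k < t" "t \<le> (1/2) ^ k"
proof -
  obtain n where n: "(1/2::real) ^ n < t" using real_arch_pow_inv[OF assms(1), of "1/2"] by auto
  define m where "m = (LEAST n. (1/2::real) ^ n < t)"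
  have m: "(1/2::real) ^ m < t" unfolding m_def using n by (rule LeastI)
  then have "m \<noteq> 0" using assms by (intro notI) simp
  then obtain k where k: "m = Suc k" by (cases m) auto
  then have "\<not> (1/2::real) ^ k < t" using not_less_Least[of k "\<lambda>n. (1/2::real) ^ n < t"] by (simp add: m_def)
  then show ?thesis using that m k by simp
qed

lemma nn_integral_radial_inside:
  fixes \<alpha> :: real
  assumes "\<alpha> > 0"
  shows "(\<integral>\<^sup>+h. ennreal (norm h powr (\<alpha> - real DIM('a))) * indicator (cball 0 1) h \<partial>(lborel::'a::euclidean_space measure)) < \<infinity>"
proof (rule nn_integral_dyadic_finite[where \<rho> = "\<lambda>k. 2 * (1/2) ^ k" and c = "4 ^ DIM('a)", OF assms])
  fix h :: 'a
  assume nz: "ennreal (norm h powr (\<alpha> - real DIM('a))) * indicator (cball 0 1) h \<noteq> 0"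
  then have h: "h \<noteq> 0" "norm h \<le> 1" by (auto simp: indicator_def split: if_splits)
  then obtain k where k: "(1/2) ^ Suc k < norm h" "norm h \<le> (1/2) ^ k"
    using dyadic_scale[of "norm h"] by auto
  have pw: "norm h powr \<alpha> \<le> ((1/2) powr \<alpha>) ^ k"
  proof -
    have "norm h powr \<alpha> \<le> ((1/2) ^ k) powr \<alpha>" using k assms by (intro powr_mono2) auto
    also have "\<dots> = ((1/2) powr \<alpha>) ^ k" by (simp add: powr_powr mult.commute flip: powr_realpow)
    finally show ?thesis .
  qed
  have "norm h powr (\<alpha> - real DIM('a)) = norm h powr \<alpha> / norm h ^ DIM('a)"
    using h by (simp add: powr_diff powr_realpow)
  also have "\<dots> \<le> ((1/2) powr \<alpha>) ^ k / ((1/2) ^ Suc k) ^ DIM('a)"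
    using pw k h by (intro frac_le power_mono) auto
  also have "\<dots> = 4 ^ DIM('a) * ((1/2) powr \<alpha>) ^ k / (2 * (1/2) ^ k) ^ DIM('a)"
    by (simp add: power_mult_distrib power_divide field_simps flip: power_mult)
      (simp add: power2_eq_square flip: power_mult_distrib)
  finally show "\<exists>k. norm h < 2 * (1/2) ^ k \<and> ennreal (norm h powr (\<alpha> - real DIM('a))) * indicator (cball 0 1) h
      \<le> ennreal (4 ^ DIM('a) * ((1/2) powr \<alpha>) ^ k / (2 * (1/2) ^ k) ^ DIM('a))"
    using k h by (intro exI[of _ k] conjI) (auto intro!: ennreal_leI intro: le_less_trans[of _ "(1/2) ^ k"])
qed auto

lemma nn_integral_radial_outside:
  fixes \<alpha> :: real
  assumes "\<alpha> > 0"
  shows "(\<integral>\<^sup>+h. ennreal (norm h powr (- \<alpha> - real DIM('a))) * indicator (- cball 0 1) h \<partial>(lborel::'a::euclidean_space measure)) < \<infinity>"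
proof (rule nn_integral_dyadic_finite[where \<rho> = "\<lambda>k. 2 * 2 ^ k" and c = "2 ^ DIM('a)", OF assms])
  fix h :: 'a
  assume nz: "ennreal (norm h powr (- \<alpha> - real DIM('a))) * indicator (- cball 0 1) h \<noteq> 0"
  then have h: "norm h > 1" by (auto simp: indicator_def split: if_splits)
  then have hn: "0 < norm h" by linarith
  then have "0 < 1 / norm h" "1 / norm h \<le> 1" using h by (simp_all add: divide_le_eq)
  then obtain k where k: "(1/2) ^ Suc k < 1 / norm h" "1 / norm h \<le> (1/2) ^ k"
    by (rule dyadic_scale)
  then have "1 < 2 * 2 ^ k / norm h" "2 ^ k / norm h \<le> 1" by (auto simp: field_simps power_divide)
  then have k': "2 ^ k \<le> norm h" "norm h < 2 * 2 ^ k"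
    using pos_less_divide_eq[OF hn, of 1 "2 * 2 ^ k"] pos_divide_le_eq[OF hn, of "2 ^ k" 1] by simp_all
  have pw: "norm h powr (- \<alpha>) \<le> ((1/2) powr \<alpha>) ^ k"
  proof -
    have "norm h powr (- \<alpha>) \<le> (2 ^ k) powr (- \<alpha>)" using k' assms by (intro powr_mono2') auto
    also have "\<dots> = ((1/2) powr \<alpha>) ^ k"
      by (simp add: powr_powr powr_minus powr_divide power_divide field_simps mult.commute flip: powr_realpow)
    finally show ?thesis .
  qed
  have "norm h powr (- \<alpha> - real DIM('a)) = norm h powr (- \<alpha>) / norm h ^ DIM('a)"
    by (subst powr_diff) (use powr_realpow[OF hn, of "DIM('a)"] in simp)
  also have "\<dots> \<le> ((1/2) powr \<alpha>) ^ k / (2 ^ k) ^ DIM('a)"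
    using pw k' h by (intro frac_le power_mono) auto
  also have "\<dots> = 2 ^ DIM('a) * ((1/2) powr \<alpha>) ^ k / (2 * 2 ^ k) ^ DIM('a)"
    by (simp add: power_mult_distrib)
  finally show "\<exists>k. norm h < 2 * 2 ^ k \<and> ennreal (norm h powr (- \<alpha> - real DIM('a))) * indicator (- cball 0 1) h
      \<le> ennreal (2 ^ DIM('a) * ((1/2) powr \<alpha>) ^ k / (2 * 2 ^ k) ^ DIM('a))"
    using k' h by (intro exI[of _ k] conjI) (auto intro!: ennreal_leI simp: indicator_def)
qed auto

subsection \<open>Translates of smooth functions\<close>

text \<open>Jensen's inequality for the derivative along the segment, proved by integrating the tangent to the
  power at the absolute value of the increment.\<close>

lemma segment_bound:
  fixes f :: "'a::euclidean_space \<Rightarrow> real"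
  assumes "C1_grad f g" "p > 1"
  shows "ennreal (\<bar>f (x + h) - f x\<bar> powr p)
    \<le> (\<integral>\<^sup>+t. ennreal (norm h powr p * norm (g (x + t *\<^sub>R h)) powr p) * indicator {0..1} t \<partial>lborel)"
proof -
  let ?d = "\<lambda>t. h \<bullet> g (x + t *\<^sub>R h)"
  let ?m = "\<bar>f (x + h) - f x\<bar>"
  have G: "\<And>x. GDERIV f x :> g x" and cg: "continuous_on UNIV g" using assms by (auto simp: C1_grad_def)
  have cgt: "continuous_on S (\<lambda>t::real. g (x + t *\<^sub>R h))" for S
    by (rule continuous_on_compose2[OF cg]) (auto intro!: continuous_intros)
  have cd: "continuous_on {0..1} ?d" by (intro continuous_intros cgt)
  have "(?d has_integral (f (x + 1 *\<^sub>R h) - f (x + 0 *\<^sub>R h))) {0..1}"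
  proof (rule fundamental_theorem_of_calculus)
    fix t :: real
    have "((\<lambda>t. x + t *\<^sub>R h) has_derivative (\<lambda>s. s *\<^sub>R h)) (at t within {0..1})"
      by (auto intro!: derivative_eq_intros)
    moreover have "(f has_derivative (\<lambda>e. e \<bullet> g (x + t *\<^sub>R h))) (at (x + t *\<^sub>R h))"
      using G by (simp add: gderiv_def)
    ultimately have "((\<lambda>t. f (x + t *\<^sub>R h)) has_derivative (\<lambda>s. (s *\<^sub>R h) \<bullet> g (x + t *\<^sub>R h))) (at t within {0..1})"
      by (rule has_derivative_compose)
    then show "((\<lambda>t. f (x + t *\<^sub>R h)) has_vector_derivative ?d t) (at t within {0..1})"
      by (simp add: has_vector_derivative_def)
  qed simp
  then have I: "integral {0..1} ?d = f (x + h) - f x" by (simp add: integral_unique)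
  have id: "?d integrable_on {0..1}" and ia: "(\<lambda>t. \<bar>?d t\<bar>) integrable_on {0..1}"
    using cd by (auto intro!: integrable_continuous_interval continuous_intros)
  have m: "?m \<le> integral {0..1} (\<lambda>t. \<bar>?d t\<bar>)"
    unfolding I[symmetric] using integral_norm_bound_integral[OF id ia] by simp
  let ?k = "\<lambda>t. norm h powr p * norm (g (x + t *\<^sub>R h)) powr p"
  have ck: "continuous_on {0..1} ?k"
    by (intro continuous_on_mult continuous_on_const continuous_on_powr' continuous_on_norm cgt)
      (use assms(2) in auto)
  then have ik: "?k integrable_on {0..1}" by (rule integrable_continuous_interval)
  have "?m powr p \<le> integral {0..1} ?k"
  proof (cases "?m = 0")
    case True
    moreover have "0 \<le> integral {0..1} ?k" by (rule integral_nonneg[OF ik]) simp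
    ultimately show ?thesis by (simp only: True powr_0)
  next
    case False
    let ?l = "\<lambda>t. ?m powr p + p * ?m powr (p - 1) * (\<bar>?d t\<bar> - ?m)"
    have il: "?l integrable_on {0..1}"
      using cd by (auto intro!: integrable_continuous_interval continuous_intros)
    have "(?l has_integral ?m powr p * 1 + p * ?m powr (p - 1) * (integral {0..1} (\<lambda>t. \<bar>?d t\<bar>) - ?m * 1)) {0..1}"
      using has_integral_const_real[of "?m powr p" 0 1] has_integral_const_real[of ?m 0 1]
      by (intro has_integral_add has_integral_mult_right has_integral_diff integrable_integral ia) auto
    then have "?m powr p + p * ?m powr (p - 1) * (integral {0..1} (\<lambda>t. \<bar>?d t\<bar>) - ?m) = integral {0..1} ?l"
      by (simp add: integral_unique)
    also have "\<dots> \<le> integral {0..1} ?k"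
    proof (rule integral_le[OF il ik])
      fix t :: real
      \<comment> \<open>\<open>?l\<close> is the tangent to the power at \<open>?m\<close>, evaluated at the speed along the segment.\<close>
      have "?l t \<le> \<bar>?d t\<bar> powr p"
        using powr_above_tangent(1)[of p "\<bar>?d t\<bar>" ?m] assms(2) False by simp
      also have "\<dots> \<le> (norm h * norm (g (x + t *\<^sub>R h))) powr p"
        using assms(2) by (intro powr_mono2 Cauchy_Schwarz_ineq2) auto
      also have "\<dots> = ?k t" by (simp add: powr_mult)
      finally show "?l t \<le> ?k t" .
    qed
    finally have "?m powr p + p * ?m powr (p - 1) * (integral {0..1} (\<lambda>t. \<bar>?d t\<bar>) - ?m) \<le> integral {0..1} ?k" .
    moreover have "0 \<le> p * ?m powr (p - 1) * (integral {0..1} (\<lambda>t. \<bar>?d t\<bar>) - ?m)"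
      using m assms(2) by (intro mult_nonneg_nonneg) auto
    ultimately show ?thesis by linarith
  qed
  then have "ennreal (?m powr p) \<le> ennreal (integral {0..1} ?k)" by (rule ennreal_leI)
  also have "ennreal (integral {0..1} ?k) = (\<integral>\<^sup>+t. ennreal (?k t) * indicator {0..1} t \<partial>lborel)"
    by (rule nn_integral_has_integral_lebesgue'[symmetric, OF _ integrable_integral[OF ik]]) simp
  finally show ?thesis .
qed


lemma nn_integral_translate:
  fixes f :: "'a::euclidean_space \<Rightarrow> ennreal"
  assumes "f \<in> borel_measurable borel"
  shows "(\<integral>\<^sup>+x. f (x + c) \<partial>lborel) = (\<integral>\<^sup>+x. f x \<partial>lborel)" "(\<integral>\<^sup>+x. f (c + x) \<partial>lborel) = (\<integral>\<^sup>+x. f x \<partial>lborel)"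
proof -
  have "(\<integral>\<^sup>+x. f x \<partial>lborel) = (\<integral>\<^sup>+x. f x \<partial>(distr lborel borel ((+) c)))"
    by (simp add: lborel_distr_plus)
  also have "\<dots> = (\<integral>\<^sup>+x. f (c + x) \<partial>lborel)"
    by (rule nn_integral_distr) (use assms in auto)
  finally show "(\<integral>\<^sup>+x. f (c + x) \<partial>lborel) = (\<integral>\<^sup>+x. f x \<partial>lborel)" by simp
  then show "(\<integral>\<^sup>+x. f (x + c) \<partial>lborel) = (\<integral>\<^sup>+x. f x \<partial>lborel)" by (simp add: add.commute)
qed

lemma powr_sum_bound:
  fixes a b p :: real
  assumes "a \<ge> 0" "b \<ge> 0" "p > 0"
  shows "(a + b) powr p \<le> 2 powr p * (a powr p + b powr p)"
proof -
  have "(a + b) powr p \<le> (2 * max a b) powr p" using assms by (intro powr_mono2) auto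
  also have "\<dots> = 2 powr p * max a b powr p" using assms by (simp add: powr_mult)
  also have "\<dots> \<le> 2 powr p * (a powr p + b powr p)" by (intro mult_left_mono) (auto simp: max_def)
  finally show ?thesis .
qed

text \<open>The first bound is useful for short translations, the second for long ones.\<close>

lemma translate_bounds:
  fixes f :: "'a::euclidean_space \<Rightarrow> real"
  assumes "C1_grad f g" "p > 1"
  shows "(\<integral>\<^sup>+x. ennreal (\<bar>f (x + h) - f x\<bar> powr p) \<partial>lborel)
      \<le> ennreal (norm h powr p) * (\<integral>\<^sup>+x. ennreal (norm (g x) powr p) \<partial>lborel)"
    "(\<integral>\<^sup>+x. ennreal (\<bar>f (x + h) - f x\<bar> powr p) \<partial>lborel)
      \<le> ennreal (2 powr p * 2) * (\<integral>\<^sup>+x. ennreal (\<bar>f x\<bar> powr p) \<partial>lborel)"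
proof -
  have [measurable]: "f \<in> borel_measurable borel" "g \<in> borel_measurable borel"
    using assms C1_grad_continuous[OF assms(1)] by (auto simp: C1_grad_def intro: borel_measurable_continuous_onI)
  have mg: "(\<lambda>x. ennreal (norm (g x) powr p)) \<in> borel_measurable borel"
    and mf: "(\<lambda>x. ennreal (\<bar>f x\<bar> powr p)) \<in> borel_measurable borel" by measurable
  have "(\<integral>\<^sup>+x. ennreal (\<bar>f (x + h) - f x\<bar> powr p) \<partial>lborel)
      \<le> (\<integral>\<^sup>+x. (\<integral>\<^sup>+t. ennreal (norm h powr p * norm (g (x + t *\<^sub>R h)) powr p) * indicator {0..1} t \<partial>lborel) \<partial>lborel)"
    by (intro nn_integral_mono segment_bound assms)
  also have "\<dots> = (\<integral>\<^sup>+t. (\<integral>\<^sup>+x. ennreal (norm h powr p * norm (g (x + t *\<^sub>R h)) powr p) * indicator {0..1} t \<partial>lborel) \<partial>lborel)"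
    by (rule lborel_pair.Fubini') measurable
  also have "\<dots> = (\<integral>\<^sup>+t. ennreal (norm h powr p) * (\<integral>\<^sup>+x. ennreal (norm (g x) powr p) \<partial>lborel) * indicator {0..1::real} t \<partial>lborel)"
  proof (rule nn_integral_cong)
    fix t :: real
    have "(\<integral>\<^sup>+x. ennreal (norm h powr p * norm (g (x + t *\<^sub>R h)) powr p) * indicator {0..1} t \<partial>lborel)
       = (\<integral>\<^sup>+x. ennreal (norm h powr p) * ennreal (norm (g (x + t *\<^sub>R h)) powr p) \<partial>lborel) * indicator {0..1} t"
      by (subst nn_integral_multc) (auto simp: ennreal_mult)
    also have "(\<integral>\<^sup>+x. ennreal (norm h powr p) * ennreal (norm (g (x + t *\<^sub>R h)) powr p) \<partial>lborel)
       = ennreal (norm h powr p) * (\<integral>\<^sup>+x. ennreal (norm (g (x + t *\<^sub>R h)) powr p) \<partial>lborel)"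
      by (rule nn_integral_cmult) simp
    also have "(\<integral>\<^sup>+x. ennreal (norm (g (x + t *\<^sub>R h)) powr p) \<partial>lborel) = (\<integral>\<^sup>+x. ennreal (norm (g x) powr p) \<partial>lborel)"
      by (rule nn_integral_translate(1)[OF mg])
    finally show "(\<integral>\<^sup>+x. ennreal (norm h powr p * norm (g (x + t *\<^sub>R h)) powr p) * indicator {0..1} t \<partial>lborel)
       = ennreal (norm h powr p) * (\<integral>\<^sup>+x. ennreal (norm (g x) powr p) \<partial>lborel) * indicator {0..1} t" .
  qed
  also have "\<dots> = ennreal (norm h powr p) * (\<integral>\<^sup>+x. ennreal (norm (g x) powr p) \<partial>lborel)"
    by (subst nn_integral_cmult_indicator) auto
  finally show "(\<integral>\<^sup>+x. ennreal (\<bar>f (x + h) - f x\<bar> powr p) \<partial>lborel)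
      \<le> ennreal (norm h powr p) * (\<integral>\<^sup>+x. ennreal (norm (g x) powr p) \<partial>lborel)" .
  have "(\<integral>\<^sup>+x. ennreal (\<bar>f (x + h) - f x\<bar> powr p) \<partial>lborel)
     \<le> (\<integral>\<^sup>+x. ennreal (2 powr p) * (ennreal (\<bar>f (x + h)\<bar> powr p) + ennreal (\<bar>f x\<bar> powr p)) \<partial>lborel)"
  proof (rule nn_integral_mono)
    fix x
    have "\<bar>f (x + h) - f x\<bar> powr p \<le> (\<bar>f (x + h)\<bar> + \<bar>f x\<bar>) powr p"
      using assms(2) by (intro powr_mono2) auto
    also have "\<dots> \<le> 2 powr p * (\<bar>f (x + h)\<bar> powr p + \<bar>f x\<bar> powr p)"
      using assms(2) by (intro powr_sum_bound) auto
    finally show "ennreal (\<bar>f (x + h) - f x\<bar> powr p) \<le> ennreal (2 powr p) * (ennreal (\<bar>f (x + h)\<bar> powr p) + ennreal (\<bar>f x\<bar> powr p))"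
      by (simp add: ennreal_leI flip: ennreal_mult ennreal_plus)
  qed
  also have "\<dots> = ennreal (2 powr p) * ((\<integral>\<^sup>+x. ennreal (\<bar>f (x + h)\<bar> powr p) \<partial>lborel) + (\<integral>\<^sup>+x. ennreal (\<bar>f x\<bar> powr p) \<partial>lborel))"
    by (subst nn_integral_cmult, measurable, subst nn_integral_add, measurable)
  also have "(\<integral>\<^sup>+x. ennreal (\<bar>f (x + h)\<bar> powr p) \<partial>lborel) = (\<integral>\<^sup>+x. ennreal (\<bar>f x\<bar> powr p) \<partial>lborel)"
    by (rule nn_integral_translate(1)[OF mf])
  also have "ennreal (2 powr p) * ((\<integral>\<^sup>+x. ennreal (\<bar>f x\<bar> powr p) \<partial>lborel) + (\<integral>\<^sup>+x. ennreal (\<bar>f x\<bar> powr p) \<partial>lborel))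
     = ennreal (2 powr p * 2) * (\<integral>\<^sup>+x. ennreal (\<bar>f x\<bar> powr p) \<partial>lborel)"
    by (simp add: ennreal_mult mult_2 mult.assoc)
  finally show "(\<integral>\<^sup>+x. ennreal (\<bar>f (x + h) - f x\<bar> powr p) \<partial>lborel)
      \<le> ennreal (2 powr p * 2) * (\<integral>\<^sup>+x. ennreal (\<bar>f x\<bar> powr p) \<partial>lborel)" .
qed

definition gagliardo :: "real \<Rightarrow> real \<Rightarrow> ('a::euclidean_space \<Rightarrow> real) \<Rightarrow> 'a \<times> 'a \<Rightarrow> real" where
  "gagliardo p s u z = \<bar>u (fst z) - u (snd z)\<bar> powr p / norm (fst z - snd z) powr (real DIM('a) + s * p)"

text \<open>Substitute \<open>y = x + h\<close> and split at \<open>\<bar>h\<bar> = 1\<close>. Near the origin a gradient bound turns the kernel into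
  a power of \<open>\<bar>h\<bar>\<close> with exponent \<open>p - s p - N\<close>, which is integrable because \<open>s < 1\<close>; the tail is integrable because
  \<open>s p > 0\<close>.\<close>

lemma gagliardo_smooth_bound:
  assumes "p > 1" "0 < s" "s < 1"
  obtains C1 C2 :: ennreal where "C1 < \<infinity>" "C2 < \<infinity>"
    "\<And>f g. C1_grad f g \<Longrightarrow> (\<integral>\<^sup>+z. ennreal (gagliardo p s f z) \<partial>(lborel :: ('a::euclidean_space \<times> 'a) measure))
       \<le> C1 * (\<integral>\<^sup>+x. ennreal (norm (g x) powr p) \<partial>lborel) + C2 * (\<integral>\<^sup>+x. ennreal (\<bar>f x\<bar> powr p) \<partial>lborel)"
proof -
  define \<beta> where "\<beta> = real DIM('a) + s * p"
  let ?k1 = "\<lambda>h::'a. ennreal (norm h powr ((p - s * p) - real DIM('a))) * indicator (cball 0 1) h"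
  let ?k2 = "\<lambda>h::'a. ennreal (norm h powr (- (s * p) - real DIM('a))) * indicator (- cball 0 1) h"
  have "s * p < 1 * p" using assms by (intro mult_strict_right_mono) auto
  then have pos: "0 < p - s * p" "0 < s * p" using assms by auto
  have fin: "(\<integral>\<^sup>+h. ?k1 h \<partial>lborel) < \<infinity>" "(\<integral>\<^sup>+h. ?k2 h \<partial>lborel) < \<infinity>"
    using nn_integral_radial_inside[OF pos(1)] nn_integral_radial_outside[OF pos(2)] by auto
  have mk: "?k1 \<in> borel_measurable borel" "?k2 \<in> borel_measurable borel"
    by (intro borel_measurable_times_ennreal borel_measurable_indicator measurable_compose[OF _ measurable_ennreal]; measurable)+
  have bound: "(\<integral>\<^sup>+z. ennreal (gagliardo p s f z) \<partial>(lborel :: ('a \<times> 'a) measure))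
       \<le> (\<integral>\<^sup>+h. ?k1 h \<partial>lborel) * (\<integral>\<^sup>+x. ennreal (norm (g x) powr p) \<partial>lborel)
        + ((\<integral>\<^sup>+h. ?k2 h \<partial>lborel) * ennreal (2 powr p * 2)) * (\<integral>\<^sup>+x. ennreal (\<bar>f x\<bar> powr p) \<partial>lborel)"
    if fg: "C1_grad f g" for f g
  proof -
    let ?\<Gamma> = "\<integral>\<^sup>+x. ennreal (norm (g x) powr p) \<partial>lborel" and ?P = "\<integral>\<^sup>+x. ennreal (\<bar>f x\<bar> powr p) \<partial>lborel"
    have [measurable]: "f \<in> borel_measurable borel"
      using C1_grad_continuous[OF fg] by (auto intro: borel_measurable_continuous_onI)
    have mG: "(\<lambda>z. ennreal (gagliardo p s f z)) \<in> borel_measurable (borel \<Otimes>\<^sub>M borel)"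
      unfolding gagliardo_def by measurable
    have mG': "(\<lambda>z. ennreal (gagliardo p s f z)) \<in> borel_measurable (lborel \<Otimes>\<^sub>M lborel)"
      using mG by (simp add: borel_prod lborel_prod)
    have "(\<integral>\<^sup>+z. ennreal (gagliardo p s f z) \<partial>(lborel :: ('a \<times> 'a) measure))
       = (\<integral>\<^sup>+x. (\<integral>\<^sup>+y. ennreal (gagliardo p s f (x, y)) \<partial>lborel) \<partial>lborel)"
      unfolding lborel_prod[symmetric] by (rule lborel.nn_integral_fst[symmetric, OF mG'])
    also have "\<dots> = (\<integral>\<^sup>+x. (\<integral>\<^sup>+h. ennreal (gagliardo p s f (x, x + h)) \<partial>lborel) \<partial>lborel)"
    proof (rule nn_integral_cong)
      fix x
      have "(\<lambda>y. ennreal (gagliardo p s f (x, y))) \<in> borel_measurable borel"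
        unfolding gagliardo_def by measurable
      from nn_integral_translate(2)[OF this, of x]
      show "(\<integral>\<^sup>+y. ennreal (gagliardo p s f (x, y)) \<partial>lborel) = (\<integral>\<^sup>+h. ennreal (gagliardo p s f (x, x + h)) \<partial>lborel)" by simp
    qed
    also have "\<dots> = (\<integral>\<^sup>+h. (\<integral>\<^sup>+x. ennreal (gagliardo p s f (x, x + h)) \<partial>lborel) \<partial>lborel)"
      by (rule lborel_pair.Fubini'[symmetric]) (unfold gagliardo_def, measurable)
    also have "\<dots> \<le> (\<integral>\<^sup>+h. ?k1 h * ?\<Gamma> + ?k2 h * (ennreal (2 powr p * 2) * ?P) \<partial>lborel)"
    proof (rule nn_integral_mono)
      fix h :: 'a
      have e: "gagliardo p s f (x, x + h) = (1 / norm h powr \<beta>) * \<bar>f (x + h) - f x\<bar> powr p" for x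
        by (simp add: gagliardo_def \<beta>_def abs_minus_commute)
      have "(\<integral>\<^sup>+x. ennreal (gagliardo p s f (x, x + h)) \<partial>lborel)
         = ennreal (1 / norm h powr \<beta>) * (\<integral>\<^sup>+x. ennreal (\<bar>f (x + h) - f x\<bar> powr p) \<partial>lborel)"
      proof -
        have "ennreal (gagliardo p s f (x, x + h)) = ennreal (1 / norm h powr \<beta>) * ennreal (\<bar>f (x + h) - f x\<bar> powr p)" for x
          unfolding e by (rule ennreal_mult) auto
        then show ?thesis by (simp only:) (rule nn_integral_cmult, measurable)
      qed
      also have "\<dots> \<le> ?k1 h * ?\<Gamma> + ?k2 h * (ennreal (2 powr p * 2) * ?P)"
      proof (cases "h \<in> cball 0 1")
        case True
        have "ennreal (1 / norm h powr \<beta>) * (\<integral>\<^sup>+x. ennreal (\<bar>f (x + h) - f x\<bar> powr p) \<partial>lborel)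
          \<le> ennreal (1 / norm h powr \<beta>) * (ennreal (norm h powr p) * ?\<Gamma>)"
          by (intro mult_left_mono translate_bounds(1)[OF fg assms(1)]) simp
        also have "\<dots> = ennreal (1 / norm h powr \<beta> * norm h powr p) * ?\<Gamma>"
          by (subst ennreal_mult) (auto simp: mult.assoc)
        also have "1 / norm h powr \<beta> * norm h powr p = norm h powr ((p - s * p) - real DIM('a))"
          by (simp add: \<beta>_def algebra_simps flip: powr_diff)
        finally show ?thesis using True by (simp add: indicator_def)
      next
        case False
        have "ennreal (1 / norm h powr \<beta>) * (\<integral>\<^sup>+x. ennreal (\<bar>f (x + h) - f x\<bar> powr p) \<partial>lborel)
          \<le> ennreal (1 / norm h powr \<beta>) * (ennreal (2 powr p * 2) * ?P)"
          by (intro mult_left_mono translate_bounds(2)[OF fg assms(1)]) simp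
        moreover have "1 / norm h powr \<beta> = norm h powr (- (s * p) - real DIM('a))"
          using powr_minus_divide[of "norm h" \<beta>] by (simp add: \<beta>_def algebra_simps)
        ultimately show ?thesis using False by (simp add: indicator_def)
      qed
      finally show "(\<integral>\<^sup>+x. ennreal (gagliardo p s f (x, x + h)) \<partial>lborel)
         \<le> ?k1 h * ?\<Gamma> + ?k2 h * (ennreal (2 powr p * 2) * ?P)" .
    qed
    also have "\<dots> = (\<integral>\<^sup>+h. ?k1 h \<partial>lborel) * ?\<Gamma> + (\<integral>\<^sup>+h. ?k2 h \<partial>lborel) * (ennreal (2 powr p * 2) * ?P)"
      using mk by (subst nn_integral_add) (auto simp: nn_integral_multc)
    finally show ?thesis by (simp add: mult.assoc)
  qed
  show ?thesis
    by (rule that[OF fin(1) _ bound]) (use fin(2) in \<open>auto simp: ennreal_mult_less_top\<close>)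
qed

text \<open>The bound for smooth functions passes to the limit by Fatou's lemma.\<close>

lemma gagliardo_integrable:
  fixes u :: "'a::euclidean_space \<Rightarrow> real"
  assumes "p > 1" "0 < s" "s < 1"
    and \<phi>: "\<And>k. C1_grad (\<phi> k) (\<gamma> k)"
    and A: "A < \<infinity>" "\<And>k. (\<integral>\<^sup>+x. ennreal (norm (\<gamma> k x) powr p) \<partial>lborel) \<le> A"
      "\<And>k. (\<integral>\<^sup>+x. ennreal (\<bar>\<phi> k x\<bar> powr p) \<partial>lborel) \<le> A"
    and u: "u \<in> borel_measurable lebesgue"
    and lim: "AE x in lebesgue. (\<lambda>k. \<phi> k x) \<longlonglongrightarrow> u x"
  shows "integrable lebesgue (gagliardo p s u)"
proof (rule integrableI_nonneg)
  have meas: "gagliardo p s w \<in> borel_measurable lebesgue" if "w \<in> borel_measurable lebesgue" for w :: "'a \<Rightarrow> real"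
  proof -
    have m: "(\<lambda>z::'a \<times> 'a. norm (fst z - snd z) powr (real DIM('a) + s * p)) \<in> borel_measurable lebesgue"
    proof -
      have "(\<lambda>z::'a \<times> 'a. norm (fst z - snd z)) \<in> borel_measurable lebesgue"
        by (intro continuous_lebesgue_measurable continuous_intros)
      then show ?thesis by measurable
    qed
    show ?thesis
      unfolding gagliardo_def[abs_def] using lebesgue_measurable_prod[OF that] m by measurable
  qed
  show "gagliardo p s u \<in> borel_measurable lebesgue" by (rule meas[OF u])
  show "AE z in lebesgue. 0 \<le> gagliardo p s u z" by (simp add: gagliardo_def)
  obtain C1 C2 :: ennreal where C: "C1 < \<infinity>" "C2 < \<infinity>"
    "\<And>f g. C1_grad f g \<Longrightarrow> (\<integral>\<^sup>+z. ennreal (gagliardo p s f z) \<partial>(lborel :: ('a \<times> 'a) measure))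
       \<le> C1 * (\<integral>\<^sup>+x. ennreal (norm (g x) powr p) \<partial>lborel) + C2 * (\<integral>\<^sup>+x. ennreal (\<bar>f x\<bar> powr p) \<partial>lborel)"
    using gagliardo_smooth_bound[OF assms(1-3)] by blast
  have b: "(\<integral>\<^sup>+z. ennreal (gagliardo p s (\<phi> k) z) \<partial>lebesgue) \<le> C1 * A + C2 * A" for k
    unfolding nn_integral_completion
    by (rule order_trans[OF C(3)[OF \<phi>]]) (intro add_mono mult_left_mono A; simp)
  have mk: "(\<lambda>z. ennreal (gagliardo p s (\<phi> k) z)) \<in> borel_measurable lebesgue" for k
    using meas[OF continuous_lebesgue_measurable[OF C1_grad_continuous[OF \<phi>]]] by measurable
  have "AE z in lebesgue. ennreal (gagliardo p s u z) = liminf (\<lambda>k. ennreal (gagliardo p s (\<phi> k) z))"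
    using AE_lebesgue_prod[OF lim]
  proof eventually_elim
    case (elim z)
    have "(\<lambda>k. gagliardo p s (\<phi> k) z) \<longlonglongrightarrow> gagliardo p s u z"
      unfolding gagliardo_def divide_inverse using elim assms(1)
      by (intro tendsto_mult tendsto_const tendsto_powr' tendsto_rabs tendsto_diff) auto
    then have "(\<lambda>k. ennreal (gagliardo p s (\<phi> k) z)) \<longlonglongrightarrow> ennreal (gagliardo p s u z)"
      by (rule tendsto_ennrealI)
    then show ?case by (rule lim_imp_Liminf[symmetric, rotated]) simp
  qed
  then have "(\<integral>\<^sup>+z. ennreal (gagliardo p s u z) \<partial>lebesgue)
     = (\<integral>\<^sup>+z. liminf (\<lambda>k. ennreal (gagliardo p s (\<phi> k) z)) \<partial>lebesgue)"
    by (rule nn_integral_cong_AE)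
  also have "\<dots> \<le> liminf (\<lambda>k. \<integral>\<^sup>+z. ennreal (gagliardo p s (\<phi> k) z) \<partial>lebesgue)"
    by (rule nn_integral_liminf[OF mk])
  also have "\<dots> \<le> C1 * A + C2 * A"
    by (rule Liminf_le) (use b in simp_all)
  also have "\<dots> < \<infinity>" using A(1) C(1,2) by (simp add: ennreal_mult_less_top)
  finally show "(\<integral>\<^sup>+z. ennreal (gagliardo p s u z) \<partial>lebesgue) < \<infinity>" .
qed

section \<open>Sobolev functions vanishing on the boundary\<close>

text \<open>Instead of Hoelder's inequality: \<open>f \<le> d + d\<^bsup>1-p\<^esup> f\<^sup>p\<close> for every \<open>d > 0\<close>, and the integral of the constant \<open>d\<close>
  over a set of finite measure is small with \<open>d\<close>.\<close>

lemma Lp_tendsto_imp_L1_tendsto: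
  fixes f :: "nat \<Rightarrow> 'a::euclidean_space \<Rightarrow> real"
  assumes p: "p > 1" and S: "S \<in> lmeasurable"
    and f: "\<And>k x. 0 \<le> f k x" "\<And>k x. x \<notin> S \<Longrightarrow> f k x = 0" "\<And>k. f k \<in> borel_measurable lebesgue"
    and i: "\<And>k. integrable lebesgue (\<lambda>x. f k x powr p)"
    and lim: "(\<lambda>k. \<integral>x. f k x powr p \<partial>lebesgue) \<longlonglongrightarrow> 0"
  shows "integrable lebesgue (f k)" "(\<lambda>k. \<integral>x. f k x \<partial>lebesgue) \<longlonglongrightarrow> 0"
proof -
  let ?m = "measure lebesgue S"
  have iS: "integrable lebesgue (indicator S :: 'a \<Rightarrow> real)" using S
    by (intro integrable_real_indicator) (auto simp: fmeasurable_def)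
  have bd: "f k x \<le> d * indicator S x + d powr (1 - p) * f k x powr p" if d: "d > 0" for d k x
  proof (cases "x \<in> S")
    case True
    show ?thesis
    proof (cases "f k x \<le> d")
      case True
      then show ?thesis using \<open>x \<in> S\<close> by (simp add: add_increasing2)
    next
      case False
      then have pos: "f k x > 0" using d by simp
      have "f k x = f k x powr (1 - p) * f k x powr p" using pos by (simp flip: powr_add)
      also have "\<dots> \<le> d powr (1 - p) * f k x powr p"
        using False d p by (intro mult_right_mono powr_mono2') auto
      finally show ?thesis using d \<open>x \<in> S\<close> by simp
    qed
  qed (use f(2) in simp)
  have ik: "integrable lebesgue (f k)" for k
  proof (rule Bochner_Integration.integrable_bound)
    show "integrable lebesgue (\<lambda>x. 1 * indicator S x + 1 powr (1 - p) * f k x powr p)"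
      using iS i by simp
    show "AE x in lebesgue. norm (f k x) \<le> norm (1 * indicator S x + 1 powr (1 - p) * f k x powr p)"
      using bd[of 1 k] f(1)[of k] by (auto intro!: AE_I2 order_trans[OF _ abs_ge_self])
  qed (rule f(3))
  then show "integrable lebesgue (f k)" .
  have est: "(\<integral>x. f k x \<partial>lebesgue) \<le> d * ?m + d powr (1 - p) * (\<integral>x. f k x powr p \<partial>lebesgue)" if "d > 0" for d k
  proof -
    have "(\<integral>x. f k x \<partial>lebesgue) \<le> (\<integral>x. d * indicator S x + d powr (1 - p) * f k x powr p \<partial>lebesgue)"
      using iS i ik bd[OF that] by (intro integral_mono) auto
    also have "\<dots> = d * ?m + d powr (1 - p) * (\<integral>x. f k x powr p \<partial>lebesgue)"
      using iS i by simp
    finally show ?thesis .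
  qed
  show "(\<lambda>k. \<integral>x. f k x \<partial>lebesgue) \<longlonglongrightarrow> 0"
  proof (rule LIMSEQ_I)
    fix e :: real assume e: "e > 0"
    define d where "d = e / (2 * (?m + 1))"
    have m0: "?m \<ge> 0" by simp
    then have d: "d > 0" using e by (simp add: d_def add_nonneg_pos)
    have dm: "d * ?m \<le> e / 2"
    proof -
      have "d * ?m \<le> d * (?m + 1)" using d by simp
      also have "\<dots> = e / 2" using m0 by (simp add: d_def field_simps add_nonneg_eq_0_iff)
      finally show ?thesis .
    qed
    have "(\<lambda>k. d powr (1 - p) * (\<integral>x. f k x powr p \<partial>lebesgue)) \<longlonglongrightarrow> d powr (1 - p) * 0"
      by (intro tendsto_intros lim)
    then have "\<forall>\<^sub>F k in sequentially. d powr (1 - p) * (\<integral>x. f k x powr p \<partial>lebesgue) < e / 2"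
      using e by (intro order_tendstoD(2)) auto
    then obtain N where N: "\<And>k. k \<ge> N \<Longrightarrow> d powr (1 - p) * (\<integral>x. f k x powr p \<partial>lebesgue) < e / 2"
      by (auto simp: eventually_sequentially)
    show "\<exists>N. \<forall>k\<ge>N. norm ((\<integral>x. f k x \<partial>lebesgue) - 0) < e"
    proof (intro exI allI impI)
      fix k assume "k \<ge> N"
      have "0 \<le> (\<integral>x. f k x \<partial>lebesgue)" using f(1) by (intro integral_nonneg_AE) auto
      then show "norm ((\<integral>x. f k x \<partial>lebesgue) - 0) < e"
        using est[OF d, of k] dm N[OF \<open>k \<ge> N\<close>] by simp
    qed
  qed
qed

lemma test_function_off_set:
  assumes "\<phi> \<in> test_functions S" "x \<notin> S"
  shows "\<phi> x = 0" "gradient \<phi> x = 0"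
proof -
  have c: "closure {x. \<phi> x \<noteq> 0} \<subseteq> S" using assms by (simp add: test_functions_def)
  then show "\<phi> x = 0" using assms(2) closure_subset[of "{x. \<phi> x \<noteq> 0}"] by blast
  have "\<And>x. GDERIV \<phi> x :> gradient \<phi> x"
    using test_function_C1c[OF assms(1)] by (simp add: C1c_grad_def C1_grad_def)
  then show "gradient \<phi> x = 0" by (rule gradient_zero_off_support) (use c assms(2) in blast)
qed

lemma powr_C1c_integrable:
  fixes f :: "'a::euclidean_space \<Rightarrow> 'b::euclidean_space"
  assumes "continuous_on UNIV f" "\<And>x. x \<notin> cball 0 R \<Longrightarrow> f x = 0" "p > 0"
  shows "integrable lebesgue (\<lambda>x. norm (f x) powr p)"
proof -
  have "integrable lborel (\<lambda>x. norm (f x) powr p)"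
    by (rule continuous_compact_support_integrable(1)[of _ R])
      (use assms in \<open>auto intro!: continuous_on_powr' continuous_on_norm continuous_on_const\<close>)
  then show ?thesis by (subst integrable_completion) auto
qed

lemma powr_norm_diff_integrable:
  fixes f g :: "'a::euclidean_space \<Rightarrow> 'b::euclidean_space"
  assumes "f \<in> borel_measurable lebesgue" "g \<in> borel_measurable lebesgue" "p > 0"
    and "integrable lebesgue (\<lambda>x. norm (f x) powr p)" "integrable lebesgue (\<lambda>x. norm (g x) powr p)"
  shows "integrable lebesgue (\<lambda>x. norm (f x - g x) powr p)"
proof (rule Bochner_Integration.integrable_bound)
  show "integrable lebesgue (\<lambda>x. 2 powr p * (norm (f x) powr p + norm (g x) powr p))"
    using assms by simp
  show "(\<lambda>x. norm (f x - g x) powr p) \<in> borel_measurable lebesgue"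
    using assms(1,2) by measurable
  have "norm (f x - g x) powr p \<le> 2 powr p * (norm (f x) powr p + norm (g x) powr p)" for x
  proof -
    have "norm (f x - g x) powr p \<le> (norm (f x) + norm (g x)) powr p"
      using assms(3) by (intro powr_mono2 norm_triangle_ineq4) auto
    also have "\<dots> \<le> 2 powr p * (norm (f x) powr p + norm (g x) powr p)"
      using assms(3) by (intro powr_sum_bound) auto
    finally show ?thesis .
  qed
  then show "AE x in lebesgue. norm (norm (f x - g x) powr p) \<le> norm (2 powr p * (norm (f x) powr p + norm (g x) powr p))"
    by (auto intro!: AE_I2 order_trans[OF _ abs_ge_self])
qed

text \<open>The definition measures convergence with an arbitrarily chosen weak gradient. Uniqueness identifies
  it with one in \<open>L\<^sup>p\<close>; so all functions are integrable, and the integrals that tend to zero are not just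
  the value \<open>0\<close> assigned to a divergent integral.\<close>

lemma W1p_0_approximation:
  fixes u :: "'a::euclidean_space \<Rightarrow> real"
  assumes \<Omega>: "open \<Omega>" and p: "p > 1" and u: "u \<in> W1p_0 p \<Omega>"
  obtains g \<phi> where
    "\<And>k. \<phi> k \<in> test_functions \<Omega>"
    "u \<in> borel_measurable lebesgue" "g \<in> borel_measurable lebesgue"
    "\<And>x. x \<notin> \<Omega> \<Longrightarrow> u x = 0" "\<And>x. x \<notin> \<Omega> \<Longrightarrow> g x = 0"
    "integrable lebesgue (\<lambda>x. norm (u x) powr p)" "integrable lebesgue (\<lambda>x. norm (g x) powr p)"
    "\<And>k. integrable lebesgue (\<lambda>x. norm (u x - \<phi> k x) powr p)"
    "\<And>k. integrable lebesgue (\<lambda>x. norm (g x - gradient (\<phi> k) x) powr p)"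
    "(\<lambda>k. \<integral>x. norm (u x - \<phi> k x) powr p \<partial>lebesgue) \<longlonglongrightarrow> 0"
    "(\<lambda>k. \<integral>x. norm (g x - gradient (\<phi> k) x) powr p \<partial>lebesgue) \<longlonglongrightarrow> 0"
proof -
  have W: "Lp_on p \<Omega> u" and off: "\<And>x. x \<notin> \<Omega> \<Longrightarrow> u x = 0"
    using u by (auto simp: W1p_0_def W1p_def)
  obtain g0 where g0: "has_weak_gradient_on u g0 \<Omega>" "Lp_on p \<Omega> g0"
    using u by (auto simp: W1p_0_def W1p_def)
  obtain \<phi> where \<phi>: "\<And>k. \<phi> k \<in> test_functions \<Omega>"
    and lim: "(\<lambda>k::nat. (LINT x:\<Omega>|lebesgue. \<bar>u x - \<phi> k x\<bar> powr p) +
                  (LINT x:\<Omega>|lebesgue. norm (weak_grad_on \<Omega> u x - gradient (\<phi> k) x) powr p)) \<longlonglongrightarrow> 0"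
    using u by (auto simp: W1p_0_def)
  have O: "\<Omega> \<in> sets lebesgue" using \<Omega> by simp
  define g where "g x = (if x \<in> \<Omega> then g0 x else 0)" for x
  have gm: "g \<in> borel_measurable lebesgue"
    unfolding g_def[abs_def] using g0(2) O by (intro borel_measurable_if_I) (auto simp: Lp_on_def)
  have "u = (\<lambda>x. if x \<in> \<Omega> then u x else 0)" using off by auto
  moreover have "(\<lambda>x. if x \<in> \<Omega> then u x else 0) \<in> borel_measurable lebesgue"
    using W O by (intro borel_measurable_if_I) (auto simp: Lp_on_def)
  ultimately have um: "u \<in> borel_measurable lebesgue" by simp
  have "indicator \<Omega> x *\<^sub>R norm (u x) powr p = norm (u x) powr p" for x
    using off[of x] by (auto simp: indicator_def)
  then have up: "integrable lebesgue (\<lambda>x. norm (u x) powr p)"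
    using W unfolding Lp_on_def set_integrable_def by (simp only:)
  have "indicator \<Omega> x *\<^sub>R norm (g0 x) powr p = norm (g x) powr p" for x
    by (auto simp: indicator_def g_def)
  then have gp: "integrable lebesgue (\<lambda>x. norm (g x) powr p)"
    using g0(2) unfolding Lp_on_def set_integrable_def by (simp only:)
  have c: "continuous_on UNIV (\<phi> k)" "continuous_on UNIV (gradient (\<phi> k))" for k
    using test_function_C1c[OF \<phi>[of k]] C1_grad_continuous by (auto simp: C1c_grad_def C1_grad_def)
  have fp: "integrable lebesgue (\<lambda>x. norm (\<phi> k x) powr p)" "integrable lebesgue (\<lambda>x. norm (gradient (\<phi> k) x) powr p)" for k
  proof -
    obtain R where "\<And>x. x \<notin> cball 0 R \<Longrightarrow> \<phi> k x = 0" "\<And>x. x \<notin> cball 0 R \<Longrightarrow> gradient (\<phi> k) x = 0"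
      using C1c_grad_support[OF test_function_C1c[OF \<phi>[of k]]] by metis
    then show "integrable lebesgue (\<lambda>x. norm (\<phi> k x) powr p)" "integrable lebesgue (\<lambda>x. norm (gradient (\<phi> k) x) powr p)"
      using powr_C1c_integrable[OF c(1), of R k p] powr_C1c_integrable[OF c(2), of R k p] p by auto
  qed
  have i: "integrable lebesgue (\<lambda>x. norm (u x - \<phi> k x) powr p)"
    "integrable lebesgue (\<lambda>x. norm (g x - gradient (\<phi> k) x) powr p)" for k
    by (intro powr_norm_diff_integrable um gm up gp fp continuous_lebesgue_measurable c; use p in simp)+
  have eq1: "(LINT x:\<Omega>|lebesgue. \<bar>u x - \<phi> k x\<bar> powr p) = (\<integral>x. norm (u x - \<phi> k x) powr p \<partial>lebesgue)" for k
    unfolding set_lebesgue_integral_def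
    by (intro Bochner_Integration.integral_cong) (use off test_function_off_set[OF \<phi>[of k]] in \<open>auto simp: indicator_def\<close>)
  have eq2: "(LINT x:\<Omega>|lebesgue. norm (weak_grad_on \<Omega> u x - gradient (\<phi> k) x) powr p)
      = (\<integral>x. norm (g x - gradient (\<phi> k) x) powr p \<partial>lebesgue)" for k
    unfolding set_lebesgue_integral_def
  proof (rule integral_cong_AE)
    have ae: "AE x in lebesgue. norm (g x - gradient (\<phi> k) x) powr p
        = indicator \<Omega> x *\<^sub>R norm (weak_grad_on \<Omega> u x - gradient (\<phi> k) x) powr p"
      using weak_grad_on_AE_eq[OF \<Omega> g0(1)]
      by eventually_elim (use test_function_off_set[OF \<phi>[of k]] in \<open>auto simp: indicator_def g_def\<close>)
    show m: "(\<lambda>x. norm (g x - gradient (\<phi> k) x) powr p) \<in> borel_measurable lebesgue"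
      using i by auto
    show "(\<lambda>x. indicator \<Omega> x *\<^sub>R norm (weak_grad_on \<Omega> u x - gradient (\<phi> k) x) powr p) \<in> borel_measurable lebesgue"
      by (rule borel_measurable_AE[OF m ae])
    show "AE x in lebesgue. indicator \<Omega> x *\<^sub>R norm (weak_grad_on \<Omega> u x - gradient (\<phi> k) x) powr p
        = norm (g x - gradient (\<phi> k) x) powr p"
      using ae by eventually_elim simp
  qed
  have nn: "0 \<le> (\<integral>x. norm (u x - \<phi> k x) powr p \<partial>lebesgue)" "0 \<le> (\<integral>x. norm (g x - gradient (\<phi> k) x) powr p \<partial>lebesgue)" for k
    by (auto intro!: integral_nonneg_AE)
  have l1: "(\<lambda>k. \<integral>x. norm (u x - \<phi> k x) powr p \<partial>lebesgue) \<longlonglongrightarrow> 0"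
    by (rule Lim_null_comparison[OF always_eventually lim]) (use nn eq1 eq2 in auto)
  have l2: "(\<lambda>k. \<integral>x. norm (g x - gradient (\<phi> k) x) powr p \<partial>lebesgue) \<longlonglongrightarrow> 0"
    by (rule Lim_null_comparison[OF always_eventually lim]) (use nn eq1 eq2 in auto)
  show ?thesis
    by (rule that[OF \<phi> um gm off _ up gp i l1 l2]) (auto simp: g_def)
qed

lemma nn_integral_powr_bound:
  fixes f g :: "'a::euclidean_space \<Rightarrow> 'b::euclidean_space"
  assumes p: "p > 0" and c: "continuous_on UNIV g"
    and i: "integrable lebesgue (\<lambda>x. norm (f x) powr p)" "integrable lebesgue (\<lambda>x. norm (f x - g x) powr p)"
    and B: "(\<integral>x. norm (f x - g x) powr p \<partial>lebesgue) \<le> B"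
  shows "(\<integral>\<^sup>+x. ennreal (norm (g x) powr p) \<partial>lborel) \<le> ennreal (2 powr p * ((\<integral>x. norm (f x) powr p \<partial>lebesgue) + B))"
proof -
  have "norm (g x) powr p \<le> 2 powr p * (norm (f x) powr p + norm (f x - g x) powr p)" for x
  proof -
    have "norm (g x) powr p \<le> (norm (f x) + norm (f x - g x)) powr p"
      using p norm_triangle_ineq4[of "f x" "f x - g x"] by (intro powr_mono2) auto
    also have "\<dots> \<le> 2 powr p * (norm (f x) powr p + norm (f x - g x) powr p)"
      using p by (intro powr_sum_bound) auto
    finally show ?thesis .
  qed
  then have "(\<integral>\<^sup>+x. ennreal (norm (g x) powr p) \<partial>lebesgue)
      \<le> (\<integral>\<^sup>+x. ennreal (2 powr p * (norm (f x) powr p + norm (f x - g x) powr p)) \<partial>lebesgue)"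
    by (intro nn_integral_mono ennreal_leI)
  also have "\<dots> = ennreal (\<integral>x. 2 powr p * (norm (f x) powr p + norm (f x - g x) powr p) \<partial>lebesgue)"
    using i by (intro nn_integral_eq_integral) auto
  also have "\<dots> = ennreal (2 powr p * ((\<integral>x. norm (f x) powr p \<partial>lebesgue) + (\<integral>x. norm (f x - g x) powr p \<partial>lebesgue)))"
    using i by simp
  also have "\<dots> \<le> ennreal (2 powr p * ((\<integral>x. norm (f x) powr p \<partial>lebesgue) + B))"
    using B by (intro ennreal_leI mult_left_mono) auto
  finally show ?thesis by (simp add: nn_integral_completion)
qed

lemma W1p_0_properties:
  fixes u :: "'a::euclidean_space \<Rightarrow> real"
  assumes \<Omega>: "open \<Omega>" "bounded \<Omega>" and p: "p > 1" and s: "0 < s" "s < 1" and u: "u \<in> W1p_0 p \<Omega>"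
  obtains g \<phi> where
    "W11_grad u g" "\<And>x. x \<notin> \<Omega> \<Longrightarrow> u x = 0" "\<And>x. x \<notin> \<Omega> \<Longrightarrow> g x = 0"
    "integrable lebesgue (gagliardo p s u)"
    "\<And>k. \<phi> k \<in> test_functions \<Omega>"
    "(\<lambda>k. \<integral>x. norm (\<phi> k x - u x) \<partial>lebesgue) \<longlonglongrightarrow> 0"
    "(\<lambda>k. \<integral>x. norm (gradient (\<phi> k) x - g x) \<partial>lebesgue) \<longlonglongrightarrow> 0"
proof -
  obtain g \<phi> where \<phi>: "\<And>k. \<phi> k \<in> test_functions \<Omega>"
    and um: "u \<in> borel_measurable lebesgue" and gm: "g \<in> borel_measurable lebesgue"
    and off: "\<And>x. x \<notin> \<Omega> \<Longrightarrow> u x = 0" "\<And>x. x \<notin> \<Omega> \<Longrightarrow> g x = 0"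
    and ip: "integrable lebesgue (\<lambda>x. norm (u x) powr p)" "integrable lebesgue (\<lambda>x. norm (g x) powr p)"
    "\<And>k. integrable lebesgue (\<lambda>x. norm (u x - \<phi> k x) powr p)"
    "\<And>k. integrable lebesgue (\<lambda>x. norm (g x - gradient (\<phi> k) x) powr p)"
    and l: "(\<lambda>k. \<integral>x. norm (u x - \<phi> k x) powr p \<partial>lebesgue) \<longlonglongrightarrow> 0"
    "(\<lambda>k. \<integral>x. norm (g x - gradient (\<phi> k) x) powr p \<partial>lebesgue) \<longlonglongrightarrow> 0"
    by (rule W1p_0_approximation[OF \<Omega>(1) p u]) (rule that)
  have O: "\<Omega> \<in> lmeasurable" using \<Omega> by (simp add: bounded_set_imp_lmeasurable)
  have C: "C1c_grad (\<phi> k) (gradient (\<phi> k))" for k by (rule test_function_C1c[OF \<phi>])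
  have c: "continuous_on UNIV (\<phi> k)" "continuous_on UNIV (gradient (\<phi> k))" for k
    using C[of k] C1_grad_continuous by (auto simp: C1c_grad_def C1_grad_def)
  note cm = continuous_lebesgue_measurable[OF c(1)] continuous_lebesgue_measurable[OF c(2)]
  have A: "integrable lebesgue (\<lambda>x. norm (u x - \<phi> k x))" "(\<lambda>k. \<integral>x. norm (u x - \<phi> k x) \<partial>lebesgue) \<longlonglongrightarrow> 0" for k
    by (rule Lp_tendsto_imp_L1_tendsto[OF p O _ _ _ ip(3) l(1)];
        use um cm off test_function_off_set[OF \<phi>] in simp)+
  have B: "integrable lebesgue (\<lambda>x. norm (g x - gradient (\<phi> k) x))"
    "(\<lambda>k. \<integral>x. norm (g x - gradient (\<phi> k) x) \<partial>lebesgue) \<longlonglongrightarrow> 0" for k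
    by (rule Lp_tendsto_imp_L1_tendsto[OF p O _ _ _ ip(4) l(2)];
        use gm cm off test_function_off_set[OF \<phi>] in simp)+
  have iu: "integrable lebesgue (\<lambda>x. u x - \<phi> k x)" for k
    by (rule integrable_norm_cancel[OF A(1)]) (use um cm in simp)
  have ig: "integrable lebesgue (\<lambda>x. g x - gradient (\<phi> k) x)" for k
    by (rule integrable_norm_cancel[OF B(1)]) (use gm cm in simp)
  have "integrable lebesgue u" "integrable lebesgue g"
    using Bochner_Integration.integrable_add[OF iu[of 0] C1c_grad_integrable_lebesgue(1)[OF C[of 0]]]
      Bochner_Integration.integrable_add[OF ig[of 0] C1c_grad_integrable_lebesgue(2)[OF C[of 0]]] by simp_all
  moreover have L: "(\<lambda>k. \<integral>x. norm (\<phi> k x - u x) \<partial>lebesgue) \<longlonglongrightarrow> 0"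
    "(\<lambda>k. \<integral>x. norm (gradient (\<phi> k) x - g x) \<partial>lebesgue) \<longlonglongrightarrow> 0"
    using A(2) B(2) by (simp_all only: norm_minus_commute[of "u _"] norm_minus_commute[of "g _"])
  ultimately have W: "W11_grad u g"
    unfolding W11_grad_def using C by (intro conjI exI[of _ \<phi>] exI[of _ "\<lambda>k. gradient (\<phi> k)"]) auto
  obtain \<rho> where \<rho>: "strict_mono \<rho>" "AE x in lebesgue. (\<lambda>n. u x - \<phi> (\<rho> n) x) \<longlonglongrightarrow> 0"
    using tendsto_L1_AE_subseq[of lebesgue "\<lambda>k x. u x - \<phi> k x", OF iu A(2)] by auto
  have ae: "AE x in lebesgue. (\<lambda>k. (\<phi> \<circ> \<rho>) k x) \<longlonglongrightarrow> u x"
    using \<rho>(2)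
  proof eventually_elim
    case (elim x)
    show ?case using tendsto_diff[OF tendsto_const elim, of "u x"] by simp
  qed
  obtain B1 where B1: "\<And>k. (\<integral>x. norm (u x - \<phi> k x) powr p \<partial>lebesgue) \<le> B1"
    using convergent_imp_Bseq[OF convergentI[OF l(1)]] unfolding Bseq_def by (auto dest: abs_le_D1)
  obtain B2 where B2: "\<And>k. (\<integral>x. norm (g x - gradient (\<phi> k) x) powr p \<partial>lebesgue) \<le> B2"
    using convergent_imp_Bseq[OF convergentI[OF l(2)]] unfolding Bseq_def by (auto dest: abs_le_D1)
  define A where "A = ennreal (2 powr p * ((\<integral>x. norm (u x) powr p \<partial>lebesgue) + B1))
     + ennreal (2 powr p * ((\<integral>x. norm (g x) powr p \<partial>lebesgue) + B2))"
  have G: "integrable lebesgue (gagliardo p s u)"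
  proof (rule gagliardo_integrable[OF p s, where \<phi> = "\<phi> \<circ> \<rho>" and \<gamma> = "\<lambda>k. gradient (\<phi> (\<rho> k))" and A = A])
    show "C1_grad ((\<phi> \<circ> \<rho>) k) (gradient (\<phi> (\<rho> k)))" for k using C by (simp add: C1c_grad_def)
    show "A < \<infinity>" by (simp add: A_def)
    show "(\<integral>\<^sup>+x. ennreal (norm (gradient (\<phi> (\<rho> k)) x) powr p) \<partial>lborel) \<le> A" for k
      unfolding A_def
      by (rule order_trans[OF nn_integral_powr_bound[OF _ c(2) ip(2,4) B2]]) (use p in auto)
    show "(\<integral>\<^sup>+x. ennreal (\<bar>(\<phi> \<circ> \<rho>) k x\<bar> powr p) \<partial>lborel) \<le> A" for k
      unfolding A_def o_def real_norm_def[symmetric]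
      by (rule order_trans[OF nn_integral_powr_bound[OF _ c(1) ip(1,3) B1]]) (use p in auto)
    show "AE x in lebesgue. (\<lambda>k. (\<phi> \<circ> \<rho>) k x) \<longlonglongrightarrow> u x" by (rule ae)
  qed (rule um)
  show ?thesis by (rule that[OF W off G \<phi> L])
qed

text \<open>Integrating by parts against a coordinate function bounds the integral by the gradient, so a
  function with vanishing gradient has zero integral.\<close>

lemma W1p_0_gradient_zero_integral:
  fixes u :: "'a::euclidean_space \<Rightarrow> real"
  assumes \<Omega>: "bounded \<Omega>"
    and i: "integrable lebesgue u" "integrable lebesgue g" and g: "AE x in lebesgue. g x = 0"
    and \<phi>: "\<And>k. \<phi> k \<in> test_functions \<Omega>"
    and L: "(\<lambda>k. \<integral>x. norm (\<phi> k x - u x) \<partial>lebesgue) \<longlonglongrightarrow> 0"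
    "(\<lambda>k. \<integral>x. norm (gradient (\<phi> k) x - g x) \<partial>lebesgue) \<longlonglongrightarrow> 0"
  shows "(\<integral>x. u x \<partial>lebesgue) = 0"
proof -
  obtain R where R: "R > 0" "\<And>x. x \<in> \<Omega> \<Longrightarrow> norm x \<le> R" using \<Omega> by (auto simp: bounded_pos)
  obtain b :: 'a where b: "b \<in> Basis" using nonempty_Basis by blast
  have C: "C1c_grad (\<phi> k) (gradient (\<phi> k))" for k by (rule test_function_C1c[OF \<phi>])
  note iC = C1c_grad_integrable_lebesgue[OF C]
  have lin: "C1_grad (\<lambda>x. x \<bullet> b) (\<lambda>x. b)"
    by (auto simp: C1_grad_def gderiv_def intro!: derivative_eq_intros)
  have bd: "\<bar>\<integral>x. \<phi> k x \<partial>lebesgue\<bar> \<le> R * (\<integral>x. norm (gradient (\<phi> k) x - g x) \<partial>lebesgue)" for k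
  proof -
    note ibp = integration_by_parts_C1[OF C[of k] lin]
    have "(\<integral>x. \<phi> k x \<partial>lborel) *\<^sub>R b = - (\<integral>x. (x \<bullet> b) *\<^sub>R gradient (\<phi> k) x \<partial>lborel)"
      using ibp(3) C1c_grad_integrable(1)[OF C[of k]] by simp
    then have "norm ((\<integral>x. \<phi> k x \<partial>lborel) *\<^sub>R b) = norm (\<integral>x. (x \<bullet> b) *\<^sub>R gradient (\<phi> k) x \<partial>lborel)" by simp
    also have "\<dots> \<le> (\<integral>x. norm ((x \<bullet> b) *\<^sub>R gradient (\<phi> k) x) \<partial>lborel)" by (rule integral_norm_bound)
    also have "\<dots> \<le> (\<integral>x. R * norm (gradient (\<phi> k) x) \<partial>lborel)"
    proof (rule integral_mono)
      show "integrable lborel (\<lambda>x. norm ((x \<bullet> b) *\<^sub>R gradient (\<phi> k) x))" using ibp(2) by (rule integrable_norm)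
      show "integrable lborel (\<lambda>x. R * norm (gradient (\<phi> k) x))"
        using C1c_grad_integrable(2)[OF C[of k]] by simp
      fix x
      show "norm ((x \<bullet> b) *\<^sub>R gradient (\<phi> k) x) \<le> R * norm (gradient (\<phi> k) x)"
      proof (cases "x \<in> \<Omega>")
        case True
        then have "\<bar>x \<bullet> b\<bar> \<le> R" using Basis_le_norm[OF b, of x] R(2)[of x] by linarith
        then show ?thesis by (simp add: mult_right_mono)
      qed (simp add: test_function_off_set[OF \<phi>])
    qed
    also have "\<dots> = (\<integral>x. R * norm (gradient (\<phi> k) x) \<partial>lebesgue)"
      using C1c_grad_integrable(2)[OF C[of k]] by (intro integral_completion[symmetric]) auto
    also have "\<dots> = (\<integral>x. R * norm (gradient (\<phi> k) x - g x) \<partial>lebesgue)"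
    proof (rule integral_cong_AE)
      show "AE x in lebesgue. R * norm (gradient (\<phi> k) x) = R * norm (gradient (\<phi> k) x - g x)"
        using g by eventually_elim simp
    qed (use iC i in auto)
    finally show ?thesis
      using b C1c_grad_integrable(1)[OF C[of k]] by (simp add: integral_completion)
  qed
  have "(\<lambda>k. \<integral>x. \<phi> k x \<partial>lebesgue) \<longlonglongrightarrow> 0"
    by (rule Lim_null_comparison[OF always_eventually]) 
      (use bd tendsto_mult_right_zero[OF L(2), of R] in auto)
  moreover have "(\<lambda>k. \<integral>x. \<phi> k x \<partial>lebesgue) \<longlonglongrightarrow> (\<integral>x. u x \<partial>lebesgue)"
    by (rule integral_tendsto_dominated_diff[where w = "\<lambda>k x. norm (\<phi> k x - u x)"]) (use iC i L in auto)
  ultimately show ?thesis by (rule LIMSEQ_unique[symmetric])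
qed

section \<open>Integrability of the nonlocal terms\<close>

lemma powr_diff_bound:
  fixes t s q M :: real
  assumes "q > 1" "0 \<le> t" "t \<le> M" "0 \<le> s" "s \<le> M"
  shows "\<bar>t powr q - s powr q\<bar> \<le> q * M powr (q - 1) * \<bar>t - s\<bar>"
proof -
  have *: "t powr q - s powr q \<le> q * M powr (q - 1) * \<bar>t - s\<bar>" "s powr q \<le> t powr q"
    if "s \<le> t" "0 \<le> s" "t \<le> M" for s t
  proof -
    show "s powr q \<le> t powr q" using that assms by (intro powr_mono2) auto
    show "t powr q - s powr q \<le> q * M powr (q - 1) * \<bar>t - s\<bar>"
    proof (cases "t = 0")
      case False
      then have "t powr q - s powr q \<le> q * t powr (q - 1) * (t - s)"
        using powr_above_tangent(1)[of q s t] that assms by (simp add: algebra_simps)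
      also have "\<dots> \<le> q * M powr (q - 1) * (t - s)"
        using that assms by (intro mult_right_mono mult_left_mono powr_mono2) auto
      finally show ?thesis using that by simp
    qed (use that in simp)
  qed
  show ?thesis using *[of s t] *[of t s] assms by (cases "s \<le> t") (auto simp: abs_minus_commute)
qed

text \<open>With \<open>t = c / a\<close> and \<open>s = d / b\<close> the quotients are \<open>a - a t\<^sup>q\<close> and \<open>b - b s\<^sup>q\<close>. Only \<open>b (t - s)\<close> is delicate,
  since \<open>b\<close> may be small while the slopes differ; but it equals \<open>(b - a) t + (c - d)\<close>.\<close>

lemma DS_ratio_Lipschitz:
  fixes a b c d :: real
  assumes r: "r > 0" and M: "M \<ge> 0"
    and ac: "(a > 0 \<and> 0 \<le> c \<and> c \<le> M * a) \<or> (a = 0 \<and> c = 0)"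
    and bd: "(b > 0 \<and> 0 \<le> d \<and> d \<le> M * b) \<or> (b = 0 \<and> d = 0)"
  shows "\<bar>DS_ratio r a c - DS_ratio r b d\<bar>
    \<le> (1 + M powr (r + 1) + (r + 1) * M powr r * (M + 1)) * (\<bar>a - b\<bar> + \<bar>c - d\<bar>)"
proof -
  define t s where "t = c / a" and "s = d / b"
  have f: "DS_ratio r x y = x - x * (y / x) powr (r + 1)" "y = x * (y / x)" "0 \<le> y / x" "y / x \<le> M" "x \<ge> 0"
    if "(x > 0 \<and> 0 \<le> y \<and> y \<le> M * x) \<or> (x = 0 \<and> y = 0)" for x y
    using that r M by (auto simp: DS_ratio_def powr_divide powr_add field_simps)
  note A = f[OF ac, folded t_def] and B = f[OF bd, folded s_def]
  let ?N = "(r + 1) * M powr r"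
  have N: "?N \<ge> 0" using r by simp
  have ts: "\<bar>t powr (r + 1) - s powr (r + 1)\<bar> \<le> ?N * \<bar>t - s\<bar>"
    using powr_diff_bound[of "r + 1" t M s] r A B by simp
  have "\<bar>b * (t powr (r + 1) - s powr (r + 1))\<bar> \<le> b * (?N * \<bar>t - s\<bar>)"
    using ts B(5) by (simp add: abs_mult mult_left_mono)
  also have "\<dots> = ?N * \<bar>b * t - b * s\<bar>"
    using B(5) by (simp add: abs_mult flip: right_diff_distrib)
  also have "b * t - b * s = (b - a) * t + (c - d)"
    using A(2) B(2) by (simp add: algebra_simps)
  also have "?N * \<bar>(b - a) * t + (c - d)\<bar> \<le> ?N * (\<bar>a - b\<bar> * M + \<bar>c - d\<bar>)"
  proof (rule mult_left_mono[OF _ N])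
    have "\<bar>(b - a) * t\<bar> \<le> \<bar>a - b\<bar> * M"
      using A by (auto simp: abs_mult abs_minus_commute intro!: mult_left_mono)
    then show "\<bar>(b - a) * t + (c - d)\<bar> \<le> \<bar>a - b\<bar> * M + \<bar>c - d\<bar>" by linarith
  qed
  finally have 1: "\<bar>b * (t powr (r + 1) - s powr (r + 1))\<bar> \<le> ?N * (\<bar>a - b\<bar> * M + \<bar>c - d\<bar>)" .
  have 2: "\<bar>(a - b) * t powr (r + 1)\<bar> \<le> \<bar>a - b\<bar> * M powr (r + 1)"
    using A r by (auto simp: abs_mult intro!: mult_left_mono powr_mono2)
  have "DS_ratio r a c - DS_ratio r b d = (a - b) - (a - b) * t powr (r + 1) - b * (t powr (r + 1) - s powr (r + 1))"
    unfolding A(1) B(1) by (simp add: algebra_simps)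
  then have "\<bar>DS_ratio r a c - DS_ratio r b d\<bar> \<le> \<bar>a - b\<bar> + \<bar>a - b\<bar> * M powr (r + 1) + ?N * (\<bar>a - b\<bar> * M + \<bar>c - d\<bar>)"
    using 1 2 by linarith
  also have "\<dots> \<le> \<bar>a - b\<bar> + \<bar>a - b\<bar> * M powr (r + 1) + ?N * (\<bar>a - b\<bar> * M + \<bar>c - d\<bar>)
     + (\<bar>c - d\<bar> + \<bar>c - d\<bar> * M powr (r + 1) + ?N * (\<bar>a - b\<bar> + M * \<bar>c - d\<bar>))"
    using N M by simp
  also have "\<dots> = (1 + M powr (r + 1) + ?N * (M + 1)) * (\<bar>a - b\<bar> + \<bar>c - d\<bar>)"
    by (simp add: algebra_simps)
  finally show ?thesis .
qed

lemma abs_signed_powr: "\<bar>signed_powr t (p - 1)\<bar> = \<bar>t\<bar> powr (p - 1)"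
  by (cases "t = 0") (simp_all add: signed_powr_def abs_mult powr_diff power2_eq_square)

lemma Times_in_sets_lebesgue:
  fixes \<omega> :: "'a::euclidean_space set"
  assumes "\<omega> \<in> sets lebesgue"
  shows "\<omega> \<times> \<omega> \<in> sets (lebesgue :: ('a \<times> 'a) measure)"
proof -
  have i: "(indicator \<omega> :: 'a \<Rightarrow> real) \<in> borel_measurable lebesgue" using assms by simp
  have "(\<lambda>z. indicator \<omega> (fst z) * indicator \<omega> (snd z) :: real) \<in> borel_measurable (lebesgue :: ('a \<times> 'a) measure)"
    using lebesgue_measurable_prod[OF i] by simp
  moreover have "(\<lambda>z. indicator \<omega> (fst z) * indicator \<omega> (snd z) :: real) = indicator (\<omega> \<times> \<omega>)"
    by (auto simp: indicator_def fun_eq_iff)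
  ultimately show ?thesis by (simp add: borel_measurable_indicator_iff)
qed

text \<open>By the upper bound on the kernel and the Lipschitz estimate, the integrand is dominated by a
  combination of the Gagliardo integrands of \<open>u\<close> and \<open>v\<close>.\<close>

lemma nonlocal_integrable:
  fixes u v :: "'a::euclidean_space \<Rightarrow> real"
  assumes \<omega>: "\<omega> \<in> sets lebesgue" and K: "fractional_kernel p s \<kappa> \<Lambda> \<omega> K"
    and p: "p > 1" and r: "r > 0" and M: "M \<ge> 0" and \<Lambda>: "\<kappa> * \<Lambda> \<ge> 0"
    and m: "u \<in> borel_measurable lebesgue" "v \<in> borel_measurable lebesgue"
    and G: "integrable lebesgue (gagliardo p s u)" "integrable lebesgue (gagliardo p s v)"
    and ae: "AE x in lebesgue. (u x > 0 \<and> 0 \<le> v x \<and> v x \<le> M * u x) \<or> (u x = 0 \<and> v x = 0)"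
  shows "set_integrable lebesgue (\<omega> \<times> \<omega>) (nonlocal_integrand p K u (DS_quotient r u v))"
  unfolding set_integrable_def
proof (rule Bochner_Integration.integrable_bound)
  let ?L = "1 + M powr (r + 1) + (r + 1) * M powr r * (M + 1)"
  have L: "?L \<ge> 0" using r M by (intro add_nonneg_nonneg mult_nonneg_nonneg) auto
  show "integrable lebesgue (\<lambda>z. \<kappa> * \<Lambda> * ?L * (2 * gagliardo p s u z + gagliardo p s v z))"
    using G by simp
  have T: "\<omega> \<times> \<omega> \<in> sets lebesgue" by (rule Times_in_sets_lebesgue[OF \<omega>])
  have "(\<lambda>z. if z \<in> \<omega> \<times> \<omega> then (\<lambda>(x, y). K x y) z else 0) \<in> borel_measurable lebesgue"
    using K T by (intro borel_measurable_if_I) (auto simp: fractional_kernel_def)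
  moreover have qm: "DS_quotient r u v \<in> borel_measurable lebesgue"
    unfolding DS_quotient_def[abs_def] using m by measurable
  ultimately have "(\<lambda>z. (if z \<in> \<omega> \<times> \<omega> then (\<lambda>(x, y). K x y) z else 0)
      * signed_powr (u (fst z) - u (snd z)) (p - 1) * (DS_quotient r u v (fst z) - DS_quotient r u v (snd z))) \<in> borel_measurable lebesgue"
    using lebesgue_measurable_prod[OF m(1)] lebesgue_measurable_prod[OF qm]
    unfolding signed_powr_def by measurable
  moreover have "(\<lambda>z. (if z \<in> \<omega> \<times> \<omega> then (\<lambda>(x, y). K x y) z else 0)
      * signed_powr (u (fst z) - u (snd z)) (p - 1) * (DS_quotient r u v (fst z) - DS_quotient r u v (snd z)))
    = (\<lambda>z. indicator (\<omega> \<times> \<omega>) z *\<^sub>R nonlocal_integrand p K u (DS_quotient r u v) z)"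
    by (auto simp: fun_eq_iff nonlocal_integrand_def indicator_def)
  ultimately show "(\<lambda>z. indicator (\<omega> \<times> \<omega>) z *\<^sub>R nonlocal_integrand p K u (DS_quotient r u v) z) \<in> borel_measurable lebesgue"
    by simp
  have "AE z in lebesgue. z \<in> \<omega> \<times> \<omega> \<longrightarrow> K (fst z) (snd z) \<le> \<kappa> * \<Lambda> / norm (fst z - snd z) powr (real DIM('a) + s * p)"
    using K T by (auto simp: fractional_kernel_def AE_restrict_space_iff elim!: eventually_mono)
  then show "AE z in lebesgue. norm (indicator (\<omega> \<times> \<omega>) z *\<^sub>R nonlocal_integrand p K u (DS_quotient r u v) z)
      \<le> norm (\<kappa> * \<Lambda> * ?L * (2 * gagliardo p s u z + gagliardo p s v z))"
    using AE_lebesgue_prod[OF ae]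
  proof eventually_elim
    case (elim z)
    obtain x y where z: "z = (x, y)" by (cases z)
    let ?n = "norm (x - y) powr (real DIM('a) + s * p)"
    have g0: "0 \<le> 2 * gagliardo p s u z + gagliardo p s v z" by (simp add: gagliardo_def)
    then have rhs: "0 \<le> \<kappa> * \<Lambda> * ?L * (2 * gagliardo p s u z + gagliardo p s v z)"
      by (rule mult_nonneg_nonneg[OF mult_nonneg_nonneg[OF \<Lambda> L]])
    show ?case
    proof (cases "z \<in> \<omega> \<times> \<omega>")
      case True
      then have k: "0 \<le> K x y" "K x y \<le> \<kappa> * \<Lambda> / ?n"
        using elim K z by (auto simp: fractional_kernel_def)
      let ?a = "\<bar>u x - u y\<bar>" and ?b = "\<bar>v x - v y\<bar>"
      have q: "\<bar>DS_quotient r u v x - DS_quotient r u v y\<bar> \<le> ?L * (?a + ?b)"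
        unfolding DS_quotient_eq by (rule DS_ratio_Lipschitz[OF r M]) (use elim z in auto)
      have ab: "?a powr (p - 1) * (?a + ?b) \<le> 2 * ?a powr p + ?b powr p"
      proof -
        have e: "c powr (p - 1) * c = c powr p" if "c \<ge> 0" for c :: real
          using that by (cases "c = 0") (auto simp: powr_diff)
        have "?a powr (p - 1) * ?b \<le> ?a powr p + ?b powr p"
        proof (cases "?b \<le> ?a")
          case True
          then have "?a powr (p - 1) * ?b \<le> ?a powr (p - 1) * ?a" by (intro mult_left_mono) auto
          then show ?thesis using e[of ?a] by (simp add: add_increasing2)
        next
          case False
          then have "?a powr (p - 1) * ?b \<le> ?b powr (p - 1) * ?b"
            using p by (intro mult_right_mono powr_mono2) auto
          then show ?thesis using e[of ?b] by (simp add: add_increasing)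
        qed
        then show ?thesis using e[of ?a] by (simp add: distrib_left)
      qed
      have "norm (indicator (\<omega> \<times> \<omega>) z *\<^sub>R nonlocal_integrand p K u (DS_quotient r u v) z)
        = K x y * (?a powr (p - 1) * \<bar>DS_quotient r u v x - DS_quotient r u v y\<bar>)"
        using True k z by (simp add: nonlocal_integrand_def abs_mult abs_signed_powr)
      also have "\<dots> \<le> (\<kappa> * \<Lambda> / ?n) * (?a powr (p - 1) * (?L * (?a + ?b)))"
        using k q \<Lambda> by (intro mult_mono) auto
      also have "\<dots> = (\<kappa> * \<Lambda> / ?n) * ?L * (?a powr (p - 1) * (?a + ?b))" by (simp add: ac_simps)
      also have "\<dots> \<le> (\<kappa> * \<Lambda> / ?n) * ?L * (2 * ?a powr p + ?b powr p)"
        by (intro mult_left_mono ab mult_nonneg_nonneg[OF _ L] divide_nonneg_nonneg \<Lambda>) simp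
      also have "\<dots> = \<kappa> * \<Lambda> * ?L * (2 * gagliardo p s u z + gagliardo p s v z)"
        by (simp add: z gagliardo_def algebra_simps add_divide_distrib)
      finally show ?thesis using rhs by simp
    qed (use rhs in simp)
  qed
qed

section \<open>The Diaz-Saa inequality\<close>

text \<open>The weak gradient on the whole space would vanish: in \<open>\<Omega>\<close> because \<open>v\<close> is constant there, and outside
  because \<open>v\<close> is extended by zero. Then \<open>v\<close> has zero integral, although it is positive on a nonempty open
  set and zero elsewhere.\<close>

lemma W1p_0_not_constant:
  fixes v :: "'a::euclidean_space \<Rightarrow> real"
  assumes \<Omega>: "open \<Omega>" "bounded \<Omega>" "\<Omega> \<noteq> {}" and p: "p > 1" and v: "v \<in> W1p_0 p \<Omega>"
    and c: "c > 0" and ae: "AE x in lebesgue. x \<in> \<Omega> \<longrightarrow> v x = c"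
  shows False
proof -
  obtain h \<phi> where W: "W11_grad v h" and off: "\<And>x. x \<notin> \<Omega> \<Longrightarrow> v x = 0" "\<And>x. x \<notin> \<Omega> \<Longrightarrow> h x = 0"
    and \<phi>: "\<And>k. \<phi> k \<in> test_functions \<Omega>"
    and L: "(\<lambda>k. \<integral>x. norm (\<phi> k x - v x) \<partial>lebesgue) \<longlonglongrightarrow> 0"
    "(\<lambda>k. \<integral>x. norm (gradient (\<phi> k) x - h x) \<partial>lebesgue) \<longlonglongrightarrow> 0"
    by (rule W1p_0_properties[OF \<Omega>(1,2) p _ _ v, of "1/2"]) auto
  have i: "integrable lebesgue v" "integrable lebesgue h" using W by (auto simp: W11_grad_def)
  have "AE x in lebesgue. x \<in> \<Omega> \<longrightarrow> h x = 0"
  proof (rule fundamental_lemma[OF \<Omega>(1) integrable_imp_locally_integrable[OF i(2)]])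
    fix \<tau> assume t: "\<tau> \<in> test_functions \<Omega>"
    then have tU: "\<tau> \<in> test_functions UNIV" by (simp add: test_functions_def)
    note C = test_function_C1c[OF t]
    have "(LINT x:\<Omega>|lebesgue. \<tau> x *\<^sub>R h x) = (\<integral>x. \<tau> x *\<^sub>R h x \<partial>lebesgue)"
      unfolding set_lebesgue_integral_def
      by (intro Bochner_Integration.integral_cong) (use off in \<open>auto simp: indicator_def\<close>)
    also have "\<dots> = - (\<integral>x. v x *\<^sub>R gradient \<tau> x \<partial>lebesgue)"
      using W11_weak_gradient[OF W] tU by (simp add: has_weak_gradient_on_def set_lebesgue_integral_def)
    also have "(\<integral>x. v x *\<^sub>R gradient \<tau> x \<partial>lebesgue) = (\<integral>x. c *\<^sub>R gradient \<tau> x \<partial>lebesgue)"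
    proof (rule integral_cong_AE)
      show "AE x in lebesgue. v x *\<^sub>R gradient \<tau> x = c *\<^sub>R gradient \<tau> x"
        using ae by eventually_elim (use test_function_off_set(2)[OF t] in force)
    qed (use i C1c_grad_integrable_lebesgue(2)[OF C] in \<open>auto intro!: borel_measurable_scaleR\<close>)
    also have "\<dots> = c *\<^sub>R (\<integral>x. gradient \<tau> x \<partial>lborel)"
      using C1c_grad_integrable(2)[OF C] by (simp add: integral_completion)
    also have "\<dots> = 0" by (simp add: integral_gradient_C1c[OF C])
    finally show "(LINT x:\<Omega>|lebesgue. \<tau> x *\<^sub>R h x) = 0" by simp
  qed
  then have h0: "AE x in lebesgue. h x = 0" by eventually_elim (use off(2) in blast)
  have int0: "(\<integral>x. v x \<partial>lebesgue) = 0"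
    by (rule W1p_0_gradient_zero_integral[OF \<Omega>(2) i h0 \<phi> L])
  have nn: "AE x in lebesgue. 0 \<le> v x"
    using ae by eventually_elim (metis c less_imp_le off(1) order_refl)
  have "AE x in lebesgue. v x = 0"
    using integral_nonneg_eq_0_iff_AE[OF i(1) nn] int0 by simp
  then have "AE x in lebesgue. x \<notin> \<Omega>" using ae by eventually_elim (use c in auto)
  then have "negligible \<Omega>" using AE_iff_null_sets[of \<Omega> lebesgue] \<Omega>(1) by (simp add: negligible_iff_null_sets)
  then show False using open_not_negligible[OF \<Omega>(1,3)] by simp
qed

text \<open>The second alternatives describe points outside \<open>\<Omega>\<close>, where both functions are extended by zero.\<close>

lemma nonlocal_DS_nonneg:
  assumes "0 < r" "r + 1 \<le> p" "(a > 0 \<and> c > 0) \<or> (a = 0 \<and> c = 0)" "(b > 0 \<and> d > 0) \<or> (b = 0 \<and> d = 0)"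
  shows "0 \<le> nonlocal_DS p r a b c d"
proof -
  consider "a > 0" "c > 0" "b > 0" "d > 0" | "a > 0" "c > 0" "b = 0" "d = 0" | "a = 0" "c = 0" "b > 0" "d > 0"
    | "a = 0" "c = 0" "b = 0" "d = 0" using assms(3,4) by blast
  then show ?thesis
  proof cases
    case 1 then show ?thesis using assms nonlocal_DS_inequality(1) by blast
  next
    case 2 then show ?thesis using assms nonlocal_DS_outside by simp
  next
    case 3 then show ?thesis using assms nonlocal_DS_outside[of b d r p] nonlocal_DS_sym(1)[of p r b 0 d 0] by simp
  next
    case 4 then show ?thesis by (simp add: nonlocal_DS_def)
  qed
qed

lemma AE_lebesgue_sections:
  assumes "AE z in (lebesgue :: ('a::euclidean_space \<times> 'a) measure). P z"
  shows "AE x in lebesgue. AE y in lebesgue. P (x, y)"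
proof -
  have "AE z in (lborel :: 'a measure) \<Otimes>\<^sub>M (lborel :: 'a measure). P z"
    using assms unfolding lborel_prod by (simp add: AE_completion_iff)
  then show ?thesis using lborel_pair.AE_pair[of P] by (simp add: AE_completion_iff)
qed

theorem lemma2p4:
  fixes \<Omega> \<omega> :: "'a::euclidean_space set"
    and H K :: "'a \<Rightarrow> 'a \<Rightarrow> real"
    and p r s \<kappa> \<Lambda> :: real
    and u v :: "'a \<Rightarrow> real"
  assumes "open \<Omega>" "connected \<Omega>" "\<Omega> \<noteq> {}" "bounded \<Omega>" "smooth_boundary \<Omega>"
    and "1 < p" "p < real DIM('a)" "0 < s" "s < 1" "0 < r" "r \<le> p - 1"
    and "0 < \<Lambda>" "0 < \<kappa>" "\<kappa> \<le> 1"
    and "\<omega> \<in> sets lebesgue"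
    and "homogeneous_integrand p \<omega> H"
    and "fractional_kernel p s \<kappa> \<Lambda> \<omega> K"
    and "u \<in> W1p_0 p \<Omega>" "v \<in> W1p_0 p \<Omega>"
    and "AE x in lebesgue_on \<Omega>. u x > 0" "AE x in lebesgue_on \<Omega>. v x > 0"
    and "Linf_on \<Omega> (\<lambda>x. u x / v x)" "Linf_on \<Omega> (\<lambda>x. v x / u x)"
    and "set_integrable lebesgue \<omega> (local_integrand H u (DS_quotient r u v))"
    and "set_integrable lebesgue \<omega> (local_integrand H v (DS_quotient r v u))"
  shows "(\<exists>g. has_weak_gradient_on (DS_quotient r u v) g UNIV) \<and>
    (\<exists>g. has_weak_gradient_on (DS_quotient r v u) g UNIV) \<and>
    set_integrable lebesgue (\<omega> \<times> \<omega>) (nonlocal_integrand p K u (DS_quotient r u v)) \<and>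
    set_integrable lebesgue (\<omega> \<times> \<omega>) (nonlocal_integrand p K v (DS_quotient r v u)) \<and>
    DS_form p r \<omega> H K u v \<ge> 0 \<and>
    (DS_form p r \<omega> H K u v = 0 \<longrightarrow>
       (\<exists>c>0. AE x in lebesgue_on (\<Omega> \<inter> \<omega>). u x / v x = c) \<and>
       (\<Omega> - \<omega> \<in> null_sets lebesgue \<longrightarrow>
          (\<exists>c>0. AE x in lebesgue_on \<Omega>. u x / v x = c) \<and>
          (r + 1 \<noteq> p \<longrightarrow> (AE x in lebesgue_on \<Omega>. u x = v x))))"
proof -
  note \<Omega> = \<open>open \<Omega>\<close> \<open>bounded \<Omega>\<close> and p = \<open>1 < p\<close> and s = \<open>0 < s\<close> \<open>s < 1\<close> and r = \<open>0 < r\<close>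
  note \<omega> = \<open>\<omega> \<in> sets lebesgue\<close> and H = \<open>homogeneous_integrand p \<omega> H\<close> and K = \<open>fractional_kernel p s \<kappa> \<Lambda> \<omega> K\<close>
  note loc = \<open>set_integrable lebesgue \<omega> (local_integrand H u (DS_quotient r u v))\<close>
    \<open>set_integrable lebesgue \<omega> (local_integrand H v (DS_quotient r v u))\<close>
  have rp: "r + 1 \<le> p" using \<open>r \<le> p - 1\<close> by simp
  have O: "\<Omega> \<in> sets lebesgue" using \<Omega> by simp
  have KL: "\<kappa> * \<Lambda> \<ge> 0" using \<open>0 < \<kappa>\<close> \<open>0 < \<Lambda>\<close> by simp
  obtain g where Wu: "W11_grad u g" and offu: "\<And>x. x \<notin> \<Omega> \<Longrightarrow> u x = 0" "\<And>x. x \<notin> \<Omega> \<Longrightarrow> g x = 0"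
    and Gu: "integrable lebesgue (gagliardo p s u)"
    by (rule W1p_0_properties[OF \<Omega> p s \<open>u \<in> W1p_0 p \<Omega>\<close>]) (rule that; assumption)
  obtain h where Wv: "W11_grad v h" and offv: "\<And>x. x \<notin> \<Omega> \<Longrightarrow> v x = 0" "\<And>x. x \<notin> \<Omega> \<Longrightarrow> h x = 0"
    and Gv: "integrable lebesgue (gagliardo p s v)"
    by (rule W1p_0_properties[OF \<Omega> p s \<open>v \<in> W1p_0 p \<Omega>\<close>]) (rule that; assumption)
  have m: "u \<in> borel_measurable lebesgue" "v \<in> borel_measurable lebesgue"
    using Wu Wv by (auto simp: W11_grad_def)
  obtain M1 where M1: "AE x in lebesgue_on \<Omega>. \<bar>u x / v x\<bar> \<le> M1"
    using \<open>Linf_on \<Omega> (\<lambda>x. u x / v x)\<close> by (auto simp: Linf_on_def)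
  obtain M2 where M2: "AE x in lebesgue_on \<Omega>. \<bar>v x / u x\<bar> \<le> M2"
    using \<open>Linf_on \<Omega> (\<lambda>x. v x / u x)\<close> by (auto simp: Linf_on_def)
  define M where "M = max 1 (max M1 M2)"
  have M: "M \<ge> 1" by (simp add: M_def)
  have good: "AE x in lebesgue. (x \<in> \<Omega> \<and> u x > 0 \<and> v x > 0 \<and> v x \<le> M * u x \<and> u x \<le> M * v x)
     \<or> (x \<notin> \<Omega> \<and> u x = 0 \<and> v x = 0 \<and> g x = 0 \<and> h x = 0)"
  proof -
    have "AE x in lebesgue_on \<Omega>. u x > 0 \<and> v x > 0 \<and> v x \<le> M * u x \<and> u x \<le> M * v x"
      using \<open>AE x in lebesgue_on \<Omega>. u x > 0\<close> \<open>AE x in lebesgue_on \<Omega>. v x > 0\<close> M1 M2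
    proof eventually_elim
      case (elim x)
      have "u x / v x \<le> M" "v x / u x \<le> M" using elim by (auto simp: M_def)
      then show ?case using elim by (simp add: pos_divide_le_eq)
    qed
    then have "AE x in lebesgue. x \<in> \<Omega> \<longrightarrow> u x > 0 \<and> v x > 0 \<and> v x \<le> M * u x \<and> u x \<le> M * v x"
      by (rule AE_restrict_space_iff[THEN iffD1, rotated]) (use O in simp)
    then show ?thesis by eventually_elim (use offu offv in blast)
  qed
  let ?Du = "\<lambda>x. (1 + r * (v x / u x) powr (r + 1)) *\<^sub>R g x - ((r + 1) * (v x / u x) powr r) *\<^sub>R h x"
  let ?Dv = "\<lambda>x. (1 + r * (u x / v x) powr (r + 1)) *\<^sub>R h x - ((r + 1) * (u x / v x) powr r) *\<^sub>R g x"
  let ?\<phi> = "DS_quotient r u v" and ?\<psi> = "DS_quotient r v u"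
  have wu: "has_weak_gradient_on ?\<phi> ?Du UNIV"
    by (rule DS_quotient_weak_gradient[OF Wu Wv r M]) (use good in eventually_elim, blast)
  have wv: "has_weak_gradient_on ?\<psi> ?Dv UNIV"
    by (rule DS_quotient_weak_gradient[OF Wv Wu r M]) (use good in eventually_elim, blast)
  have nlu: "set_integrable lebesgue (\<omega> \<times> \<omega>) (nonlocal_integrand p K u ?\<phi>)"
    by (rule nonlocal_integrable[OF \<omega> K p r _ KL m Gu Gv, of M])
      (use M good in \<open>auto elim!: eventually_mono\<close>)
  have nlv: "set_integrable lebesgue (\<omega> \<times> \<omega>) (nonlocal_integrand p K v ?\<psi>)"
    by (rule nonlocal_integrable[OF \<omega> K p r _ KL m(2,1) Gv Gu, of M])
      (use M good in \<open>auto elim!: eventually_mono\<close>)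
  have wg: "AE x in lebesgue. weak_grad u x = g x" "AE x in lebesgue. weak_grad v x = h x"
    "AE x in lebesgue. weak_grad ?\<phi> x = ?Du x" "AE x in lebesgue. weak_grad ?\<psi> x = ?Dv x"
    using weak_grad_on_AE_eq[OF open_UNIV W11_weak_gradient[OF Wu]] weak_grad_on_AE_eq[OF open_UNIV W11_weak_gradient[OF Wv]]
      weak_grad_on_AE_eq[OF open_UNIV wu] weak_grad_on_AE_eq[OF open_UNIV wv] by auto
  have local_nonneg: "AE x in lebesgue. 0 \<le> indicator \<omega> x *\<^sub>R (local_integrand H u ?\<phi> x + local_integrand H v ?\<psi> x)"
    using good wg
  proof eventually_elim
    case (elim x)
    show ?case
    proof (cases "x \<in> \<omega>")
      case True
      have "0 \<le> local_integrand H u ?\<phi> x + local_integrand H v ?\<psi> x"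
        using elim(1)
      proof
        assume pos: "x \<in> \<Omega> \<and> u x > 0 \<and> v x > 0 \<and> v x \<le> M * u x \<and> u x \<le> M * v x"
        have "(u x / v x) powr t = (v x / u x) powr (- t)" for t
          using pos by (simp add: powr_minus powr_divide)
        moreover have "0 \<le> gradient (H x) (g x) \<bullet> ((1 + r * (v x / u x) powr (r + 1)) *\<^sub>R g x - ((r + 1) * (v x / u x) powr r) *\<^sub>R h x)
          + gradient (H x) (h x) \<bullet> ((1 + r * (v x / u x) powr (- (r + 1))) *\<^sub>R h x - ((r + 1) * (v x / u x) powr (- r)) *\<^sub>R g x)"
          using H True pos r rp differentiable_GDERIV(2)[of "H x"]
          by (intro local_DS_inequality[of "H x"]) (auto simp: homogeneous_integrand_def)
        ultimately show ?thesis by (simp add: local_integrand_def elim)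
      next
        assume "x \<notin> \<Omega> \<and> u x = 0 \<and> v x = 0 \<and> g x = 0 \<and> h x = 0"
        then show ?thesis by (simp add: local_integrand_def elim)
      qed
      then show ?thesis by simp
    qed simp
  qed
  have nl_eq: "nonlocal_integrand p K u ?\<phi> z + nonlocal_integrand p K v ?\<psi> z
      = K (fst z) (snd z) * nonlocal_DS p r (u (fst z)) (u (snd z)) (v (fst z)) (v (snd z))" for z
    by (cases z) (simp add: nonlocal_integrand_def nonlocal_DS_def DS_quotient_eq algebra_simps)
  have nl_nonneg: "AE z in lebesgue. 0 \<le> indicator (\<omega> \<times> \<omega>) z *\<^sub>R (nonlocal_integrand p K u ?\<phi> z + nonlocal_integrand p K v ?\<psi> z)"
    using AE_lebesgue_prod[OF good]
  proof eventually_elim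
    case (elim z)
    have "0 \<le> nonlocal_DS p r (u (fst z)) (u (snd z)) (v (fst z)) (v (snd z))"
      by (rule nonlocal_DS_nonneg[OF r rp]) (use elim in auto)
    moreover have "0 \<le> K (fst z) (snd z)" if "z \<in> \<omega> \<times> \<omega>"
      using K that by (auto simp: fractional_kernel_def)
    ultimately show ?case unfolding nl_eq by (simp add: indicator_def)
  qed
  define I where "I = (\<integral>x. indicator \<omega> x *\<^sub>R (local_integrand H u ?\<phi> x + local_integrand H v ?\<psi> x) \<partial>lebesgue)"
  define J where "J = (\<integral>z. indicator (\<omega> \<times> \<omega>) z *\<^sub>R (nonlocal_integrand p K u ?\<phi> z + nonlocal_integrand p K v ?\<psi> z) \<partial>lebesgue)"
  have nlint: "integrable lebesgue (\<lambda>z. indicator (\<omega> \<times> \<omega>) z *\<^sub>R (nonlocal_integrand p K u ?\<phi> z + nonlocal_integrand p K v ?\<psi> z))"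
    using set_integral_add(1)[OF nlu nlv] by (simp add: set_integrable_def)
  have form: "DS_form p r \<omega> H K u v = I + J"
    using set_integral_add(2)[OF loc] set_integral_add(2)[OF nlu nlv]
    by (simp add: DS_form_def I_def J_def set_lebesgue_integral_def)
  have IJ: "0 \<le> I" "0 \<le> J"
    unfolding I_def J_def using local_nonneg nl_nonneg by (auto intro: integral_nonneg_AE)
  have eq: "\<exists>c>0. (AE x in lebesgue. x \<in> \<Omega> \<inter> \<omega> \<longrightarrow> u x / v x = c) \<and>
      (r + 1 \<noteq> p \<longrightarrow> \<Omega> - \<omega> \<in> null_sets lebesgue \<longrightarrow> (AE x in lebesgue. x \<in> \<Omega> \<longrightarrow> u x = v x))"
    if zero: "DS_form p r \<omega> H K u v = 0"
  proof -
    \<comment> \<open>Both parts are nonnegative, so the nonlocal one vanishes and its integrand is zero almost everywhere.\<close>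
    have "J = 0" using zero form IJ by simp
    then have "AE z in lebesgue. indicator (\<omega> \<times> \<omega>) z *\<^sub>R (nonlocal_integrand p K u ?\<phi> z + nonlocal_integrand p K v ?\<psi> z) = 0"
      using integral_nonneg_eq_0_iff_AE[OF nlint nl_nonneg] by (simp add: J_def)
    moreover have "AE z in lebesgue. z \<in> \<omega> \<times> \<omega> \<longrightarrow> \<kappa> / (\<Lambda> * norm (fst z - snd z) powr (real DIM('a) + s * p)) \<le> K (fst z) (snd z)"
      using K Times_in_sets_lebesgue[OF \<omega>]
      by (auto simp: fractional_kernel_def AE_restrict_space_iff elim!: eventually_mono)
    ultimately have "AE z in lebesgue. fst z \<in> \<Omega> \<inter> \<omega> \<longrightarrow> snd z \<in> \<Omega> \<inter> \<omega> \<longrightarrow>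
        u (fst z) / v (fst z) = u (snd z) / v (snd z) \<and>
        (r + 1 \<noteq> p \<longrightarrow> \<bar>u (fst z) - u (snd z)\<bar> = \<bar>v (fst z) - v (snd z)\<bar>)"
      using AE_lebesgue_prod[OF good]
    proof eventually_elim
      case (elim z)
      show ?case
      proof (intro impI)
        assume in_: "fst z \<in> \<Omega> \<inter> \<omega>" "snd z \<in> \<Omega> \<inter> \<omega>"
        then have zz: "z \<in> \<omega> \<times> \<omega>" by (cases z) auto
        show "u (fst z) / v (fst z) = u (snd z) / v (snd z) \<and>
          (r + 1 \<noteq> p \<longrightarrow> \<bar>u (fst z) - u (snd z)\<bar> = \<bar>v (fst z) - v (snd z)\<bar>)"
        proof (cases "fst z = snd z")
          case False
          then have "0 < \<kappa> / (\<Lambda> * norm (fst z - snd z) powr (real DIM('a) + s * p))"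
            using \<open>0 < \<kappa>\<close> \<open>0 < \<Lambda>\<close> by simp
          then have "0 < K (fst z) (snd z)" using elim zz by (auto intro: less_le_trans)
          then have "nonlocal_DS p r (u (fst z)) (u (snd z)) (v (fst z)) (v (snd z)) = 0"
            using elim(1) zz unfolding nl_eq by simp
          then show ?thesis
            using nonlocal_DS_inequality(2,3)[OF _ _ _ _ r rp, of "u (fst z)" "u (snd z)" "v (fst z)" "v (snd z)"]
              elim in_ by blast
        qed simp
      qed
    qed
    from AE_lebesgue_sections[OF this]
    have sec: "AE x in lebesgue. AE y in lebesgue. x \<in> \<Omega> \<inter> \<omega> \<longrightarrow> y \<in> \<Omega> \<inter> \<omega> \<longrightarrow>
        u x / v x = u y / v y \<and> (r + 1 \<noteq> p \<longrightarrow> \<bar>u x - u y\<bar> = \<bar>v x - v y\<bar>)" by simp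
    show ?thesis
    proof (cases "AE x in lebesgue. x \<notin> \<Omega> \<inter> \<omega>")
      case True
      have "AE x in lebesgue. x \<in> \<Omega> \<longrightarrow> u x = v x" if "\<Omega> - \<omega> \<in> null_sets lebesgue"
        using AE_not_in[OF that] True by eventually_elim blast
      moreover have "AE x in lebesgue. x \<in> \<Omega> \<inter> \<omega> \<longrightarrow> u x / v x = 1"
        using True by eventually_elim blast
      ultimately show ?thesis by (intro exI[of _ 1]) auto
    next
      case False
      \<comment> \<open>Almost every section is generic, so a set of positive measure contains a base point \<open>x\<^sub>0\<close> with which
        almost all other points can be compared.\<close>
      have "\<exists>x0. x0 \<in> \<Omega> \<inter> \<omega> \<and> u x0 > 0 \<and> v x0 > 0 \<and> (AE y in lebesgue. x0 \<in> \<Omega> \<inter> \<omega> \<longrightarrow> y \<in> \<Omega> \<inter> \<omega> \<longrightarrow>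
        u x0 / v x0 = u y / v y \<and> (r + 1 \<noteq> p \<longrightarrow> \<bar>u x0 - u y\<bar> = \<bar>v x0 - v y\<bar>))"
      proof (rule ccontr)
        assume no: "\<not> ?thesis"
        have "AE x in lebesgue. x \<notin> \<Omega> \<inter> \<omega>"
          using sec good by eventually_elim (use no in blast)
        then show False using False by simp
      qed
      then obtain x0 where x0: "x0 \<in> \<Omega> \<inter> \<omega>" "u x0 > 0" "v x0 > 0"
        and ae0: "AE y in lebesgue. y \<in> \<Omega> \<inter> \<omega> \<longrightarrow>
        u x0 / v x0 = u y / v y \<and> (r + 1 \<noteq> p \<longrightarrow> \<bar>u x0 - u y\<bar> = \<bar>v x0 - v y\<bar>)" by auto
      define c where "c = u x0 / v x0"
      have c: "c > 0" using x0 by (simp add: c_def)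
      have "AE x in lebesgue. x \<in> \<Omega> \<inter> \<omega> \<longrightarrow> u x / v x = c"
        using ae0 by eventually_elim (simp add: c_def)
      moreover have "AE x in lebesgue. x \<in> \<Omega> \<longrightarrow> u x = v x" if ne: "r + 1 \<noteq> p" and nul: "\<Omega> - \<omega> \<in> null_sets lebesgue"
      proof (cases "c = 1")
        case True
        show ?thesis using ae0 AE_not_in[OF nul] good
        proof eventually_elim
          case (elim y)
          show ?case
          proof
            assume y: "y \<in> \<Omega>"
            then have "v y > 0" "u y / v y = 1" using elim True by (auto simp: c_def)
            then show "u y = v y" by simp
          qed
        qed
      next
        case False
        have "AE y in lebesgue. y \<in> \<Omega> \<longrightarrow> v y = v x0"
          using ae0 AE_not_in[OF nul] good
        proof eventually_elim
          case (elim y)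
          show ?case
          proof
            assume y: "y \<in> \<Omega>"
            then have y': "v y > 0" "u y / v y = c" "\<bar>u x0 - u y\<bar> = \<bar>v x0 - v y\<bar>"
              using elim ne by (auto simp: c_def)
            then have "u y = c * v y" "u x0 = c * v x0" using x0 by (auto simp: c_def field_simps)
            then have "\<bar>c * (v x0 - v y)\<bar> = \<bar>v x0 - v y\<bar>" using y'(3) by (simp add: right_diff_distrib)
            then have "c * \<bar>v x0 - v y\<bar> = 1 * \<bar>v x0 - v y\<bar>" using c by (simp add: abs_mult)
            then show "v y = v x0" using False by simp
          qed
        qed
        then have False by (rule W1p_0_not_constant[OF \<Omega> \<open>\<Omega> \<noteq> {}\<close> p \<open>v \<in> W1p_0 p \<Omega>\<close> x0(3)])
        then show ?thesis ..
      qed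
      ultimately show ?thesis using c by blast
    qed
  qed
  show ?thesis
  proof (intro conjI impI)
    show "\<exists>g. has_weak_gradient_on ?\<phi> g UNIV" "\<exists>g. has_weak_gradient_on ?\<psi> g UNIV" using wu wv by blast+
    show "set_integrable lebesgue (\<omega> \<times> \<omega>) (nonlocal_integrand p K u ?\<phi>)"
      "set_integrable lebesgue (\<omega> \<times> \<omega>) (nonlocal_integrand p K v ?\<psi>)" by (fact nlu nlv)+
    show "0 \<le> DS_form p r \<omega> H K u v" using form IJ by simp
  next
    assume zero: "DS_form p r \<omega> H K u v = 0"
    obtain c where c: "c > 0" "AE x in lebesgue. x \<in> \<Omega> \<inter> \<omega> \<longrightarrow> u x / v x = c" using eq[OF zero] by blast
    have S: "\<Omega> \<inter> \<omega> \<in> sets lebesgue" using O \<omega> by auto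
    show "\<exists>c>0. AE x in lebesgue_on (\<Omega> \<inter> \<omega>). u x / v x = c"
      using c S by (intro exI[of _ c]) (simp add: AE_restrict_space_iff)
    assume nul: "\<Omega> - \<omega> \<in> null_sets lebesgue"
    have "AE x in lebesgue. x \<in> \<Omega> \<longrightarrow> u x / v x = c"
      using c(2) AE_not_in[OF nul] by eventually_elim blast
    then show "\<exists>c>0. AE x in lebesgue_on \<Omega>. u x / v x = c"
      using c(1) O by (intro exI[of _ c]) (simp add: AE_restrict_space_iff)
    assume "r + 1 \<noteq> p"
    then show "AE x in lebesgue_on \<Omega>. u x = v x"
      using eq[OF zero] nul O by (auto simp: AE_restrict_space_iff)
  qed
qed

end
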